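(* Assume that $(V,T)$ is a (C1)-Jordan triple system. (i) The associated set $M^{(p)}$ of non-isotropic points is an open submanifold of $X=X^+$ containing the base point $o=o^+$, and together with the multiplication map $m:M^{(p)}\times M^{(p)}\to M^{(p)}$, $m(x,y)=\mu_{-1}(x,p(x),y)$, it is a symmetric space. Moreover, for all $x\in M^{(p)}$, $x$ is an isolated fixed point of the symmetry $\sigma_x=m(x,\cdot)$. (ii) The Lie triple system associated to $(M^{(p)},o)$ is the vector space $V=V^+$ together with the bracket given by $$[X,Y,Z]=T(X,Y,Z)-T(Y,X,Z).$$
   Context: Throughout, $\mathbb{K}$ is a commutative topological ring with unit $1$ (ring operations continuous, unit group $\mathbb{K}^\times$ open, inversion on $\mathbb{K}^\times$ continuous) such that $\mathbb{K}^\times$ is dense in $\mathbb{K}$ and $2$ is invertible. Topological $\mathbb{K}$-modules are assumed Hausdorff; $C^0$ means continuous. Calculus: for topological $\mathbb{K}$-modules $V,W$ and $U\subset V$ open, $f:U\to W$ is $C^1$ if there is a continuous map $f^{[1]}:\{(x,v,t)\in U\times V\times\mathbb{K}: x+tv\in U\}\to W$ with $f(x+tv)-f(x)=t\,f^{[1]}(x,v,t)$; then $df(x)v:=f^{[1]}(x,v,0)$. $f$ is $C^{k+1}$ if it is $C^1$ and $f^{[1]}$ is $C^k$; smooth means $C^k$ for all $k$. A smooth manifold modeled on a topological $\mathbb{K}$-module $E$ is a topological space with an atlas of charts onto open subsets of $E$ with smooth transition functions; smooth maps, tangent bundle $TM$, tangent maps $Tf$ are defined as usual. The Lie bracket of vector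 fields is given in a chart by $[X,Y](x)=dY(x)X(x)-dX(x)Y(x)$. Symmetric space: a smooth manifold $M$ with a smooth map $m:M\times M\to M$ such that, with $\sigma_x:=m(x,\cdot)$: $m(x,x)=x$; $m(x,m(x,y))=y$; $m(x,m(y,z))=m(m(x,y),m(x,z))$; $T_x(\sigma_x)=-\mathrm{id}_{T_xM}$. Given a base point $o\in M$ and $v\in T_oM$, let $\tilde v$ be the vector field $\tilde v(p)=\frac12\,Tm(v,Tm(0_o,0_p))\in T_pM$ (it satisfies $\tilde v(o)=v$), where $0_p$ is the zero vector of $T_pM$. The Lie triple system associated to $(M,o)$ is $T_oM$ with $[u,v,w]:=[[\tilde u,\tilde v],\tilde w](o)$. Setup: let $\mathfrak g=\mathfrak g_1\oplus\mathfrak g_0\oplus\mathfrak g_{-1}$ be a Lie algebra over $\mathbb K$ with $[\mathfrak g_k,\mathfrak g_l]\subset\mathfrak g_{k+l}$, whose grading derivation $D$ ($DX=iX$ on $\mathfrak g_i$) is inner, $D=\mathrm{ad}(E)$, and let $\theta$ be an involution of $(\mathfrak g,D)$, i.e. an automorphism of $\mathfrak g$ of order 2 with $\theta(\mathfrak g_i)=\mathfrak g_{-i}$. Then $V=V^+:=\mathfrak g_1$ with $T(x,y,z)=[[x,\theta(y)],z]$ is a Jordan triple system, i.e. $T$ is trilinear, $T(x,y,z)=T(z,y,x)$ and, writing $T(x,y)z=T(x,y,z)$, $T(x,y)T(u,v,w)=T(T(x,y)u,v,w)-T(u,T(y,x)v,w)+T(u,v,T(x,y)w)$; every Jordan triple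 system arises this way, and such $(\mathfrak g,D,\theta)$ is fixed for the given $(V,T)$. (C1)-Jordan triple system (continuous quasi-inverse Jts): $V$ is a topological $\mathbb K$-module, $T$ is continuous, and with $Q(x)y=\frac12T(x,y,x)$ and Bergman operators $B(x,y)z=z-T(x,y,z)+Q(x)Q(y)z$, the set $(V\times V)^\times=\{(x,y):B(x,y),B(y,x)\text{ invertible}\}$ is open in $V\times V$ and $(V\times V)^\times\times V\to V$, $(x,y,v)\mapsto B(x,y)^{-1}v$ is continuous. The module $V^-:=\mathfrak g_{-1}$ is topologized by requiring $\theta:V\to V^-$ to be a homeomorphism. Projective completion: for $x\in\mathfrak g_{\pm1}$, $e^{\mathrm{ad}x}=1+\mathrm{ad}x+\frac12(\mathrm{ad}x)^2\in\mathrm{Aut}(\mathfrak g)$; $G\subset\mathrm{Aut}(\mathfrak g)$ is the group generated by these. Let $o^+$ be the flag $0\subset\mathfrak g_{-1}\subset\mathfrak g_{-1}\oplus\mathfrak g_0\subset\mathfrak g$, $o^-$ the flag $0\subset\mathfrak g_1\subset\mathfrak g_1\oplus\mathfrak g_0\subset\mathfrak g$, and $X^\pm:=G.o^\pm$. $V^\pm$ is identified with a subset of $X^\pm$ via the injection $x\mapsto e^{\mathrm{ad}(x)}.o^\pm$. $X^\pm$ carries the unique smooth manifold structure for which the charts $g(V^\pm)\to V^\pm$, $g.x\mapsto x$ ($g\in G$) form an atlas. $T_oX^+$ is identified with $V^+$ via the chart $V^+$. Flags $\mathfrak f=(\mathfrak f_1\subset\mathfrak f_0)$, $\mathfrak e=(\mathfrak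 e_1\subset\mathfrak e_0)$ are transversal if $\mathfrak g=\mathfrak f_1\oplus\mathfrak e_0=\mathfrak e_1\oplus\mathfrak f_0$. Polarity: $p:X^+\to X^-$ is the bijection induced by $\theta$, $p(\mathfrak f)=\theta(\mathfrak f)$ (image of the flag), and $M^{(p)}:=\{x\in X^+: x\text{ and }p(x)\text{ are transversal}\}$. The map $\mu_{-1}$: for a transversal pair $(x,a)=(g.o^+,g.o^-)\in X^+\times X^-$ ($g\in G$), the set $g(V^+)\subset X^+$ of elements transversal to $a$ is an affine space over $\mathbb K$, and for $y$ in this set $\mu_{-1}(x,a,y)$ is $-y$ in the $\mathbb K$-module $g(V^+)$ with zero vector $x$. This map $y\mapsto\mu_{-1}(x,a,y)$ extends to all $y\in X^+$ as the transformation $y\mapsto g\,\delta\, g^{-1}.y$, where $\delta\in\mathrm{Aut}(\mathfrak g)$ is $-\mathrm{id}$ on $\mathfrak g_{\pm1}$ and $\mathrm{id}$ on $\mathfrak g_0$; this extension is meant in the definition of $m$. *)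

theory Defs
  imports "HOL-Analysis.Analysis"
begin

section \<open>Base rings and topological modules\<close>

definition ring_inverse :: "'k::comm_ring_1 \<Rightarrow> 'k" where
  "ring_inverse u = (THE w. u * w = 1)"

class topological_comm_ring_1 = comm_ring_1 + topological_ab_group_add + topological_monoid_mult

text \<open>Units are the divisors of 1.  The ring itself is not required to be Hausdorff; topological
  modules are.\<close>

definition calculus_ring :: "'k::topological_comm_ring_1 itself \<Rightarrow> bool" where
  "calculus_ring _ \<longleftrightarrow>
     open {u::'k. u dvd 1} \<and> closure {u::'k. u dvd 1} = UNIV \<and>
     continuous_on {u::'k. u dvd 1} ring_inverse \<and> (2::'k) dvd 1"

abbreviation half :: "'k::comm_ring_1" where
  "half \<equiv> ring_inverse 2"

text \<open>The carrier of a topological module is the underlying set of its topology, a submodule of the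
  ambient type.\<close>

record ('k, 'e) tmodule =
  scal :: "'k \<Rightarrow> 'e \<Rightarrow> 'e"
  mod_top :: "'e topology"

abbreviation carr :: "('k, 'e, 'z) tmodule_scheme \<Rightarrow> 'e set" where
  "carr E \<equiv> topspace (mod_top E)"

definition topological_module :: "('k::topological_comm_ring_1, 'e::ab_group_add) tmodule \<Rightarrow> bool" where
  "topological_module E \<longleftrightarrow>
     module (scal E) \<and> module.subspace (scal E) (carr E) \<and>
     Hausdorff_space (mod_top E) \<and>
     continuous_map (prod_topology (mod_top E) (mod_top E)) (mod_top E) (\<lambda>(x, y). x + y) \<and>
     continuous_map (prod_topology euclidean (mod_top E)) (mod_top E) (\<lambda>(t, x). scal E t x)"

definition prod_module ::
    "('k::topological_comm_ring_1, 'e::ab_group_add) tmodule \<Rightarrow> ('k, 'f::ab_group_add) tmodule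
      \<Rightarrow> ('k, 'e \<times> 'f) tmodule" where
  "prod_module E F = \<lparr>scal = module_prod.scale (scal E) (scal F),
                      mod_top = prod_topology (mod_top E) (mod_top F)\<rparr>"

section \<open>Differential calculus over the base ring\<close>

text \<open>The definition of \<open>C\<^sup>k\<close> recurses over the modules \<open>E\<^sub>0 = E\<close>, \<open>E\<^sub>n\<^sub>+\<^sub>1 = E\<^sub>n \<times> E\<^sub>n \<times> K\<close>, whose
  types differ.  The type below contains all of them: the elements of \<open>E\<^sub>n\<close> are the complete
  trees of depth \<open>n\<close>, with \<open>Node x v t\<close> for the triple \<open>(x, v, t)\<close>.\<close>

datatype ('k, 'e) iter =
    Leaf (leaf: 'e)
  | Node (pnt: "('k, 'e) iter") (dir: "('k, 'e) iter") (par: 'k)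

fun iter_add :: "('k::comm_ring_1, 'e::ab_group_add) iter \<Rightarrow> ('k, 'e) iter \<Rightarrow> ('k, 'e) iter" where
  "iter_add (Leaf x) (Leaf y) = Leaf (x + y)"
| "iter_add (Node x v s) (Node y w t) = Node (iter_add x y) (iter_add v w) (s + t)"
| "iter_add _ _ = undefined"

primrec iter_scal ::
    "('k::comm_ring_1, 'e::ab_group_add) tmodule \<Rightarrow> 'k \<Rightarrow> ('k, 'e) iter \<Rightarrow> ('k, 'e) iter" where
  "iter_scal E t (Leaf x) = Leaf (scal E t x)"
| "iter_scal E t (Node x v s) = Node (iter_scal E t x) (iter_scal E t v) (t * s)"

primrec iter_top :: "('k::topological_comm_ring_1, 'e::ab_group_add) tmodule \<Rightarrow> nat \<Rightarrow> ('k, 'e) iter topology"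
  where
  "iter_top E 0 = pullback_topology (range Leaf) leaf (mod_top E)"
| "iter_top E (Suc n) =
     pullback_topology {Node x v t | x v t. True} (\<lambda>z. (pnt z, dir z, par z))
       (prod_topology (iter_top E n) (prod_topology (iter_top E n) euclidean))"

definition quot_dom ::
    "('k::topological_comm_ring_1, 'e::ab_group_add) tmodule \<Rightarrow> nat \<Rightarrow> ('k, 'e) iter set \<Rightarrow> ('k, 'e) iter set"
  where
  "quot_dom E n U =
     {Node x v t | x v t. x \<in> U \<and> v \<in> topspace (iter_top E n) \<and> iter_add x (iter_scal E t v) \<in> U}"

text \<open>\<open>g\<close> is the map \<open>f\<^bsup>[1]\<^esup>\<close> of \<open>f\<close>, where \<open>f\<close> is defined on the subset \<open>U\<close> of \<open>E\<^sub>n\<close>.  It is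
  unique for open \<open>U\<close>, since units are dense and \<open>F\<close> is Hausdorff.\<close>

definition is_quotient_map ::
    "('k::topological_comm_ring_1, 'e::ab_group_add) tmodule \<Rightarrow> ('k, 'f::ab_group_add) tmodule \<Rightarrow> nat
      \<Rightarrow> ('k, 'e) iter set \<Rightarrow> (('k, 'e) iter \<Rightarrow> 'f) \<Rightarrow> (('k, 'e) iter \<Rightarrow> 'f) \<Rightarrow> bool" where
  "is_quotient_map E F n U f g \<longleftrightarrow>
     continuous_map (subtopology (iter_top E (Suc n)) (quot_dom E n U)) (mod_top F) g \<and>
     (\<forall>x v t. Node x v t \<in> quot_dom E n U \<longrightarrow>
        f (iter_add x (iter_scal E t v)) - f x = scal F t (g (Node x v t)))"

primrec Ck_on ::
    "('k::topological_comm_ring_1, 'e::ab_group_add) tmodule \<Rightarrow> ('k, 'f::ab_group_add) tmodule \<Rightarrow> nat \<Rightarrow> nat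
      \<Rightarrow> ('k, 'e) iter set \<Rightarrow> (('k, 'e) iter \<Rightarrow> 'f) \<Rightarrow> bool" where
  "Ck_on E F 0 n U f \<longleftrightarrow> continuous_map (subtopology (iter_top E n) U) (mod_top F) f"
| "Ck_on E F (Suc k) n U f \<longleftrightarrow>
     continuous_map (subtopology (iter_top E n) U) (mod_top F) f \<and>
     (\<exists>g. is_quotient_map E F n U f g \<and> Ck_on E F k (Suc n) (quot_dom E n U) g)"

definition smooth_on ::
    "('k::topological_comm_ring_1, 'e::ab_group_add) tmodule \<Rightarrow> ('k, 'f::ab_group_add) tmodule
      \<Rightarrow> 'e set \<Rightarrow> ('e \<Rightarrow> 'f) \<Rightarrow> bool" where
  "smooth_on E F U f \<longleftrightarrow>
     openin (mod_top E) U \<and> (\<forall>k. Ck_on E F k 0 (Leaf ` U) (\<lambda>z. f (leaf z)))"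

text \<open>\<open>df(x)v = f\<^bsup>[1]\<^esup>(x, v, 0)\<close> for \<open>f\<close> on the open set \<open>U\<close>.\<close>

definition differential ::
    "('k::topological_comm_ring_1, 'e::ab_group_add) tmodule \<Rightarrow> ('k, 'f::ab_group_add) tmodule
      \<Rightarrow> 'e set \<Rightarrow> ('e \<Rightarrow> 'f) \<Rightarrow> 'e \<Rightarrow> 'e \<Rightarrow> 'f" where
  "differential E F U f x v =
     (THE w. \<exists>g. is_quotient_map E F 0 (Leaf ` U) (\<lambda>z. f (leaf z)) g \<and>
                 w = g (Node (Leaf x) (Leaf v) 0))"

section \<open>Smooth manifolds\<close>

text \<open>A chart is a domain with a map, the values of which outside the domain are irrelevant.\<close>

type_synonym ('m, 'e) chart = "'m set \<times> ('m \<Rightarrow> 'e)"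

record ('k, 'e, 'm) mfd =
  model :: "('k, 'e) tmodule"
  mfd_top :: "'m topology"
  atlas :: "('m, 'e) chart set"

abbreviation pts :: "('k, 'e, 'm, 'z) mfd_scheme \<Rightarrow> 'm set" where
  "pts M \<equiv> topspace (mfd_top M)"

definition chart_inv :: "('m, 'e) chart \<Rightarrow> 'e \<Rightarrow> 'm" where
  "chart_inv c = the_inv_into (fst c) (snd c)"

definition loc_dom :: "('m, 'e) chart \<Rightarrow> ('m \<Rightarrow> 'n) \<Rightarrow> ('n, 'f) chart \<Rightarrow> 'e set" where
  "loc_dom c f c' = snd c ` {p \<in> fst c. f p \<in> fst c'}"

definition loc_rep :: "('m, 'e) chart \<Rightarrow> ('m \<Rightarrow> 'n) \<Rightarrow> ('n, 'f) chart \<Rightarrow> 'e \<Rightarrow> 'f" where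
  "loc_rep c f c' x = snd c' (f (chart_inv c x))"

definition smooth_manifold :: "('k::topological_comm_ring_1, 'e::ab_group_add, 'm) mfd \<Rightarrow> bool" where
  "smooth_manifold M \<longleftrightarrow>
     topological_module (model M) \<and>
     (\<forall>c \<in> atlas M.
        openin (mfd_top M) (fst c) \<and> openin (mod_top (model M)) (snd c ` fst c) \<and>
        homeomorphic_map (subtopology (mfd_top M) (fst c))
          (subtopology (mod_top (model M)) (snd c ` fst c)) (snd c)) \<and>
     (\<Union>c \<in> atlas M. fst c) = pts M \<and>
     (\<forall>c \<in> atlas M. \<forall>c' \<in> atlas M.
        smooth_on (model M) (model M) (loc_dom c id c') (loc_rep c id c'))"

definition smooth_map ::
    "('k::topological_comm_ring_1, 'e::ab_group_add, 'm) mfd \<Rightarrow> ('k, 'f::ab_group_add, 'n) mfd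
      \<Rightarrow> ('m \<Rightarrow> 'n) \<Rightarrow> bool" where
  "smooth_map M N f \<longleftrightarrow>
     continuous_map (mfd_top M) (mfd_top N) f \<and>
     (\<forall>c \<in> atlas M. \<forall>c' \<in> atlas N.
        smooth_on (model M) (model N) (loc_dom c f c') (loc_rep c f c'))"

definition prod_chart :: "('m, 'e) chart \<Rightarrow> ('n, 'f) chart \<Rightarrow> ('m \<times> 'n, 'e \<times> 'f) chart" where
  "prod_chart c c' = (fst c \<times> fst c', map_prod (snd c) (snd c'))"

definition prod_mfd ::
    "('k::topological_comm_ring_1, 'e::ab_group_add, 'm) mfd \<Rightarrow> ('k, 'f::ab_group_add, 'n) mfd
      \<Rightarrow> ('k, 'e \<times> 'f, 'm \<times> 'n) mfd" where
  "prod_mfd M N =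
     \<lparr>model = prod_module (model M) (model N),
      mfd_top = prod_topology (mfd_top M) (mfd_top N),
      atlas = {prod_chart c c' | c c'. c \<in> atlas M \<and> c' \<in> atlas N}\<rparr>"

definition restrict_chart :: "'m set \<Rightarrow> ('m, 'e) chart \<Rightarrow> ('m, 'e) chart" where
  "restrict_chart U c = (fst c \<inter> U, snd c)"

definition open_submanifold ::
    "('k::topological_comm_ring_1, 'e::ab_group_add, 'm) mfd \<Rightarrow> 'm set \<Rightarrow> bool" where
  "open_submanifold M U \<longleftrightarrow> smooth_manifold M \<and> openin (mfd_top M) U"

definition restrict_mfd ::
    "('k::topological_comm_ring_1, 'e::ab_group_add, 'm) mfd \<Rightarrow> 'm set \<Rightarrow> ('k, 'e, 'm) mfd" where
  "restrict_mfd M U =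
     M\<lparr>mfd_top := subtopology (mfd_top M) U, atlas := restrict_chart U ` atlas M\<rparr>"

section \<open>Tangent vectors and vector fields\<close>

text \<open>A tangent vector at \<open>p\<close> is \<open>p\<close> together with a class of pairs (chart at \<open>p\<close>, vector of the
  model space), two pairs being equivalent if the differential of the transition map takes one
  vector to the other.  Each class contains exactly one vector for each chart at \<open>p\<close>.\<close>

type_synonym ('m, 'e) tangent = "'m \<times> (('m, 'e) chart \<times> 'e) set"

definition tvec ::
    "('k::topological_comm_ring_1, 'e::ab_group_add, 'm) mfd \<Rightarrow> ('m, 'e) chart \<Rightarrow> 'm \<Rightarrow> 'e
      \<Rightarrow> ('m, 'e) tangent" where
  "tvec M c p v =
     (p, {(c', differential (model M) (model M) (loc_dom c id c') (loc_rep c id c') (snd c p) v)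
          | c'. c' \<in> atlas M \<and> p \<in> fst c'})"

definition tangent_space ::
    "('k::topological_comm_ring_1, 'e::ab_group_add, 'm) mfd \<Rightarrow> 'm \<Rightarrow> ('m, 'e) tangent set" where
  "tangent_space M p =
     {tvec M c p v | c v. c \<in> atlas M \<and> p \<in> fst c \<and> v \<in> carr (model M)}"

definition coord :: "('m, 'e) tangent \<Rightarrow> ('m, 'e) chart \<Rightarrow> 'e" where
  "coord \<xi> c = (THE v. (c, v) \<in> snd \<xi>)"

definition tzero ::
    "('k::topological_comm_ring_1, 'e::ab_group_add, 'm) mfd \<Rightarrow> 'm \<Rightarrow> ('m, 'e) tangent" where
  "tzero M p = (p, {(c, 0) | c. c \<in> atlas M \<and> p \<in> fst c})"

definition tadd ::
    "('m, 'e::ab_group_add) tangent \<Rightarrow> ('m, 'e) tangent \<Rightarrow> ('m, 'e) tangent" where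
  "tadd \<xi> \<eta> = (fst \<xi>, {(c, v + w) | c v w. (c, v) \<in> snd \<xi> \<and> (c, w) \<in> snd \<eta>})"

definition tneg :: "('m, 'e::ab_group_add) tangent \<Rightarrow> ('m, 'e) tangent" where
  "tneg \<xi> = (fst \<xi>, {(c, - v) | c v. (c, v) \<in> snd \<xi>})"

definition tscal ::
    "('k::topological_comm_ring_1, 'e::ab_group_add, 'm) mfd \<Rightarrow> 'k \<Rightarrow> ('m, 'e) tangent
      \<Rightarrow> ('m, 'e) tangent" where
  "tscal M t \<xi> = (fst \<xi>, {(c, scal (model M) t v) | c v. (c, v) \<in> snd \<xi>})"

text \<open>The identification of \<open>TM \<times> TN\<close> with \<open>T(M \<times> N)\<close>.\<close>

definition tpair ::
    "('m, 'e) tangent \<Rightarrow> ('n, 'f) tangent \<Rightarrow> ('m \<times> 'n, 'e \<times> 'f) tangent" where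
  "tpair \<xi> \<eta> =
     ((fst \<xi>, fst \<eta>),
      {(prod_chart c c', (v, w)) | c c' v w. (c, v) \<in> snd \<xi> \<and> (c', w) \<in> snd \<eta>})"

definition tangent_map ::
    "('k::topological_comm_ring_1, 'e::ab_group_add, 'm) mfd \<Rightarrow> ('k, 'f::ab_group_add, 'n) mfd
      \<Rightarrow> ('m \<Rightarrow> 'n) \<Rightarrow> ('m, 'e) tangent \<Rightarrow> ('n, 'f) tangent" where
  "tangent_map M N f \<xi> =
     (f (fst \<xi>),
      {(c', differential (model M) (model N) (loc_dom c f c') (loc_rep c f c') (snd c (fst \<xi>)) v)
       | c' c v. c' \<in> atlas N \<and> f (fst \<xi>) \<in> fst c' \<and> (c, v) \<in> snd \<xi>})"

definition field_rep :: "('m \<Rightarrow> ('m, 'e) tangent) \<Rightarrow> ('m, 'e) chart \<Rightarrow> 'e \<Rightarrow> 'e" where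
  "field_rep X c x = coord (X (chart_inv c x)) c"

text \<open>In a chart, \<open>[X,Y](x) = dY(x)X(x) - dX(x)Y(x)\<close>.\<close>

definition lie_bracket ::
    "('k::topological_comm_ring_1, 'e::ab_group_add, 'm) mfd \<Rightarrow> ('m \<Rightarrow> ('m, 'e) tangent)
      \<Rightarrow> ('m \<Rightarrow> ('m, 'e) tangent) \<Rightarrow> 'm \<Rightarrow> ('m, 'e) tangent" where
  "lie_bracket M X Y p =
     (p, {(c, differential (model M) (model M) (snd c ` fst c) (field_rep Y c) (snd c p)
                (field_rep X c (snd c p))
            - differential (model M) (model M) (snd c ` fst c) (field_rep X c) (snd c p)
                (field_rep Y c (snd c p)))
          | c. c \<in> atlas M \<and> p \<in> fst c})"

section \<open>Symmetric spaces\<close>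

definition symmetric_space ::
    "('k::topological_comm_ring_1, 'e::ab_group_add, 'm) mfd \<Rightarrow> ('m \<Rightarrow> 'm \<Rightarrow> 'm) \<Rightarrow> bool" where
  "symmetric_space M m \<longleftrightarrow>
     smooth_manifold M \<and> smooth_map (prod_mfd M M) M (\<lambda>(x, y). m x y) \<and>
     (\<forall>x \<in> pts M. m x x = x) \<and>
     (\<forall>x \<in> pts M. \<forall>y \<in> pts M. m x (m x y) = y) \<and>
     (\<forall>x \<in> pts M. \<forall>y \<in> pts M. \<forall>z \<in> pts M. m x (m y z) = m (m x y) (m x z)) \<and>
     (\<forall>x \<in> pts M. \<forall>\<xi> \<in> tangent_space M x. tangent_map M M (m x) \<xi> = tneg \<xi>)"

text \<open>\<open>v\<^sup>~(p) = 1/2 Tm(v, Tm(0\<^sub>b, 0\<^sub>p))\<close> for \<open>v\<close> tangent at the base point \<open>b\<close>.\<close>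

definition tilde_field ::
    "('k::topological_comm_ring_1, 'e::ab_group_add, 'm) mfd \<Rightarrow> ('m \<Rightarrow> 'm \<Rightarrow> 'm) \<Rightarrow> 'm
      \<Rightarrow> ('m, 'e) tangent \<Rightarrow> 'm \<Rightarrow> ('m, 'e) tangent" where
  "tilde_field M m b v p =
     (let Tm = (\<lambda>\<xi> \<eta>. tangent_map (prod_mfd M M) M (\<lambda>(x, y). m x y) (tpair \<xi> \<eta>))
      in tscal M half (Tm v (Tm (tzero M b) (tzero M p))))"

definition lts_bracket ::
    "('k::topological_comm_ring_1, 'e::ab_group_add, 'm) mfd \<Rightarrow> ('m \<Rightarrow> 'm \<Rightarrow> 'm) \<Rightarrow> 'm
      \<Rightarrow> ('m, 'e) tangent \<Rightarrow> ('m, 'e) tangent \<Rightarrow> ('m, 'e) tangent \<Rightarrow> ('m, 'e) tangent" where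
  "lts_bracket M m b u v w =
     lie_bracket M (lie_bracket M (tilde_field M m b u) (tilde_field M m b v))
       (tilde_field M m b w) b"

definition isolated_fixed_point :: "'m topology \<Rightarrow> ('m \<Rightarrow> 'm) \<Rightarrow> 'm \<Rightarrow> bool" where
  "isolated_fixed_point X f x \<longleftrightarrow>
     f x = x \<and> (\<exists>N. openin X N \<and> x \<in> N \<and> (\<forall>y \<in> N. f y = y \<longrightarrow> y = x))"

section \<open>Three-graded Lie algebras with involution and their Jordan triple systems\<close>

text \<open>The Lie algebra is the whole type \<open>'g\<close>; \<open>gr i\<close> is its homogeneous part of degree \<open>i\<close>,
  \<open>\<theta>\<close> the involution, and the topology lives on \<open>V = gr 1\<close> only.\<close>

record ('k, 'g) jts =
  smul :: "'k \<Rightarrow> 'g \<Rightarrow> 'g"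
  brk :: "'g \<Rightarrow> 'g \<Rightarrow> 'g"
  gr :: "int \<Rightarrow> 'g set"
  theta :: "'g \<Rightarrow> 'g"
  V_top :: "'g topology"

abbreviation VV :: "('k, 'g, 'z) jts_scheme \<Rightarrow> 'g set" where
  "VV L \<equiv> gr L 1"

definition direct_sum :: "'g::ab_group_add set \<Rightarrow> 'g set \<Rightarrow> bool" where
  "direct_sum A B \<longleftrightarrow> bij_betw (\<lambda>(a, b). a + b) (A \<times> B) UNIV"

definition lie_algebra :: "('k::topological_comm_ring_1, 'g::ab_group_add) jts \<Rightarrow> bool" where
  "lie_algebra L \<longleftrightarrow>
     module (smul L) \<and>
     (\<forall>x. module_hom (smul L) (smul L) (\<lambda>y. brk L x y)) \<and>
     (\<forall>y. module_hom (smul L) (smul L) (\<lambda>x. brk L x y)) \<and>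
     (\<forall>x. brk L x x = 0) \<and>
     (\<forall>x y z. brk L x (brk L y z) + brk L y (brk L z x) + brk L z (brk L x y) = 0)"

definition lie_automorphism ::
    "('k::topological_comm_ring_1, 'g::ab_group_add) jts \<Rightarrow> ('g \<Rightarrow> 'g) \<Rightarrow> bool" where
  "lie_automorphism L f \<longleftrightarrow>
     bij f \<and> module_hom (smul L) (smul L) f \<and> (\<forall>x y. f (brk L x y) = brk L (f x) (f y))"

text \<open>The last conjunct says that the grading derivation is inner.\<close>

definition inner_three_grading :: "('k::topological_comm_ring_1, 'g::ab_group_add) jts \<Rightarrow> bool" where
  "inner_three_grading L \<longleftrightarrow>
     (\<forall>i. module.subspace (smul L) (gr L i)) \<and>
     (\<forall>i. i \<notin> {-1, 0, 1} \<longrightarrow> gr L i = {0}) \<and>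
     bij_betw (\<lambda>(a, b, c). a + b + c) (gr L 1 \<times> gr L 0 \<times> gr L (-1)) UNIV \<and>
     (\<forall>i j. \<forall>x \<in> gr L i. \<forall>y \<in> gr L j. brk L x y \<in> gr L (i + j)) \<and>
     (\<exists>E. \<forall>i. \<forall>x \<in> gr L i. brk L E x = smul L (of_int i) x)"

definition graded_involution :: "('k::topological_comm_ring_1, 'g::ab_group_add) jts \<Rightarrow> bool" where
  "graded_involution L \<longleftrightarrow>
     lie_automorphism L (theta L) \<and> (\<forall>x. theta L (theta L x) = x) \<and>
     (\<forall>i. theta L ` gr L i = gr L (- i))"

text \<open>\<open>e\<^bsup>ad x\<^esup>\<close> for \<open>x\<close> of degree 1 or -1.\<close>

definition exp_ad :: "('k::topological_comm_ring_1, 'g::ab_group_add) jts \<Rightarrow> 'g \<Rightarrow> 'g \<Rightarrow> 'g" where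
  "exp_ad L x y = y + brk L x y + smul L half (brk L x (brk L x y))"

text \<open>That \<open>e\<^bsup>ad x\<^esup>\<close> is an automorphism is automatic if the algebra has no 3-torsion, but can fail
  otherwise; it is part of the setting.\<close>

definition involutive_graded_lie_algebra ::
    "('k::topological_comm_ring_1, 'g::ab_group_add) jts \<Rightarrow> bool" where
  "involutive_graded_lie_algebra L \<longleftrightarrow>
     lie_algebra L \<and> inner_three_grading L \<and> graded_involution L \<and>
     (\<forall>x \<in> gr L 1 \<union> gr L (-1). lie_automorphism L (exp_ad L x))"

definition triple :: "('k::topological_comm_ring_1, 'g::ab_group_add) jts \<Rightarrow> 'g \<Rightarrow> 'g \<Rightarrow> 'g \<Rightarrow> 'g" where
  "triple L x y z = brk L (brk L x (theta L y)) z"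

definition quad :: "('k::topological_comm_ring_1, 'g::ab_group_add) jts \<Rightarrow> 'g \<Rightarrow> 'g \<Rightarrow> 'g" where
  "quad L x y = smul L half (triple L x y x)"

definition bergman :: "('k::topological_comm_ring_1, 'g::ab_group_add) jts \<Rightarrow> 'g \<Rightarrow> 'g \<Rightarrow> 'g \<Rightarrow> 'g" where
  "bergman L x y z = z - triple L x y z + quad L x (quad L y z)"

definition quasi_invertible :: "('k::topological_comm_ring_1, 'g::ab_group_add) jts \<Rightarrow> ('g \<times> 'g) set" where
  "quasi_invertible L =
     {(x, y). x \<in> VV L \<and> y \<in> VV L \<and>
        bij_betw (bergman L x y) (VV L) (VV L) \<and> bij_betw (bergman L y x) (VV L) (VV L)}"

definition V_module :: "('k::topological_comm_ring_1, 'g::ab_group_add) jts \<Rightarrow> ('k, 'g) tmodule" where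
  "V_module L = \<lparr>scal = smul L, mod_top = V_top L\<rparr>"

definition C1_jordan_triple_system :: "('k::topological_comm_ring_1, 'g::ab_group_add) jts \<Rightarrow> bool" where
  "C1_jordan_triple_system L \<longleftrightarrow>
     topspace (V_top L) = VV L \<and> topological_module (V_module L) \<and>
     continuous_map (prod_topology (V_top L) (prod_topology (V_top L) (V_top L))) (V_top L)
       (\<lambda>(x, y, z). triple L x y z) \<and>
     openin (prod_topology (V_top L) (V_top L)) (quasi_invertible L) \<and>
     continuous_map
       (prod_topology
          (subtopology (prod_topology (V_top L) (V_top L)) (quasi_invertible L)) (V_top L))
       (V_top L)
       (\<lambda>((x, y), v). the_inv_into (VV L) (bergman L x y) v)"

section \<open>The projective completion\<close>

inductive_set GG :: "('k::topological_comm_ring_1, 'g::ab_group_add) jts \<Rightarrow> ('g \<Rightarrow> 'g) set"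
  for L where
  one: "id \<in> GG L"
| gen: "x \<in> gr L 1 \<union> gr L (-1) \<Longrightarrow> exp_ad L x \<in> GG L"
| mult: "g \<in> GG L \<Longrightarrow> h \<in> GG L \<Longrightarrow> g \<circ> h \<in> GG L"
| inverse: "g \<in> GG L \<Longrightarrow> inv g \<in> GG L"

text \<open>The pair \<open>(f\<^sub>1, f\<^sub>0)\<close> encodes the flag consisting of the zero space, \<open>f\<^sub>1\<close>, \<open>f\<^sub>0\<close> and the
  whole algebra.\<close>

type_synonym 'g flag = "'g set \<times> 'g set"

definition act :: "('g \<Rightarrow> 'g) \<Rightarrow> 'g flag \<Rightarrow> 'g flag" where
  "act g f = (g ` fst f, g ` snd f)"

definition transversal :: "'g::ab_group_add flag \<Rightarrow> 'g flag \<Rightarrow> bool" where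
  "transversal f e \<longleftrightarrow> direct_sum (fst f) (snd e) \<and> direct_sum (fst e) (snd f)"

definition o_plus :: "('k::topological_comm_ring_1, 'g::ab_group_add) jts \<Rightarrow> 'g flag" where
  "o_plus L = (gr L (-1), {a + b | a b. a \<in> gr L (-1) \<and> b \<in> gr L 0})"

definition o_minus :: "('k::topological_comm_ring_1, 'g::ab_group_add) jts \<Rightarrow> 'g flag" where
  "o_minus L = (gr L 1, {a + b | a b. a \<in> gr L 1 \<and> b \<in> gr L 0})"

definition X_plus :: "('k::topological_comm_ring_1, 'g::ab_group_add) jts \<Rightarrow> 'g flag set" where
  "X_plus L = (\<lambda>g. act g (o_plus L)) ` GG L"

text \<open>The inclusion of \<open>V\<close> into \<open>X\<^sup>+\<close>, and the chart with domain \<open>g(V)\<close> sending \<open>g.x\<close> to \<open>x\<close>.\<close>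

definition embed_V :: "('k::topological_comm_ring_1, 'g::ab_group_add) jts \<Rightarrow> 'g \<Rightarrow> 'g flag" where
  "embed_V L x = act (exp_ad L x) (o_plus L)"

definition X_chart ::
    "('k::topological_comm_ring_1, 'g::ab_group_add) jts \<Rightarrow> ('g \<Rightarrow> 'g) \<Rightarrow> ('g flag, 'g) chart" where
  "X_chart L g =
     ((\<lambda>x. act g (embed_V L x)) ` VV L, the_inv_into (VV L) (\<lambda>x. act g (embed_V L x)))"

text \<open>If the charts \<open>X_chart L g\<close> are homeomorphisms from open sets onto \<open>V\<close>, then a set is open
  if and only if it is open in each of them; hence this is the only possible topology.\<close>

definition X_top :: "('k::topological_comm_ring_1, 'g::ab_group_add) jts \<Rightarrow> 'g flag topology" where
  "X_top L =
     topology (\<lambda>U. U \<subseteq> X_plus L \<and>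
       (\<forall>g \<in> GG L. openin (V_top L) {x \<in> VV L. act g (embed_V L x) \<in> U}))"

lemma openin_X_top:
  "openin (X_top L) U \<longleftrightarrow> U \<subseteq> X_plus L \<and>
       (\<forall>g \<in> GG L. openin (V_top L) {x \<in> VV L. act g (embed_V L x) \<in> U})"
proof -
  let ?P = "\<lambda>U. U \<subseteq> X_plus L \<and>
       (\<forall>g \<in> GG L. openin (V_top L) {x \<in> VV L. act g (embed_V L x) \<in> U})"
  have "istopology ?P"
    unfolding istopology_def
  proof (intro conjI allI impI)
    fix S T assume S: "?P S" and T: "?P T"
    show "S \<inter> T \<subseteq> X_plus L" using S by blast
    show "\<forall>g \<in> GG L. openin (V_top L) {x \<in> VV L. act g (embed_V L x) \<in> S \<inter> T}"
    proof
      fix g assume g: "g \<in> GG L"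
      have "{x \<in> VV L. act g (embed_V L x) \<in> S \<inter> T} =
          {x \<in> VV L. act g (embed_V L x) \<in> S} \<inter> {x \<in> VV L. act g (embed_V L x) \<in> T}" by blast
      then show "openin (V_top L) {x \<in> VV L. act g (embed_V L x) \<in> S \<inter> T}"
        using S T g by (simp add: openin_Int)
    qed
  next
    fix \<K> assume K: "\<forall>S \<in> \<K>. ?P S"
    show "\<Union>\<K> \<subseteq> X_plus L" using K by blast
    show "\<forall>g \<in> GG L. openin (V_top L) {x \<in> VV L. act g (embed_V L x) \<in> \<Union>\<K>}"
    proof
      fix g assume g: "g \<in> GG L"
      have "{x \<in> VV L. act g (embed_V L x) \<in> \<Union>\<K>} =
          (\<Union>S \<in> \<K>. {x \<in> VV L. act g (embed_V L x) \<in> S})" by blast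
      then show "openin (V_top L) {x \<in> VV L. act g (embed_V L x) \<in> \<Union>\<K>}"
        using K g by (metis (no_types, lifting) imageE openin_Union)
    qed
  qed
  then show ?thesis by (simp add: X_top_def topology_inverse')
qed

definition X_mfd :: "('k::topological_comm_ring_1, 'g::ab_group_add) jts \<Rightarrow> ('k, 'g, 'g flag) mfd" where
  "X_mfd L = \<lparr>model = V_module L, mfd_top = X_top L, atlas = X_chart L ` GG L\<rparr>"

section \<open>The symmetric space of non-isotropic points\<close>

text \<open>The map that is the identity on degree 0 and minus the identity on degrees 1 and -1.\<close>

definition delta :: "('k::topological_comm_ring_1, 'g::ab_group_add) jts \<Rightarrow> 'g \<Rightarrow> 'g" where
  "delta L x =
     (THE y. \<exists>a \<in> gr L 1. \<exists>b \<in> gr L 0. \<exists>c \<in> gr L (-1). x = a + b + c \<and> y = - a + b - c)"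

text \<open>For \<open>(x, a) = (g.o\<^sup>+, g.o\<^sup>-)\<close>, \<open>g \<delta> g\<^sup>-\<^sup>1\<close> is the negation of the module \<open>g(V)\<close> with zero
  vector \<open>x\<close>, extended to all of \<open>X\<^sup>+\<close>; it does not depend on the choice of \<open>g\<close>.\<close>

definition mu_neg ::
    "('k::topological_comm_ring_1, 'g::ab_group_add) jts \<Rightarrow> 'g flag \<Rightarrow> 'g flag \<Rightarrow> 'g flag \<Rightarrow> 'g flag" where
  "mu_neg L x a y =
     (THE z. \<exists>g \<in> GG L. x = act g (o_plus L) \<and> a = act g (o_minus L) \<and>
                        z = act (g \<circ> delta L \<circ> inv g) y)"

definition polarity :: "('k::topological_comm_ring_1, 'g::ab_group_add) jts \<Rightarrow> 'g flag \<Rightarrow> 'g flag" where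
  "polarity L f = act (theta L) f"

definition non_isotropic :: "('k::topological_comm_ring_1, 'g::ab_group_add) jts \<Rightarrow> 'g flag set" where
  "non_isotropic L = {x \<in> X_plus L. transversal x (polarity L x)}"

definition M_mfd :: "('k::topological_comm_ring_1, 'g::ab_group_add) jts \<Rightarrow> ('k, 'g, 'g flag) mfd" where
  "M_mfd L = restrict_mfd (X_mfd L) (non_isotropic L)"

definition M_mult ::
    "('k::topological_comm_ring_1, 'g::ab_group_add) jts \<Rightarrow> 'g flag \<Rightarrow> 'g flag \<Rightarrow> 'g flag" where
  "M_mult L x y = mu_neg L x (polarity L x) y"

text \<open>The identification of \<open>V\<close> with the tangent space at the base point by the chart \<open>V\<close>.\<close>

definition V_tangent ::
    "('k::topological_comm_ring_1, 'g::ab_group_add) jts \<Rightarrow> 'g \<Rightarrow> ('g flag, 'g) tangent" where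
  "V_tangent L v =
     tvec (M_mfd L) (restrict_chart (non_isotropic L) (X_chart L id)) (o_plus L) v"

end

theory Submission
  imports Defs
begin

text \<open>The proof takes place inside the Lie algebra \<open>\<gg>\<close>.  The group \<open>G\<close> consists of the words
  \<open>e\<^sup>a\<^sup>1 \<dots> e\<^sup>a\<^sup>n\<close> with letters of degree 1 and -1.  A point \<open>F.o\<^sup>+\<close> with coordinate \<open>z\<close> in the
  chart \<open>V\<close> satisfies \<open>F.o\<^sup>+ = e\<^sup>z.o\<^sup>+\<close>, and \<open>z\<close> can be read off from \<open>e\<^sup>z E = E - z\<close>.  If the letters of
  \<open>F\<close> move by \<open>t\<close> times given increments, then \<open>z\<close> moves by \<open>t\<close> times an expression that is polynomial in the
  letters, the increments and the old and the new value of \<open>z\<close> (\<open>quot\<close>).  This holds for every \<open>t\<close>, invertible or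
  not, so it yields the difference quotient of \<open>z\<close> on its whole domain and reduces smoothness of every map that is
  given by words to its continuity (\<open>nC_coordinate\<close>).  The value at \<open>t = 0\<close> is
  the derivative: the component of degree 1 of \<open>e\<^sup>-\<^sup>z \<Lambda>\<close>, where \<open>\<Lambda>\<close> is the logarithmic derivative of the word
  (\<open>differential_family\<close>).

  Continuity is what the hypotheses on the Bergman operators give.  The point \<open>e\<^sup>w e\<^sup>z.o\<^sup>+\<close> lies in \<open>V\<close> if and only if the
  pair \<open>(z, -\<theta> w)\<close> is quasi-invertible, and its coordinate is then \<open>B(z, -\<theta> w)\<^sup>-\<^sup>1\<close> applied to a polynomial
  (\<open>chart_criterion\<close>, \<open>quasi_iff\<close>).  This settles the words \<open>e\<^sup>w e\<^sup>z\<close>; for longer words a small exponential is moved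
  past the fixed ones, each time at the cost of further small factors (\<open>exchange\<close>, \<open>word_limit\<close>).

  A point \<open>x = a.o\<^sup>+\<close> is non-isotropic if and only if \<open>\<theta> a\<^sup>-\<^sup>1 \<theta> a.o\<^sup>+\<close> lies in \<open>V\<close>; if \<open>z\<close> is its coordinate, then
  \<open>g = a e\<^sup>\<theta>\<^sup>z\<close> carries \<open>(o\<^sup>+, o\<^sup>-)\<close> to \<open>(x, p(x))\<close>, and the symmetry at \<open>x\<close> is \<open>g \<delta> g\<^sup>-\<^sup>1\<close>.  This
  automorphism depends on \<open>x\<close> only and commutes with \<open>\<theta>\<close>, which gives the algebraic axioms of a
  symmetric space.  In charts the product is given by a word whose letters are the coordinates of the two points and
  \<open>\<theta> z\<close>; since \<open>z\<close> is itself the coordinate of a point given by a word, the product is smooth.  In the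
  chart \<open>g(V)\<close> the symmetry is \<open>v \<mapsto> -v\<close>; as 2 is invertible, \<open>x\<close> is its only fixed point there, and its tangent map is
  \<open>-id\<close>.

  Finally, every \<open>X\<close> in \<open>\<gg>\<close> defines a vector field on \<open>X\<^sup>+\<close>, its infinitesimal action, and all tangent vectors
  arise in this way.  The bracket of the fields of \<open>X\<close> and \<open>Y\<close> is the field of \<open>-[X, Y]\<close>
  (\<open>lie_bracket_tau\<close>), and the field extending \<open>v \<in> V\<close> in the definition of the Lie triple system is the field of \<open>v + \<theta> v\<close>
  (\<open>tilde_tau\<close>).  Hence \<open>[x, y, z]\<close> is the component of degree 1 of \<open>[[x + \<theta> x, y + \<theta> y], z + \<theta> z]\<close>, which is
  \<open>[[x, \<theta> y], z] - [[y, \<theta> x], z]\<close>.\<close>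

section \<open>Three-graded Lie algebras with involution\<close>

locale graded_setting =
  fixes L :: "('k::topological_comm_ring_1, 'g::ab_group_add) jts"
  assumes ring: "calculus_ring TYPE('k)"
    and algebra: "involutive_graded_lie_algebra L"
begin

abbreviation br :: "'g \<Rightarrow> 'g \<Rightarrow> 'g" (infixr "\<star>" 72) where "x \<star> y \<equiv> brk L x y"
abbreviation sm :: "'k \<Rightarrow> 'g \<Rightarrow> 'g" (infixr "\<cdot>" 74) where "t \<cdot> x \<equiv> smul L t x"
abbreviation \<theta> :: "'g \<Rightarrow> 'g" where "\<theta> \<equiv> theta L"
abbreviation ex :: "'g \<Rightarrow> 'g \<Rightarrow> 'g" where "ex \<equiv> exp_ad L"
abbreviation base :: "'g flag" where "base \<equiv> o_plus L"
abbreviation g1 :: "'g set" where "g1 \<equiv> gr L 1"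
abbreviation g0 :: "'g set" where "g0 \<equiv> gr L 0"
abbreviation gm :: "'g set" where "gm \<equiv> gr L (-1)"
abbreviation aut :: "('g \<Rightarrow> 'g) \<Rightarrow> bool" where "aut \<equiv> lie_automorphism L"

lemma lie: "lie_algebra L" and grading: "inner_three_grading L" and invol: "graded_involution L"
  and exp_aut: "x \<in> g1 \<union> gm \<Longrightarrow> aut (ex x)"
  using algebra by (auto simp: involutive_graded_lie_algebra_def)

sublocale module "smul L" using lie by (simp add: lie_algebra_def)

lemma two_half: "2 * half = (1::'k)"
proof -
  obtain w :: 'k where w: "2 * w = 1" using ring by (auto simp: calculus_ring_def dvd_def)
  have "w' = w" if "2 * w' = 1" for w'
    using w that by (metis mult.left_commute mult.right_neutral)
  then show ?thesis unfolding ring_inverse_def by (metis (mono_tags, lifting) theI w)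
qed

lemma half_add: "half \<cdot> x + half \<cdot> x = x"
  by (metis mult_2 scale_left_distrib scale_one two_half)

lemma half_double: "half \<cdot> (x + x) = x"
  by (simp add: half_add scale_right_distrib)

lemma double_zero: "x + x = 0 \<Longrightarrow> x = (0::'g)"
  by (metis half_double scale_zero_right)

lemma br_add_left: "(x + y) \<star> z = x \<star> z + y \<star> z"
  and br_add_right: "z \<star> (x + y) = z \<star> x + z \<star> y"
  and br_scale_left: "(t \<cdot> x) \<star> z = t \<cdot> (x \<star> z)"
  and br_scale_right: "z \<star> (t \<cdot> x) = t \<cdot> (z \<star> x)"
  and br_self [simp]: "x \<star> x = 0"
  using lie unfolding lie_algebra_def module_hom_def module_hom_axioms_def by auto

lemma br_zero [simp]: "0 \<star> z = 0" "z \<star> 0 = 0"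
  by (metis add_cancel_right_right br_add_left, metis add_cancel_right_right br_add_right)

lemma br_minus [simp]: "(- x) \<star> z = - (x \<star> z)" "z \<star> (- x) = - (z \<star> x)"
  by (metis add_eq_0_iff2 br_add_left br_zero(1) add.right_inverse,
      metis add_eq_0_iff2 br_add_right br_zero(2) add.right_inverse)

lemma br_diff: "(x - y) \<star> z = x \<star> z - y \<star> z" "z \<star> (x - y) = z \<star> x - z \<star> y"
  using br_add_left[of x "- y" z] br_add_right[of z x "- y"] by simp_all

lemma br_anti: "x \<star> y = - (y \<star> x)"
proof -
  have "(x + y) \<star> (x + y) = x \<star> y + y \<star> x"
    unfolding br_add_left br_add_right by simp
  then have "x \<star> y + y \<star> x = 0" by (metis br_self)
  then show ?thesis by (rule eq_neg_iff_add_eq_0[THEN iffD2])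
qed

lemma jacobi: "x \<star> y \<star> z = (x \<star> y) \<star> z + y \<star> x \<star> z"
proof -
  have "x \<star> y \<star> z + y \<star> z \<star> x + z \<star> x \<star> y = 0" using lie by (simp add: lie_algebra_def)
  moreover have "y \<star> z \<star> x = - (y \<star> x \<star> z)" using br_anti[of z x] by simp
  moreover have "z \<star> x \<star> y = - ((x \<star> y) \<star> z)" by (rule br_anti)
  ultimately show ?thesis by (simp add: algebra_simps)
qed

lemmas lin = br_add_left br_add_right br_scale_left br_scale_right br_diff
  scale_right_distrib scale_right_diff_distrib

definition euler :: "'g" where
  "euler = (SOME E. \<forall>i. \<forall>x \<in> gr L i. E \<star> x = of_int i \<cdot> x)"

lemma euler: "x \<in> gr L i \<Longrightarrow> euler \<star> x = of_int i \<cdot> x"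
proof -
  have "\<exists>E. \<forall>i. \<forall>x \<in> gr L i. E \<star> x = of_int i \<cdot> x" using grading by (simp add: inner_three_grading_def)
  from someI_ex[OF this] show "x \<in> gr L i \<Longrightarrow> euler \<star> x = of_int i \<cdot> x" by (simp add: euler_def)
qed

lemma euler_simps:
  "a \<in> g1 \<Longrightarrow> euler \<star> a = a" "b \<in> g0 \<Longrightarrow> euler \<star> b = 0" "c \<in> gm \<Longrightarrow> euler \<star> c = - c"
  using euler[of a 1] euler[of b 0] euler[of c "-1"] by simp_all

lemma gr_subspace: "subspace (gr L i)" using grading by (auto simp: inner_three_grading_def)
lemma gr_closed: 
  "0 \<in> gr L i" "x \<in> gr L i \<Longrightarrow> y \<in> gr L i \<Longrightarrow> x + y \<in> gr L i" 
  "x \<in> gr L i \<Longrightarrow> y \<in> gr L i \<Longrightarrow> x - y \<in> gr L i" "x \<in> gr L i \<Longrightarrow> - x \<in> gr L i" "x \<in> gr L i \<Longrightarrow> t \<cdot> x \<in> gr L i"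
  using gr_subspace[of i] by (auto intro: subspace_0 subspace_add subspace_diff subspace_neg subspace_scale)
declare gr_closed(1) [simp]

lemma gr_br: "x \<in> gr L i \<Longrightarrow> y \<in> gr L j \<Longrightarrow> i + j = k \<Longrightarrow> x \<star> y \<in> gr L k"
  using grading by (auto simp: inner_three_grading_def)

lemma br_gr:
  "x \<in> g1 \<Longrightarrow> y \<in> g0 \<Longrightarrow> x \<star> y \<in> g1" "x \<in> g0 \<Longrightarrow> y \<in> g1 \<Longrightarrow> x \<star> y \<in> g1"
  "x \<in> gm \<Longrightarrow> y \<in> g0 \<Longrightarrow> x \<star> y \<in> gm" "x \<in> g0 \<Longrightarrow> y \<in> gm \<Longrightarrow> x \<star> y \<in> gm"
  "x \<in> g1 \<Longrightarrow> y \<in> gm \<Longrightarrow> x \<star> y \<in> g0" "x \<in> gm \<Longrightarrow> y \<in> g1 \<Longrightarrow> x \<star> y \<in> g0"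
  "x \<in> g0 \<Longrightarrow> y \<in> g0 \<Longrightarrow> x \<star> y \<in> g0"
  by (auto intro: gr_br)

lemma gr_out: "i \<notin> {-1, 0, 1} \<Longrightarrow> gr L i = {0}"
  using grading unfolding inner_three_grading_def by blast

lemma br_same: "x \<in> g1 \<Longrightarrow> y \<in> g1 \<Longrightarrow> x \<star> y = 0" "x \<in> gm \<Longrightarrow> y \<in> gm \<Longrightarrow> x \<star> y = 0"
  using gr_br[of x 1 y 1 2] gr_br[of x "-1" y "-1" "-2"] gr_out[of 2] gr_out[of "-2"] by auto

text \<open>As \<open>ad E\<close> has the eigenvalues 1, 0, -1 and 2 is invertible, Lagrange interpolation gives the
  projections to the homogeneous parts as polynomials in \<open>ad E\<close>, which makes them linear.\<close>

definition p1 :: "'g \<Rightarrow> 'g" where "p1 x = half \<cdot> (euler \<star> euler \<star> x + euler \<star> x)"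
definition pm :: "'g \<Rightarrow> 'g" where "pm x = half \<cdot> (euler \<star> euler \<star> x - euler \<star> x)"
definition p0 :: "'g \<Rightarrow> 'g" where "p0 x = x - euler \<star> euler \<star> x"

lemma p_add [simp]: "p1 (x + y) = p1 x + p1 y" "p0 (x + y) = p0 x + p0 y" "pm (x + y) = pm x + pm y"
  by (simp_all add: p1_def p0_def pm_def lin algebra_simps)
lemma p_scale [simp]: "p1 (t \<cdot> x) = t \<cdot> p1 x" "p0 (t \<cdot> x) = t \<cdot> p0 x" "pm (t \<cdot> x) = t \<cdot> pm x"
  by (simp_all add: p1_def p0_def pm_def lin mult.commute)
lemma p_minus [simp]: "p1 (- x) = - p1 x" "p0 (- x) = - p0 x" "pm (- x) = - pm x"
  by (simp_all add: p1_def p0_def pm_def lin)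
lemma p_diff [simp]: "p1 (x - y) = p1 x - p1 y" "p0 (x - y) = p0 x - p0 y" "pm (x - y) = pm x - pm y"
  by (simp_all add: p1_def p0_def pm_def lin algebra_simps)
lemma p_zero [simp]: "p1 0 = 0" "p0 0 = 0" "pm 0 = 0"
  by (simp_all add: p1_def p0_def pm_def)

lemma p_gr:
  "a \<in> g1 \<Longrightarrow> p1 a = a" "a \<in> g1 \<Longrightarrow> p0 a = 0" "a \<in> g1 \<Longrightarrow> pm a = 0"
  "b \<in> g0 \<Longrightarrow> p1 b = 0" "b \<in> g0 \<Longrightarrow> p0 b = b" "b \<in> g0 \<Longrightarrow> pm b = 0"
  "c \<in> gm \<Longrightarrow> p1 c = 0" "c \<in> gm \<Longrightarrow> p0 c = 0" "c \<in> gm \<Longrightarrow> pm c = c"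
  by (simp_all add: p1_def p0_def pm_def euler_simps half_double)

lemma decompose: obtains a b c where "a \<in> g1" "b \<in> g0" "c \<in> gm" "x = a + b + c"
proof -
  have "(\<lambda>(a, b, c). a + b + c) ` (g1 \<times> g0 \<times> gm) = UNIV"
    using grading by (auto simp: inner_three_grading_def bij_betw_def)
  then have "x \<in> (\<lambda>(a, b, c). a + b + c) ` (g1 \<times> g0 \<times> gm)" by simp
  then show ?thesis using that by auto
qed

lemma p_in [simp]: "p1 x \<in> g1" "p0 x \<in> g0" "pm x \<in> gm"
  by (rule decompose[of x]; simp add: p_gr)+
lemma p_sum: "x = p1 x + p0 x + pm x"
  by (rule decompose[of x]) (simp add: p_gr)
lemma p_p [simp]:
  "p1 (p1 x) = p1 x" "p0 (p1 x) = 0" "pm (p1 x) = 0"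
  "p1 (p0 x) = 0" "p0 (p0 x) = p0 x" "pm (p0 x) = 0"
  "p1 (pm x) = 0" "p0 (pm x) = 0" "pm (pm x) = pm x"
  by (simp_all add: p_gr)

lemma in_gr_iff: "x \<in> g1 \<longleftrightarrow> p1 x = x" "x \<in> g0 \<longleftrightarrow> p0 x = x" "x \<in> gm \<longleftrightarrow> pm x = x"
  by (metis p_in(1) p_gr(1), metis p_in(2) p_gr(5), metis p_in(3) p_gr(9))

lemma p_ext: "p1 x = p1 y \<Longrightarrow> p0 x = p0 y \<Longrightarrow> pm x = pm y \<Longrightarrow> x = y"
  by (metis p_sum)

lemma p_br:
  "p1 (x \<star> y) = p1 x \<star> p0 y + p0 x \<star> p1 y"
  "p0 (x \<star> y) = p1 x \<star> pm y + pm x \<star> p1 y + p0 x \<star> p0 y"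
  "pm (x \<star> y) = pm x \<star> p0 y + p0 x \<star> pm y"
proof -
  have e: "x \<star> y = (p1 x \<star> p0 y + p0 x \<star> p1 y) + (p1 x \<star> pm y + pm x \<star> p1 y + p0 x \<star> p0 y)
      + (pm x \<star> p0 y + p0 x \<star> pm y)"
  proof -
    have "x \<star> y = (p1 x + p0 x + pm x) \<star> (p1 y + p0 y + pm y)" using p_sum by metis
    also have "\<dots> = (p1 x \<star> p0 y + p0 x \<star> p1 y) + (p1 x \<star> pm y + pm x \<star> p1 y + p0 x \<star> p0 y)
      + (pm x \<star> p0 y + p0 x \<star> pm y) + p1 x \<star> p1 y + pm x \<star> pm y"
      by (simp only: br_add_left br_add_right algebra_simps)
    finally show ?thesis by (simp add: br_same)
  qed
  have 1: "p1 x \<star> p0 y + p0 x \<star> p1 y \<in> g1" 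
    and 2: "p1 x \<star> pm y + pm x \<star> p1 y + p0 x \<star> p0 y \<in> g0"
    and 3: "pm x \<star> p0 y + p0 x \<star> pm y \<in> gm"
    by (simp_all add: gr_closed br_gr)
  show "p1 (x \<star> y) = p1 x \<star> p0 y + p0 x \<star> p1 y"
    using p_gr(1)[OF 1] p_gr(4)[OF 2] p_gr(7)[OF 3] unfolding e p_add by simp
  show "p0 (x \<star> y) = p1 x \<star> pm y + pm x \<star> p1 y + p0 x \<star> p0 y"
    using p_gr(2)[OF 1] p_gr(5)[OF 2] p_gr(8)[OF 3] unfolding e p_add by simp
  show "pm (x \<star> y) = pm x \<star> p0 y + p0 x \<star> pm y"
    using p_gr(3)[OF 1] p_gr(6)[OF 2] p_gr(9)[OF 3] unfolding e p_add by simp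
qed

lemma euler_g0 [simp]: "euler \<in> g0"
  unfolding in_gr_iff p0_def by simp

lemma p_euler [simp]: "p1 euler = 0" "p0 euler = euler" "pm euler = 0"
  using euler_g0 by (simp_all only: p_gr)

lemma euler_p: "euler \<star> x = p1 x - pm x"
proof -
  have "euler \<star> x = euler \<star> p1 x + euler \<star> p0 x + euler \<star> pm x" by (metis p_sum br_add_right)
  then show ?thesis by (simp add: euler_simps)
qed

subsection \<open>The involution and automorphisms\<close>

lemma autD:
  assumes "aut f"
  shows "bij f" "f (x + y) = f x + f y" "f (t \<cdot> x) = t \<cdot> f x" "f (x \<star> y) = f x \<star> f y"
    "f (- x) = - f x" "f (x - y) = f x - f y" "f 0 = 0" "f x = f y \<longleftrightarrow> x = y"
    "inv f (f x) = x" "f (inv f x) = x"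
proof -
  show b: "bij f" using assms by (simp add: lie_automorphism_def)
  interpret h: module_hom "smul L" "smul L" f using assms by (simp add: lie_automorphism_def)
  show "f (x + y) = f x + f y" "f (t \<cdot> x) = t \<cdot> f x" "f (- x) = - f x" "f (x - y) = f x - f y" "f 0 = 0"
    by (simp_all add: h.add h.scale h.neg h.diff)
  show "f (x \<star> y) = f x \<star> f y" using assms by (simp add: lie_automorphism_def)
  show "f x = f y \<longleftrightarrow> x = y" "inv f (f x) = x" "f (inv f x) = x" using b
    by (auto simp: bij_def inj_def surj_f_inv_f)
qed

lemma autI:
  assumes "bij f" "\<And>x y. f (x + y) = f x + f y" "\<And>t x. f (t \<cdot> x) = t \<cdot> f x" 
    "\<And>x y. f (x \<star> y) = f x \<star> f y"
  shows "aut f"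
  unfolding lie_automorphism_def using assms by (auto intro!: module_hom.intro module_hom_axioms.intro module_axioms)

lemma aut_id: "aut id" by (rule autI) auto

lemma aut_comp: "aut f \<Longrightarrow> aut h \<Longrightarrow> aut (f \<circ> h)"
  by (rule autI) (auto simp: autD intro: bij_comp)

lemma aut_inv: assumes "aut f" shows "aut (inv f)"
proof (rule autI)
  note [simp] = autD[OF assms]
  show "bij (inv f)" by (simp add: bij_imp_bij_inv)
  show "inv f (x + y) = inv f x + inv f y" for x y by (metis autD(2,9,10)[OF assms])
  show "inv f (t \<cdot> x) = t \<cdot> inv f x" for t x by (metis autD(3,9,10)[OF assms])
  show "inv f (x \<star> y) = inv f x \<star> inv f y" for x y by (metis autD(4,9,10)[OF assms])
qed

lemma theta_aut: "aut \<theta>" and theta_theta [simp]: "\<theta> (\<theta> x) = x" and theta_img: "\<theta> ` gr L i = gr L (- i)"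
  using invol by (auto simp: graded_involution_def)

lemma theta_comp: "\<theta> \<circ> \<theta> = id" by auto

lemmas theta_simps [simp] = autD(2-7)[OF theta_aut]

lemma theta_gr: "x \<in> gr L i \<Longrightarrow> \<theta> x \<in> gr L (- i)" using theta_img by blast
lemma theta_in: "\<theta> x \<in> gm \<longleftrightarrow> x \<in> g1" "\<theta> x \<in> g1 \<longleftrightarrow> x \<in> gm" "\<theta> x \<in> g0 \<longleftrightarrow> x \<in> g0"
  using theta_gr[of x 1] theta_gr[of "\<theta> x" 1] theta_gr[of x "-1"] theta_gr[of "\<theta> x" "-1"]
    theta_gr[of x 0] theta_gr[of "\<theta> x" 0] by auto

lemma theta_p: "p1 (\<theta> x) = \<theta> (pm x)" "p0 (\<theta> x) = \<theta> (p0 x)" "pm (\<theta> x) = \<theta> (p1 x)"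
proof -
  have e: "\<theta> x = \<theta> (pm x) + \<theta> (p0 x) + \<theta> (p1 x)"
    using arg_cong[OF p_sum[of x], of \<theta>] by (simp add: algebra_simps)
  have 1: "\<theta> (pm x) \<in> g1" "\<theta> (p0 x) \<in> g0" "\<theta> (p1 x) \<in> gm" by (simp_all add: theta_in)
  show "p1 (\<theta> x) = \<theta> (pm x)" "p0 (\<theta> x) = \<theta> (p0 x)" "pm (\<theta> x) = \<theta> (p1 x)"
    by (subst e; simp only: p_add p_gr 1; simp)+
qed

subsection \<open>Exponentials and the group they generate\<close>

lemma ex_zero [simp]: "ex 0 = id" "ex x 0 = 0"
  by (auto simp: exp_ad_def)

lemma ex_lin: "ex x (y + z) = ex x y + ex x z" "ex x (y - z) = ex x y - ex x z"
  "ex x (t \<cdot> y) = t \<cdot> ex x y" "ex x (- y) = - ex x y"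
  by (simp_all add: exp_ad_def lin algebra_simps)

lemma p_ex_plus: 
  assumes "a \<in> g1"
  shows "p1 (ex a y) = p1 y + a \<star> p0 y + half \<cdot> (a \<star> a \<star> pm y)"
    "p0 (ex a y) = p0 y + a \<star> pm y" "pm (ex a y) = pm y"
  using assms by (simp_all add: exp_ad_def p_br p_gr)

lemma p_ex_minus: 
  assumes "c \<in> gm"
  shows "p1 (ex c y) = p1 y" "p0 (ex c y) = p0 y + c \<star> p1 y"
    "pm (ex c y) = pm y + c \<star> p0 y + half \<cdot> (c \<star> c \<star> p1 y)"
  using assms by (simp_all add: exp_ad_def p_br p_gr)

lemma ex_fix: "a \<star> y = 0 \<Longrightarrow> ex a y = y" by (simp add: exp_ad_def)

lemma ex_same: "a \<in> g1 \<Longrightarrow> b \<in> g1 \<Longrightarrow> ex a b = b" "a \<in> gm \<Longrightarrow> b \<in> gm \<Longrightarrow> ex a b = b"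
  by (auto intro: ex_fix simp: br_same)

lemma ex_euler: "a \<in> g1 \<Longrightarrow> ex a euler = euler - a" "c \<in> gm \<Longrightarrow> ex c euler = euler + c"
  using br_anti[of a euler] br_anti[of c euler]
  by (simp_all add: exp_ad_def euler_simps)

lemma nilpotent: 
  assumes "a \<in> g1 \<and> b \<in> g1 \<and> d \<in> g1 \<or> a \<in> gm \<and> b \<in> gm \<and> d \<in> gm"
  shows "a \<star> b \<star> d \<star> y = 0"
  by (rule p_ext) (use assms in \<open>auto simp: p_br p_gr\<close>)

lemma br_commute: 
  assumes "a \<in> g1 \<and> b \<in> g1 \<or> a \<in> gm \<and> b \<in> gm"
  shows "b \<star> a \<star> y = a \<star> b \<star> y"
  using jacobi[of b a y] assms by (auto simp: br_same)

lemma ex_add: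
  assumes "a \<in> g1 \<and> b \<in> g1 \<or> a \<in> gm \<and> b \<in> gm"
  shows "ex (a + b) = ex a \<circ> ex b"
proof
  fix y
  have n: "a \<star> b \<star> b \<star> y = 0" "a \<star> a \<star> b \<star> y = 0" "a \<star> a \<star> b \<star> b \<star> y = 0"
    using assms by (auto simp: nilpotent)
  have "half \<cdot> ((a + b) \<star> (a + b) \<star> y) 
      = half \<cdot> (a \<star> a \<star> y) + half \<cdot> (b \<star> b \<star> y) + half \<cdot> (a \<star> b \<star> y + a \<star> b \<star> y)"
    using br_commute[OF assms, of y] by (simp add: lin algebra_simps)
  then show "ex (a + b) y = (ex a \<circ> ex b) y"
    unfolding half_double by (simp add: exp_ad_def lin n algebra_simps)
qed

lemma ex_cancel:
  assumes "x \<in> g1 \<union> gm" shows "ex x (ex (- x) y) = y" "ex (- x) (ex x y) = y"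
proof -
  have "- x \<in> g1 \<and> x \<in> g1 \<or> - x \<in> gm \<and> x \<in> gm" using assms gr_closed(4) by blast
  then have "ex (x + - x) = ex x \<circ> ex (- x)" "ex (- x + x) = ex (- x) \<circ> ex x"
    by (blast intro: ex_add)+
  then show "ex x (ex (- x) y) = y" "ex (- x) (ex x y) = y"
    by (simp_all add: fun_eq_iff)
qed

lemma ex_inv: "x \<in> g1 \<union> gm \<Longrightarrow> inv (ex x) = ex (- x)"
  by (rule inv_equality) (auto simp: ex_cancel)

lemma aut_ex: "aut f \<Longrightarrow> f (ex x y) = ex (f x) (f y)"
  by (simp add: exp_ad_def autD)

lemma theta_ex: "\<theta> (ex x y) = ex (\<theta> x) (\<theta> y)" by (rule aut_ex[OF theta_aut])

text \<open>\<open>W l\<close> is the product of the exponentials of the entries of \<open>l\<close>.  Every element of \<open>G\<close> has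
  this form, and families of group elements are described by families of such words.\<close>

primrec W :: "'g list \<Rightarrow> 'g \<Rightarrow> 'g" where
  "W [] = id"
| "W (a # l) = ex a \<circ> W l"

abbreviation word :: "'g list \<Rightarrow> bool" where "word l \<equiv> set l \<subseteq> g1 \<union> gm"

lemma W_append: "W (l @ l') = W l \<circ> W l'" by (induction l) (auto simp: o_assoc)

lemma W_GG: "word l \<Longrightarrow> W l \<in> GG L"
  by (induction l) (auto intro: GG.intros simp del: id_apply)

lemma W_inv: "word l \<Longrightarrow> inv (W l) = W (rev (map uminus l)) \<and> aut (W l)"
proof (induction l)
  case (Cons a l)
  have a: "aut (ex a)" and i: "inv (W l) = W (rev (map uminus l))" "aut (W l)"
    using Cons by (auto intro: exp_aut)
  have "inv (ex a \<circ> W l) = inv (W l) \<circ> inv (ex a)" by (rule o_inv_distrib) (use a i in \<open>auto simp: autD\<close>)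
  then show ?case using a i Cons.prems by (simp del: o_apply add: W_append ex_inv aut_comp)
qed (simp add: aut_id del: id_apply)

lemma GG_W: assumes "g \<in> GG L" obtains l where "word l" "g = W l"
proof -
  have "\<exists>l. word l \<and> g = W l" using assms
  proof (induction)
    case one show ?case by (rule exI[of _ "[]"]) simp
  next
    case (gen x) then show ?case by (intro exI[of _ "[x]"]) simp
  next
    case (mult g h) then obtain l l' where "word l" "g = W l" "word l'" "h = W l'" by auto
    then show ?case by (intro exI[of _ "l @ l'"]) (simp add: W_append)
  next
    case (inverse g) then obtain l where "word l" "g = W l" by auto
    then show ?case by (intro exI[of _ "rev (map uminus l)"]) (auto simp: W_inv gr_closed)
  qed
  then show ?thesis using that by auto
qed

lemma GG_aut: "g \<in> GG L \<Longrightarrow> aut g" using GG_W W_inv by metis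

lemma GG_ex: "x \<in> g1 \<Longrightarrow> ex x \<in> GG L" "x \<in> gm \<Longrightarrow> ex x \<in> GG L" by (auto intro: GG.gen)

lemma GG_conj: 
  assumes "g \<in> GG L" "aut f" "\<And>y. f' (f y) = y" "\<And>y. f (f' y) = y" "\<And>x. x \<in> g1 \<union> gm \<Longrightarrow> f x \<in> g1 \<union> gm"
  shows "f \<circ> g \<circ> f' \<in> GG L"
proof -
  obtain l where l: "word l" "g = W l" using GG_W assms(1) by metis
  have "f (W l (f' y)) = W (map f l) y" for y
    by (induction l) (simp_all add: assms(4) aut_ex[OF assms(2)])
  then have "f \<circ> g \<circ> f' = W (map f l)" by (auto simp: l)
  moreover have "word (map f l)" using l assms(5) by auto
  ultimately show ?thesis by (simp only: W_GG)
qed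

lemma theta_GG: "g \<in> GG L \<Longrightarrow> \<theta> \<circ> g \<circ> \<theta> \<in> GG L"
  by (rule GG_conj) (auto simp: theta_aut theta_in)

lemma GG_fix: "g \<in> GG L \<Longrightarrow> (\<And>u. u \<in> g1 \<union> gm \<Longrightarrow> u \<star> b = 0) \<Longrightarrow> g b = b"
proof -
  assume g: "g \<in> GG L" and b: "\<And>u. u \<in> g1 \<union> gm \<Longrightarrow> u \<star> b = 0"
  obtain l where l: "word l" "g = W l" using GG_W g by metis
  have "word l \<Longrightarrow> W l b = b" by (induction l) (auto simp: ex_fix b)
  then show "g b = b" using l by simp
qed

subsection \<open>Flags and their stabilizers\<close>

lemma act_id [simp]: "act id F = F" by (simp add: act_def)
lemma act_comp: "act (f \<circ> g) F = act f (act g F)" by (simp add: act_def image_comp)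

lemma act_inv: "aut f \<Longrightarrow> act f F = F' \<longleftrightarrow> F = act (inv f) F'"
proof -
  assume f: "aut f"
  have "f \<circ> inv f = id" "inv f \<circ> f = id" using f by (auto simp: autD)
  then show ?thesis by (metis act_comp act_id)
qed

lemma base_eq: "base = (gm, {x. p1 x = 0})"
proof -
  have "{a + b | a b. a \<in> gm \<and> b \<in> g0} = {x. p1 x = 0}"
  proof (auto simp: p_gr)
    fix x assume "p1 x = 0"
    then have "x = pm x + p0 x" using p_sum[of x] by (simp add: add.commute)
    then show "\<exists>a b. x = a + b \<and> a \<in> gm \<and> b \<in> g0" using p_in by blast
  qed
  then show ?thesis by (simp add: o_plus_def)
qed

lemma theta_base: "act \<theta> base = o_minus L" 
proof -
  have "\<theta> ` {a + b | a b. a \<in> gm \<and> b \<in> g0} = {a + b | a b. a \<in> g1 \<and> b \<in> g0}"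
  proof (auto)
    fix a b assume "a \<in> gm" "b \<in> g0"
    then have "\<theta> a \<in> g1" "\<theta> b \<in> g0" by (simp_all only: theta_in)
    then show "\<exists>a' b'. \<theta> a + \<theta> b = a' + b' \<and> a' \<in> g1 \<and> b' \<in> g0" by blast
  next
    fix a b assume "a \<in> g1" "b \<in> g0"
    then show "a + b \<in> \<theta> ` {a + b |a b. a \<in> gm \<and> b \<in> g0}"
      by (intro image_eqI[of _ _ "\<theta> a + \<theta> b"]) (use theta_in in \<open>auto\<close>, blast)
  qed
  then show ?thesis using theta_img[of "-1"] by (simp add: act_def o_plus_def o_minus_def)
qed

text \<open>An automorphism fixing the flag \<open>o\<^sup>+\<close> acts on the quotient \<open>\<gg> / (\<gg>\<^sub>0 + \<gg>\<^sub>-\<^sub>1) = \<gg>\<^sub>1\<close>.\<close>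

lemma stab:
  assumes f: "aut f" and s: "act f base = base"
  shows "p1 (f x) = p1 (f (p1 x))" "c \<in> gm \<Longrightarrow> f c \<in> gm" "p1 x = 0 \<Longrightarrow> p1 (f x) = 0"
    "act (inv f) base = base"
proof -
  have m: "f ` gm = gm" "f ` {x. p1 x = 0} = {x. p1 x = 0}" using s by (auto simp: act_def base_eq)
  show "c \<in> gm \<Longrightarrow> f c \<in> gm" using m by auto
  show z: "p1 x = 0 \<Longrightarrow> p1 (f x) = 0" for x using m by auto
  show "p1 (f x) = p1 (f (p1 x))"
    using z[of "x - p1 x"] by (simp add: autD[OF f])
  show "act (inv f) base = base" using act_inv[OF f] s by metis
qed

lemma stabI:
  assumes f: "aut f" and 1: "\<And>c. c \<in> gm \<Longrightarrow> f c \<in> gm" and 2: "\<And>x. p1 x = 0 \<Longrightarrow> p1 (f x) = 0"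
    and 3: "\<And>c. c \<in> gm \<Longrightarrow> inv f c \<in> gm" and 4: "\<And>x. p1 x = 0 \<Longrightarrow> p1 (inv f x) = 0"
  shows "act f base = base"
proof -
  have "f ` gm = gm" using 1 3 autD(10)[OF f] by (metis image_subset_iff rev_image_eqI subsetI subset_antisym)
  moreover have "f ` {x. p1 x = 0} = {x. p1 x = 0}"
    using 2 4 autD(10)[OF f] by (auto simp: image_iff) metis
  ultimately show ?thesis by (simp add: act_def base_eq)
qed

lemma stab_inj:
  assumes f: "aut f" and s: "act f base = base"
  shows "p1 (inv f (p1 (f x))) = p1 x" "p1 (f (p1 (inv f x))) = p1 x"
  using stab(1)[OF aut_inv[OF f] stab(4)[OF f s], of "f x"] stab(1)[OF f s, of "inv f x"]
  by (simp_all add: autD[OF f])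

lemma ex_minus_base: "c \<in> gm \<Longrightarrow> act (ex c) base = base"
  by (rule stabI) (auto simp: exp_aut ex_inv p_ex_minus ex_same gr_closed)

definition degree_zero :: "('g \<Rightarrow> 'g) \<Rightarrow> bool" where
  "degree_zero h \<longleftrightarrow> aut h \<and> (\<forall>x. p1 (h x) = h (p1 x) \<and> p0 (h x) = h (p0 x) \<and> pm (h x) = h (pm x))"

lemma degree_zeroD:
  "degree_zero h \<Longrightarrow> aut h" "degree_zero h \<Longrightarrow> p1 (h x) = h (p1 x)" "degree_zero h \<Longrightarrow> p0 (h x) = h (p0 x)"
  "degree_zero h \<Longrightarrow> pm (h x) = h (pm x)" "degree_zero h \<Longrightarrow> x \<in> g1 \<Longrightarrow> h x \<in> g1"
  "degree_zero h \<Longrightarrow> x \<in> g0 \<Longrightarrow> h x \<in> g0" "degree_zero h \<Longrightarrow> x \<in> gm \<Longrightarrow> h x \<in> gm"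
  by (auto simp: degree_zero_def in_gr_iff)

lemma degree_zeroI: 
  assumes f: "aut h" and "\<And>x. h (euler \<star> x) = euler \<star> h x"
  shows "degree_zero h"
  unfolding degree_zero_def by (simp add: p1_def p0_def pm_def autD(2,3,6)[OF f] assms)

lemma degree_zero_inv: assumes "degree_zero h" shows "degree_zero (inv h)"
proof -
  note h = assms[THEN degree_zeroD(1)]
  have "p1 (inv h x) = inv h (p1 x) \<and> p0 (inv h x) = inv h (p0 x) \<and> pm (inv h x) = inv h (pm x)" for x
    using degree_zeroD(2-4)[OF assms, of "inv h x"] autD(9,10)[OF h] by metis
  then show ?thesis unfolding degree_zero_def using h by (simp add: aut_inv)
qed

lemma degree_zero_base: "degree_zero h \<Longrightarrow> act h base = base"
  using degree_zero_inv[of h] by (intro stabI) (auto simp: degree_zeroD autD)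

lemma degree_zero_theta: assumes "degree_zero h" shows "degree_zero (\<theta> \<circ> h \<circ> \<theta>)"
  using assms theta_aut unfolding degree_zero_def by (auto simp: theta_p intro!: aut_comp)

text \<open>The stabilizer of \<open>o\<^sup>+\<close> is a semidirect product: \<open>f E\<close> acts on the graded pieces of the filtration as \<open>E\<close> does,
  so \<open>ad (f E) = ad (E + w) = e\<^sup>w ad (E) e\<^sup>-\<^sup>w\<close> where \<open>w\<close> is the component of \<open>f E\<close> of degree -1, and \<open>e\<^sup>-\<^sup>w f\<close>
  commutes with \<open>ad E\<close>.\<close>

lemma stab_factor:
  assumes f: "aut f" and s: "act f base = base"
  defines "w \<equiv> pm (f euler)"
  shows "degree_zero (ex (- w) \<circ> f)"
proof (rule degree_zeroI)
  have w: "w \<in> gm" "- w \<in> gm" by (simp_all add: w_def gr_closed)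
  note F = autD[OF f] and FI = autD[OF aut_inv[OF f]]
  show "aut (ex (- w) \<circ> f)" using f w by (auto intro: aut_comp exp_aut)
  define E' where "E' = p0 (f euler)"
  have e: "f euler = E' + w"
    using p_sum[of "f euler"] stab(3)[OF f s, of euler] by (simp add: E'_def w_def)
  have E0: "E' \<in> g0" by (simp add: E'_def)
  have 1: "E' \<star> v = v" if v: "v \<in> g1" for v
  proof -
    have "p1 (f (euler \<star> inv f v)) = E' \<star> v"
      using v E0 w by (simp add: F e p_br p_gr)
    moreover have "p1 (f (euler \<star> inv f v)) = p1 (f (p1 (inv f v)))"
      using stab(1)[OF f s, of "euler \<star> inv f v"] by (simp add: euler_p)
    moreover have "\<dots> = v" using stab_inj(2)[OF f s, of v] v by (simp add: p_gr)
    ultimately show ?thesis by simp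
  qed
  have 2: "E' \<star> v = - v" if v: "v \<in> gm" for v
  proof -
    have "inv f v \<in> gm" using stab(2)[OF aut_inv[OF f] stab(4)[OF f s] v] .
    then have "- v = f (euler \<star> inv f v)" by (simp add: euler_simps F)
    also have "\<dots> = E' \<star> v" using v w by (simp add: F e lin br_same)
    finally show ?thesis by simp
  qed
  have 3: "E' \<star> v = 0" if v: "v \<in> g0" for v
  proof -
    have "p1 (inv f v) = 0" using stab(3)[OF aut_inv[OF f] stab(4)[OF f s]] v by (simp add: p_gr)
    then have "f (euler \<star> inv f v) \<in> gm"
      by (intro stab(2)[OF f s]) (simp add: euler_p gr_closed)
    then have "p0 ((E' + w) \<star> v) = 0" by (simp add: F e p_gr)
    then show ?thesis using v E0 w by (simp add: p_br p_gr)
  qed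
  have E': "E' \<star> x = euler \<star> x" for x
  proof -
    have "E' \<star> (p1 x + p0 x + pm x) = p1 x - pm x" by (simp only: br_add_right 1 2 3 p_in) simp
    then show ?thesis unfolding p_sum[of x, symmetric] by (simp add: euler_p)
  qed
  show "(ex (- w) \<circ> f) (euler \<star> x) = euler \<star> (ex (- w) \<circ> f) x" for x
  proof -
    have a: "aut (ex (- w))" using w by (auto intro: exp_aut)
    have "(ex (- w) \<circ> f) (euler \<star> x) = ex (- w) ((euler + w) \<star> f x)"
      by (simp add: F e lin E')
    also have "\<dots> = ex (- w) (ex w euler) \<star> ex (- w) (f x)"
      using w by (simp add: autD[OF a] ex_euler)
    finally show ?thesis using w by (simp add: ex_cancel)
  qed
qed

subsection \<open>The chart at the base point\<close>

text \<open>The coordinate \<open>x\<close> of \<open>e\<^sup>x.o\<^sup>+\<close> is the component of degree 1 of \<open>-e\<^sup>x E\<close>, and elements fixing \<open>o\<^sup>+\<close> keep \<open>E\<close> in the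
  filtration.\<close>

lemma embed_inj: 
  assumes "x \<in> g1" "y \<in> g1" "embed_V L x = embed_V L y" shows "x = y"
proof -
  have m: "- y + x \<in> g1" by (intro gr_closed assms)
  have e: "ex (- y) \<circ> ex x = ex (- y + x)"
    by (rule ex_add[symmetric]) (simp add: assms gr_closed)
  have "act (ex (- y)) (act (ex x) base) = base"
    using assms act_inv[of "ex y" base "embed_V L y"] by (simp add: embed_V_def exp_aut ex_inv)
  then have st: "act (ex (- y + x)) base = base" by (simp only: act_comp[symmetric] e)
  have "aut (ex (- y + x))" using m by (blast intro: exp_aut)
  from stab(3)[OF this st p_euler(1)] have "p1 (ex (- y + x) euler) = 0" .
  then have "p1 (- y + x) = 0" by (simp only: ex_euler(1)[OF m] p_diff p_euler) simp
  then show ?thesis using assms by (simp add: p_gr)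
qed

lemma GG_cancel: "g \<in> GG L \<Longrightarrow> inv g (g x) = x" "g \<in> GG L \<Longrightarrow> g (inv g x) = x"
  by (auto simp: GG_aut autD)

text \<open>If \<open>k.o\<^sup>+ = e\<^sup>x.o\<^sup>+\<close>, then \<open>e\<^sup>-\<^sup>x k\<close> fixes \<open>o\<^sup>+\<close> and is therefore block triangular with invertible diagonal
  blocks.  On \<open>\<gg>\<^sub>1\<close> the inverses of \<open>k\<close> and \<open>e\<^sup>-\<^sup>x k\<close> agree, and on \<open>\<gg>\<^sub>-\<^sub>1\<close> the
  components of degree -1 of \<open>k\<close> and \<open>e\<^sup>-\<^sup>x k\<close>.\<close>

lemma chart_value:
  assumes k: "k \<in> GG L" and x: "x \<in> g1" and e: "act k base = embed_V L x"
  shows "p1 (inv k x) = p1 (inv k euler)" "act (ex (- x) \<circ> k) base = base"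
    "v \<in> g1 \<Longrightarrow> p1 (inv k (p1 (ex (- x) (k v)))) = v" "v \<in> g1 \<Longrightarrow> p1 (ex (- x) (k (p1 (inv k v)))) = v"
    "bij_betw (\<lambda>v. p1 (inv k v)) g1 g1" "bij_betw (\<lambda>v. pm (k v)) gm gm"
proof -
  let ?f = "ex (- x) \<circ> k"
  have a: "aut k" "aut (ex (- x))" "aut (ex x)" "aut ?f" using k x by (auto intro!: exp_aut aut_comp simp: gr_closed GG_aut)
  show s: "act ?f base = base"
    using e act_inv[OF a(3), of base "act k base"] x by (simp add: embed_V_def act_comp ex_inv)
  have i: "inv ?f = inv k \<circ> ex x"
    by (rule inv_equality) (use x in \<open>auto simp: autD[OF a(1)] ex_cancel\<close>)
  have iv: "inv ?f v = inv k v" if "v \<in> g1" for v using that x by (simp add: i ex_same)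
  have "p1 (inv ?f euler) = 0" by (rule stab(3)[OF aut_inv[OF a(4)] stab(4)[OF a(4) s]]) simp
  then show "p1 (inv k x) = p1 (inv k euler)"
    using x by (simp add: i ex_euler autD(6)[OF aut_inv[OF a(1)]])
  show 1: "p1 (inv k (p1 (ex (- x) (k v)))) = v" if "v \<in> g1" for v
    using stab_inj(1)[OF a(4) s, of v] that iv[of "p1 (?f v)"] by (simp add: p_gr)
  show 2: "p1 (ex (- x) (k (p1 (inv k v)))) = v" if "v \<in> g1" for v
    using stab_inj(2)[OF a(4) s, of v] that iv[of v] by (simp add: p_gr)
  show "bij_betw (\<lambda>v. p1 (inv k v)) g1 g1"
    by (rule bij_betw_byWitness[of _ "\<lambda>v. p1 (ex (- x) (k v))"]) (auto simp: 1 2)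
  have f: "pm (k v) = ?f v" if "v \<in> gm" for v
    using stab(2)[OF a(4) s that] x p_ex_plus(3)[of "- x" "k v"] by (simp add: gr_closed p_gr)
  have "bij_betw ?f gm gm"
    by (rule bij_betw_byWitness[of _ "inv ?f"])
      (use stab(2)[OF a(4) s] stab(2)[OF aut_inv[OF a(4)] stab(4)[OF a(4) s]] in \<open>auto simp: autD[OF a(4)] simp del: o_apply\<close>)
  then show "bij_betw (\<lambda>v. pm (k v)) gm gm" using f by (simp cong: bij_betw_cong)
qed

text \<open>Invertibility of the two diagonal blocks is also sufficient.  The block on \<open>\<gg>\<^sub>1\<close> singles out the only possible
  \<open>x\<close>: for it, \<open>q = k\<^sup>-\<^sup>1 e\<^sup>x\<close> sends \<open>E\<close> to \<open>E' + u\<close> without a component of degree 1.  Comparing the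
  eigenspaces of \<open>ad E\<close> with those of \<open>ad (E' + u)\<close> shows that \<open>E'\<close> acts on \<open>\<gg>\<^sub>1\<close> and \<open>\<gg>\<^sub>-\<^sub>1\<close> as \<open>E\<close>
  does and that \<open>q\<close> respects the filtration, up to a possible component of degree 0 of \<open>q v\<close> for \<open>v\<close> of degree -1.\<close>

lemma chart_criterion:
  assumes k: "k \<in> GG L" and d: "bij_betw (\<lambda>v. p1 (inv k v)) g1 g1" and c: "bij_betw (\<lambda>v. pm (k v)) gm gm"
  obtains x where "x \<in> g1" "act k base = embed_V L x"
proof -
  have "p1 (inv k euler) \<in> (\<lambda>v. p1 (inv k v)) ` g1" using d by (simp add: bij_betw_def)
  then obtain x where x: "x \<in> g1" "p1 (inv k x) = p1 (inv k euler)" by auto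
  define f where "f = ex (- x) \<circ> k"
  define q where "q = inv k \<circ> ex x"
  have a: "aut k" "aut (inv k)" "aut (ex (- x))" "aut (ex x)" using k x by (auto intro!: GG_aut exp_aut aut_inv simp: gr_closed)
  have G: "q \<in> GG L" using k x by (auto simp: q_def intro!: GG.intros)
  have aq: "aut q" and af: "aut f" using a by (auto simp: q_def f_def aut_comp)
  have fq: "f (q y) = y" and qf: "q (f y) = y" for y using x by (simp_all add: f_def q_def autD[OF a(1)] ex_cancel)
  have iq: "inv q = f" by (rule inv_equality) (auto simp: fq qf)
  have qv: "q v = inv k v" if "v \<in> g1" for v using that x by (simp add: q_def ex_same)
  have pf: "pm (f y) = pm (k y)" for y using x by (simp add: f_def p_ex_plus gr_closed)
  define E' where "E' = p0 (q euler)"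
  define u where "u = pm (q euler)"
  have qE: "p1 (q euler) = 0" using x by (simp add: q_def ex_euler autD[OF a(2)])
  then have e: "q euler = E' + u" using p_sum[of "q euler"] by (simp add: E'_def u_def)
  have E0: "E' \<in> g0" and um: "u \<in> gm" by (simp_all add: E'_def u_def)
  have qbr: "p1 (q (euler \<star> y)) = E' \<star> p1 (q y)" for y
    by (simp add: autD[OF aq] p_br qE E'_def)
  have 1: "E' \<star> v = v" if v: "v \<in> g1" for v
  proof -
    obtain v' where v': "v' \<in> g1" "v = p1 (q v')" using d v qv by (auto simp: bij_betw_def image_iff) 
    then show ?thesis using qbr[of v'] by (simp add: euler_simps)
  qed
  have q0: "p1 (q y) = 0" if "y \<in> g0" for y using qbr[of y] that by (simp add: euler_simps 1 autD[OF aq])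
  have qm: "p1 (q y) = 0" if "y \<in> gm" for y 
  proof (rule double_zero)
    have "p1 (q (- y)) = p1 (q y)" using qbr[of y] that by (simp only: euler_simps 1 p_in)
    then show "p1 (q y) + p1 (q y) = 0" by (metis add.right_inverse autD(5)[OF aq] p_minus(1))
  qed
  have q1: "p1 (q y) = p1 (q (p1 y))" for y
  proof -
    have "q y = q (p1 y) + q (p0 y) + q (pm y)" using p_sum[of y] autD(2)[OF aq] by metis
    then show ?thesis by (simp add: q0 qm)
  qed
  have 2: "E' \<star> v = - v" if v: "v \<in> gm" for v
  proof -
    have "pm (f (q euler \<star> v)) = pm (f (- v))" by (simp add: autD[OF af] fq euler_p)
    moreover have "q euler \<star> v = E' \<star> v" using um v by (simp add: e lin br_same)
    ultimately have "pm (k (E' \<star> v)) = pm (k (- v))" by (simp add: pf)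
    then show ?thesis using c v E0 by (simp add: bij_betw_def inj_on_def br_gr gr_closed)
  qed
  have qgm: "q v \<in> gm" if v: "v \<in> gm" for v
  proof -
    define b where "b = p0 (q v)"
    have b0: "b \<in> g0" by (simp add: b_def)
    have "p0 (q (euler \<star> v)) = E' \<star> b" by (simp add: autD[OF aq] p_br qE qm v E'_def b_def)
    \<comment> \<open>The component \<open>b\<close> is an eigenvector of \<open>ad E'\<close> for -1, but \<open>E'\<close> commutes with \<open>b\<close> on \<open>\<gg>\<^sub>1\<close> and \<open>\<gg>\<^sub>-\<^sub>1\<close>.\<close>
    then have Eb: "E' \<star> b = - b" using v by (simp add: euler_simps autD[OF aq] b_def)
    have bz: "w \<star> b = 0" if w: "w \<in> g1 \<union> gm" for w
    proof -
      have wE: "E' \<star> b \<star> w = b \<star> E' \<star> w"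
        using w by (auto simp: 1 2 br_gr b0)
      have "(E' \<star> b) \<star> w = 0" using jacobi[of E' b w] wE by simp
      then show ?thesis using br_anti[of w b] by (simp add: Eb)
    qed
    \<comment> \<open>So \<open>b\<close> is fixed by \<open>G\<close>; as \<open>u\<close> commutes with \<open>b\<close>, applying \<open>q\<close> to \<open>[E, b] = 0\<close> gives \<open>b = 0\<close>.\<close>
    have "q b = b" using G bz by (rule GG_fix)
    then have "q euler \<star> b = 0" using autD(4)[OF aq, of euler b] b0 by (simp add: euler_simps autD[OF aq])
    then have "b = 0" using bz[of u] um by (simp add: e lin Eb)
    then have "q v = pm (q v)" using p_sum[of "q v"] qm[OF v] by (simp add: b_def)
    then show ?thesis by (metis p_in(3))
  qed
  have "act q base = base"
  proof (rule stabI[OF aq qgm])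
    show "p1 (q y) = 0" if "p1 y = 0" for y using q1[of y] that by (simp add: autD[OF aq])
    show "inv q y \<in> gm" if y: "y \<in> gm" for y
    proof -
      have "pm (f (q (pm (f y)))) = pm (f y)" by (simp add: fq)
      then have "q (pm (f y)) = y" using c qgm[of "pm (f y)"] y by (auto simp: bij_betw_def inj_on_def pf)
      then show ?thesis by (metis iq fq p_in(3))
    qed
    show "p1 (inv q y) = 0" if "p1 y = 0" for y
    proof -
      have "p1 (q (p1 (f y))) = p1 (q 0)" using q1[of "f y"] that by (simp add: qf autD[OF aq])
      then have "p1 (inv k (p1 (f y))) = p1 (inv k 0)" by (simp add: qv)
      moreover have "inj_on (\<lambda>v. p1 (inv k v)) g1" using d by (simp add: bij_betw_def)
      ultimately have "p1 (f y) = 0" by (simp add: inj_on_def)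
      then show ?thesis by (simp add: iq)
    qed
  qed
  then have "act (inv k) (embed_V L x) = base" by (simp add: q_def act_comp embed_V_def)
  then have "act k base = embed_V L x" using act_inv[OF a(1)] by metis
  then show ?thesis using x that by blast
qed

text \<open>The diagonal blocks of \<open>k = e\<^sup>w e\<^sup>z\<close> are Bergman operators: expanding the exponentials leaves
  \<open>v + [z, [w, v]]\<close> and one quarter of \<open>[z, [z, [w, [w, v]]]]\<close>, and the iterated brackets are triple products.\<close>

lemma bergman_blocks:
  assumes z: "z \<in> g1" and w: "w \<in> gm" and v: "v \<in> g1"
  shows "bergman L z (- \<theta> w) v = p1 (ex (- z) (ex (- w) v))"
    "bergman L (- \<theta> w) z v = \<theta> (pm (ex w (ex z (\<theta> v))))"
proof -
  have T: "(x \<star> c) \<star> u = x \<star> c \<star> u" if "x \<in> g1 \<and> u \<in> g1 \<or> x \<in> gm \<and> u \<in> gm" for x c u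
    using jacobi[of x c u] that by (auto simp: br_same)
  define y where "y = \<theta> w"
  have mem: "- w \<in> gm" "- z \<in> g1" "y \<in> g1" "\<theta> z \<in> gm" "\<theta> v \<in> gm"
    using z w v by (simp_all add: theta_in gr_closed y_def)
  have T1: "(z \<star> c) \<star> v = z \<star> c \<star> v" "(z \<star> c) \<star> z = - (z \<star> z \<star> c)" 
    "(w \<star> c) \<star> w = - (w \<star> w \<star> c)" "(y \<star> c) \<star> v = y \<star> c \<star> v"
    "(y \<star> c) \<star> y = - (y \<star> y \<star> c)" "(\<theta> z \<star> c) \<star> \<theta> z = - (\<theta> z \<star> \<theta> z \<star> c)" for c
    using T[of z v c] T[of y v c] z v mem(3) br_anti[of "z \<star> c" z] br_anti[of "w \<star> c" w] 
      br_anti[of "y \<star> c" y] br_anti[of "\<theta> z \<star> c" "\<theta> z"] by blast+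
  have "bergman L z (- \<theta> w) v = v + z \<star> w \<star> v + (half * half) \<cdot> (z \<star> z \<star> w \<star> w \<star> v)"
    by (simp add: bergman_def triple_def quad_def br_scale_left br_scale_right T1)
  also have "\<dots> = p1 (ex (- z) (ex (- w) v))"
    using z w v mem by (simp add: p_ex_plus p_ex_minus p_gr br_scale_right)
  finally show "bergman L z (- \<theta> w) v = p1 (ex (- z) (ex (- w) v))" .
  have "bergman L (- \<theta> w) z v = v + y \<star> \<theta> z \<star> v + (half * half) \<cdot> (y \<star> y \<star> \<theta> z \<star> \<theta> z \<star> v)"
    by (simp add: bergman_def triple_def quad_def br_scale_left br_scale_right T1 flip: y_def)
  also have "\<dots> = \<theta> (pm (ex w (ex z (\<theta> v))))"
    using z w v mem by (simp add: p_ex_plus p_ex_minus p_gr br_scale_right flip: y_def)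
  finally show "bergman L (- \<theta> w) z v = \<theta> (pm (ex w (ex z (\<theta> v))))" .
qed

lemma theta_bij: "bij_betw \<theta> g1 gm" "bij_betw \<theta> gm g1"
  by (rule bij_betw_byWitness[of _ \<theta>]; auto simp: theta_in)+

text \<open>The coordinate of \<open>e\<^sup>w e\<^sup>z.o\<^sup>+\<close>, the quasi-inverse of \<open>z\<close> with respect to \<open>-\<theta> w\<close>.\<close>

definition qi :: "'g \<Rightarrow> 'g \<Rightarrow> 'g" where
  "qi z w = the_inv_into g1 (bergman L z (- \<theta> w)) (z - half \<cdot> (z \<star> z \<star> w))"

lemma quasi_iff:
  assumes z: "z \<in> g1" and w: "w \<in> gm"
  shows "(z, - \<theta> w) \<in> quasi_invertible L \<longleftrightarrow> (\<exists>x\<in>g1. act (ex w \<circ> ex z) base = embed_V L x)"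
    and "(z, - \<theta> w) \<in> quasi_invertible L \<Longrightarrow> qi z w \<in> g1 \<and> act (ex w \<circ> ex z) base = embed_V L (qi z w)"
proof -
  let ?k = "ex w \<circ> ex z"
  have k: "?k \<in> GG L" using z w by (intro GG.mult GG_ex)
  have i: "inv ?k = ex (- z) \<circ> ex (- w)"
    by (rule inv_equality) (use z w in \<open>auto simp: ex_cancel\<close>)
  have b1: "bij_betw (bergman L z (- \<theta> w)) g1 g1 \<longleftrightarrow> bij_betw (\<lambda>v. p1 (inv ?k v)) g1 g1"
    by (rule bij_betw_cong) (simp add: i bergman_blocks z w)
  have "bij_betw (bergman L (- \<theta> w) z) g1 g1 \<longleftrightarrow> bij_betw (\<theta> \<circ> (\<lambda>v. pm (?k v)) \<circ> \<theta>) g1 g1"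
    by (rule bij_betw_cong) (simp add: bergman_blocks z w)
  also have "\<dots> \<longleftrightarrow> bij_betw (\<lambda>v. pm (?k v)) gm gm"
  proof
    assume "bij_betw (\<theta> \<circ> (\<lambda>v. pm (?k v)) \<circ> \<theta>) g1 g1"
    from bij_betw_trans[OF bij_betw_trans[OF theta_bij(2) this] theta_bij(1)]
    show "bij_betw (\<lambda>v. pm (?k v)) gm gm" by (simp add: comp_def)
  next
    assume "bij_betw (\<lambda>v. pm (?k v)) gm gm"
    from bij_betw_trans[OF bij_betw_trans[OF theta_bij(1) this] theta_bij(2)]
    show "bij_betw (\<theta> \<circ> (\<lambda>v. pm (?k v)) \<circ> \<theta>) g1 g1" by (simp add: comp_def)
  qed
  finally have b2: "bij_betw (bergman L (- \<theta> w) z) g1 g1 \<longleftrightarrow> bij_betw (\<lambda>v. pm (?k v)) gm gm" .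
  have m: "- \<theta> w \<in> g1" using w by (simp add: gr_closed theta_in)
  then have q: "(z, - \<theta> w) \<in> quasi_invertible L \<longleftrightarrow>
      bij_betw (\<lambda>v. p1 (inv ?k v)) g1 g1 \<and> bij_betw (\<lambda>v. pm (?k v)) gm gm"
    using z b1 b2 by (simp add: quasi_invertible_def)
  show e: "(z, - \<theta> w) \<in> quasi_invertible L \<longleftrightarrow> (\<exists>x\<in>g1. act ?k base = embed_V L x)"
    using q chart_criterion[OF k] chart_value(5,6)[OF k] by metis
  assume Q: "(z, - \<theta> w) \<in> quasi_invertible L"
  then obtain x where x: "x \<in> g1" "act ?k base = embed_V L x" using e by auto
  have "p1 (inv ?k euler) = z - half \<cdot> (z \<star> z \<star> w)"
    using z w br_anti[of z euler] by (simp add: i ex_euler p_ex_plus gr_closed p_gr euler_simps)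
  then have "bergman L z (- \<theta> w) x = z - half \<cdot> (z \<star> z \<star> w)"
    using chart_value(1)[OF k x] x(1) by (simp add: i bergman_blocks z w)
  then have "qi z w = x" unfolding qi_def using Q x(1)
    by (intro the_inv_into_f_eq) (auto simp: quasi_invertible_def bij_betw_def)
  then show "qi z w \<in> g1 \<and> act ?k base = embed_V L (qi z w)" using x by simp
qed

subsection \<open>Frames and symmetries\<close>

abbreviation \<delta> :: "'g \<Rightarrow> 'g" where "\<delta> \<equiv> delta L"

lemma delta_eq: "\<delta> x = p0 x - p1 x - pm x"
  unfolding delta_def
proof (rule the_equality)
  show "\<exists>a\<in>g1. \<exists>b\<in>g0. \<exists>c\<in>gm. x = a + b + c \<and> p0 x - p1 x - pm x = - a + b - c"
    using p_sum[of x] by (intro bexI[of _ "p1 x"] bexI[of _ "p0 x"] bexI[of _ "pm x"]) auto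
next
  fix y assume "\<exists>a\<in>g1. \<exists>b\<in>g0. \<exists>c\<in>gm. x = a + b + c \<and> y = - a + b - c"
  then show "y = p0 x - p1 x - pm x" by (auto simp: p_gr)
qed

lemma p_delta: "p1 (\<delta> x) = - p1 x" "p0 (\<delta> x) = p0 x" "pm (\<delta> x) = - pm x"
  by (simp_all add: delta_eq)

lemma delta_delta [simp]: "\<delta> (\<delta> x) = x"
  by (rule p_ext) (simp_all add: p_delta)

lemma delta_gr: "a \<in> g1 \<union> gm \<Longrightarrow> \<delta> a = - a" by (auto simp: delta_eq p_gr)

lemma delta_aut: "aut \<delta>"
proof (rule autI)
  show "bij \<delta>" by (rule bij_betw_byWitness[of _ \<delta>]) auto
  show "\<delta> (x + y) = \<delta> x + \<delta> y" for x y by (simp add: delta_eq algebra_simps)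
  show "\<delta> (t \<cdot> x) = t \<cdot> \<delta> x" for t x by (simp add: delta_eq algebra_simps)
  show "\<delta> (x \<star> y) = \<delta> x \<star> \<delta> y" for x y by (rule p_ext) (simp_all add: p_delta p_br)
qed

lemma delta_degree_zero: "degree_zero \<delta>"
  unfolding degree_zero_def using delta_aut by (simp add: delta_eq)

lemma delta_theta: "\<delta> (\<theta> x) = \<theta> (\<delta> x)"
  by (simp add: delta_eq theta_p algebra_simps)

lemma delta_GG: "g \<in> GG L \<Longrightarrow> \<delta> \<circ> g \<circ> \<delta> \<in> GG L"
  by (rule GG_conj) (auto simp: delta_aut delta_gr gr_closed)

text \<open>Transporting \<open>\<delta>\<close> by a frame at \<open>x\<close> gives the symmetry at \<open>x\<close>.  As \<open>o\<^sup>- = \<theta>.o\<^sup>+\<close>, a frame carries the standard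
  transversal pair to \<open>(x, p(x))\<close>.\<close>

definition frame :: "'g flag \<Rightarrow> ('g \<Rightarrow> 'g) \<Rightarrow> bool" where
  "frame x g \<longleftrightarrow> g \<in> GG L \<and> act g base = x \<and> act g (act \<theta> base) = act \<theta> x"

text \<open>Fixing both \<open>o\<^sup>+\<close> and \<open>o\<^sup>-\<close> means preserving two opposite filtrations, hence their intersections.\<close>

lemma frame_stab:
  assumes q: "aut q" and 1: "act q base = base" and 2: "act q (act \<theta> base) = act \<theta> base"
  shows "degree_zero q"
proof -
  let ?q = "\<theta> \<circ> q \<circ> \<theta>"
  have a: "aut ?q" using q theta_aut by (intro aut_comp)
  have s: "act ?q base = base" using 2 by (simp add: act_comp) (metis act_comp act_id theta_comp)
  have m: "q c \<in> gm" if "c \<in> gm" for c using stab(2)[OF q 1 that] .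
  have p: "q c \<in> g1" if "c \<in> g1" for c using stab(2)[OF a s, of "\<theta> c"] that by (simp add: theta_in)
  have z: "q c \<in> g0" if c: "c \<in> g0" for c
  proof -
    have "p1 (q c) = 0" using stab(3)[OF q 1, of c] c by (simp add: p_gr)
    moreover have "p1 (?q (\<theta> c)) = 0" using stab(3)[OF a s, of "\<theta> c"] c by (simp add: p_gr theta_p)
    then have "\<theta> (pm (q c)) = 0" by (simp add: theta_p)
    then have "pm (q c) = 0" by (metis theta_theta theta_simps(6))
    ultimately show ?thesis using p_sum[of "q c"] by (metis add.left_neutral add.right_neutral p_in(2))
  qed
  have "p1 (q x) = q (p1 x) \<and> p0 (q x) = q (p0 x) \<and> pm (q x) = q (pm x)" for x
  proof -
    have e: "q x = q (p1 x) + q (p0 x) + q (pm x)" using p_sum[of x] autD(2)[OF q] by metis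
    show ?thesis
      unfolding e p_add using p[of "p1 x"] z[of "p0 x"] m[of "pm x"] by (simp add: p_gr)
  qed
  then show ?thesis using q by (simp add: degree_zero_def)
qed

definition sy :: "('g \<Rightarrow> 'g) \<Rightarrow> 'g \<Rightarrow> 'g" where "sy g = g \<circ> \<delta> \<circ> inv g"

text \<open>Two frames at \<open>x\<close> differ by an automorphism of degree 0, and those commute with \<open>\<delta>\<close>.\<close>

lemma sy_unique:
  assumes "frame x g" "frame x h" shows "sy g = sy h"
proof -
  have G: "aut g" "aut h" "aut (inv g)" "aut (inv h)" using assms by (auto simp: frame_def GG_aut aut_inv)
  have "degree_zero (inv h \<circ> g)"
  proof (rule frame_stab)
    show "aut (inv h \<circ> g)" using G by (intro aut_comp)
    show "act (inv h \<circ> g) base = base" "act (inv h \<circ> g) (act \<theta> base) = act \<theta> base"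
      using assms act_inv[OF G(2)] by (auto simp: frame_def act_comp)
  qed
  then have q: "\<delta> (inv h (g y)) = inv h (g (\<delta> y))" for y
    using degree_zeroD(2-4)[of "inv h \<circ> g"] autD(6)[OF degree_zeroD(1), of "inv h \<circ> g"]
    by (simp add: delta_eq)
  have "g (\<delta> (inv g y)) = h (\<delta> (inv h y))" for y
    using arg_cong[OF q[of "inv g y"], of h] by (simp add: autD[OF G(1)] autD[OF G(2)])
  then show ?thesis by (auto simp: sy_def)
qed

lemma frame_theta: assumes "frame x g" shows "frame x (\<theta> \<circ> g \<circ> \<theta>)"
proof -
  have tt: "act \<theta> (act \<theta> F) = F" for F by (metis act_comp act_id theta_comp)
  show ?thesis using assms by (auto simp: frame_def theta_GG act_comp tt simp del: o_apply)
qed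

text \<open>Conjugation by \<open>\<theta>\<close> turns frames at \<open>x\<close> into frames at \<open>x\<close>, and the symmetry does not depend on the frame.\<close>

lemma sy_theta: assumes "frame x g" shows "sy g (\<theta> y) = \<theta> (sy g y)"
proof -
  have G: "aut g" using assms by (simp add: frame_def GG_aut)
  have "inv (\<theta> \<circ> g \<circ> \<theta>) = \<theta> \<circ> inv g \<circ> \<theta>"
    by (rule inv_equality) (auto simp: autD[OF G])
  then have "sy (\<theta> \<circ> g \<circ> \<theta>) y = \<theta> (sy g (\<theta> y))" for y by (simp add: sy_def delta_theta)
  then show ?thesis using sy_unique[OF assms frame_theta[OF assms]] by (metis theta_theta)
qed

lemma sy_sy: "aut g \<Longrightarrow> sy g (sy g y) = y" by (simp add: sy_def autD)

lemma M_mult_frame: assumes "frame x g" shows "M_mult L x y = act (sy g) y"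
  unfolding M_mult_def mu_neg_def
proof (rule the_equality)
  show "\<exists>h\<in>GG L. x = act h base \<and> polarity L x = act h (o_minus L) \<and> act (sy g) y = act (h \<circ> \<delta> \<circ> inv h) y"
    using assms by (intro bexI[of _ g]) (auto simp: frame_def polarity_def theta_base[symmetric] sy_def)
next
  fix z assume "\<exists>h\<in>GG L. x = act h base \<and> polarity L x = act h (o_minus L) \<and> z = act (h \<circ> \<delta> \<circ> inv h) y"
  then obtain h where "frame x h" "z = act (sy h) y" by (auto simp: frame_def polarity_def theta_base[symmetric] sy_def)
  then show "z = act (sy g) y" using sy_unique[OF assms] by metis
qed

subsection \<open>Non-isotropic points\<close>

lemma X_plus_iff: "F \<in> X_plus L \<longleftrightarrow> (\<exists>g\<in>GG L. F = act g base)" by (auto simp: X_plus_def)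

lemma direct_sum_image:
  assumes f: "aut f" shows "direct_sum (f ` A) (f ` B) \<longleftrightarrow> direct_sum A B"
proof -
  have "direct_sum (h ` A) (h ` B)" if h: "aut h" and d: "direct_sum A B" for h A B
  proof -
    have "bij_betw (map_prod (inv h) (inv h)) (h ` A \<times> h ` B) (A \<times> B)"
      by (rule bij_betw_byWitness[of _ "map_prod h h"]) (auto simp: autD[OF h])
    from bij_betw_trans[OF bij_betw_trans[OF this d[unfolded direct_sum_def]] autD(1)[OF h]]
    have b: "bij_betw (h \<circ> ((\<lambda>(a, b). a + b) \<circ> map_prod (inv h) (inv h))) (h ` A \<times> h ` B) UNIV" .
    show ?thesis unfolding direct_sum_def
      by (rule bij_betw_cong[THEN iffD1, OF _ b]) (auto simp: autD[OF h])
  qed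
  from this[OF f] this[OF aut_inv[OF f], of "f ` A" "f ` B"] show ?thesis
    by (auto simp: image_image autD[OF f])
qed

lemma direct_sum_block:
  assumes f: "aut f" 
  shows "direct_sum (f ` gm) {x. p1 x = 0} \<longleftrightarrow> bij_betw (\<lambda>v. p1 (f v)) gm g1"
proof
  assume d: "direct_sum (f ` gm) {x. p1 x = 0}"
  show "bij_betw (\<lambda>v. p1 (f v)) gm g1" unfolding bij_betw_def
  proof (intro conjI inj_onI equalityI subsetI)
    fix v v' assume v: "v \<in> gm" "v' \<in> gm" "p1 (f v) = p1 (f v')"
    have "(f v, 0) \<in> f ` gm \<times> {x. p1 x = 0}" "(f v', f v - f v') \<in> f ` gm \<times> {x. p1 x = 0}" using v by auto
    moreover have "f v + 0 = f v' + (f v - f v')" by simp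
    ultimately have "(f v, 0) = (f v', f v - f v')" 
      using inj_onD[OF bij_betw_imp_inj_on[OF d[unfolded direct_sum_def]], of "(f v, 0)" "(f v', f v - f v')"] by simp
    then show "v = v'" by (simp add: autD[OF f])
  next
    fix u assume u: "u \<in> g1"
    have "u \<in> (\<lambda>(a, b). a + b) ` (f ` gm \<times> {x. p1 x = 0})" using d by (simp add: direct_sum_def bij_betw_def)
    then obtain v y where "v \<in> gm" "p1 y = 0" "u = f v + y" by auto
    then have "v \<in> gm" "u = p1 (f v)" using u p_gr(1)[of u] by auto
    then show "u \<in> (\<lambda>v. p1 (f v)) ` gm" by blast
  qed auto
next
  assume b: "bij_betw (\<lambda>v. p1 (f v)) gm g1"
  show "direct_sum (f ` gm) {x. p1 x = 0}" unfolding direct_sum_def bij_betw_def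
  proof (intro conjI inj_onI equalityI subsetI)
    fix s t assume s: "s \<in> f ` gm \<times> {x. p1 x = 0}" and t: "t \<in> f ` gm \<times> {x. p1 x = 0}"
      and e: "(case s of (a, b) \<Rightarrow> a + b) = (case t of (a, b) \<Rightarrow> a + b)"
    obtain v y v' y' where [simp]: "s = (f v, y)" "t = (f v', y')" and m: "v \<in> gm" "v' \<in> gm" "p1 y = 0" "p1 y' = 0"
      using s t by auto
    have e': "f v + y = f v' + y'" using e by simp
    have "p1 (f v) = p1 (f v')" using arg_cong[OF e', of p1] m by simp
    then have "v = v'" using b m by (auto simp: bij_betw_def inj_on_def)
    then show "s = t" using e' by simp
  next
    fix x :: 'g
    have "p1 x \<in> (\<lambda>v. p1 (f v)) ` gm" using b by (simp add: bij_betw_def)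
    then obtain v where "v \<in> gm" "p1 x = p1 (f v)" by auto
    then show "x \<in> (\<lambda>(a, b). a + b) ` (f ` gm \<times> {x. p1 x = 0})"
      by (intro image_eqI[of _ _ "(f v, x - f v)"]) auto
  qed auto
qed

text \<open>Transport by \<open>a\<^sup>-\<^sup>1\<close> turns transversality of \<open>a.o\<^sup>+\<close> and \<open>p(a.o\<^sup>+)\<close> into the invertibility of a block
  of \<open>a\<^sup>-\<^sup>1 \<theta> a\<close>, that is, into the condition that \<open>\<theta> a\<^sup>-\<^sup>1 \<theta> a.o\<^sup>+\<close> lies in \<open>V\<close>.\<close>

definition tw :: "('g \<Rightarrow> 'g) \<Rightarrow> 'g \<Rightarrow> 'g" where "tw a = \<theta> \<circ> inv a \<circ> \<theta> \<circ> a"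

lemma tw_GG: "a \<in> GG L \<Longrightarrow> tw a \<in> GG L"
  using GG.mult[OF theta_GG[OF GG.inverse]] by (simp add: tw_def)

lemma non_isotropic_iff:
  assumes a: "a \<in> GG L"
  shows "act a base \<in> non_isotropic L \<longleftrightarrow> (\<exists>z\<in>g1. act (tw a) base = embed_V L z)"
proof -
  note A = GG_aut[OF a] and T = theta_aut
  let ?f = "inv a \<circ> \<theta> \<circ> a"
  have f: "aut ?f" using A T by (intro aut_comp aut_inv)
  have "direct_sum (fst (act a base)) (snd (act \<theta> (act a base))) \<longleftrightarrow>
      direct_sum (\<theta> ` a ` gm) (a ` {x. p1 x = 0})"
    using direct_sum_image[OF T, of "a ` gm" "\<theta> ` a ` {x. p1 x = 0}"] by (simp add: act_def base_eq image_image)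
  then have "transversal (act a base) (polarity L (act a base)) \<longleftrightarrow> direct_sum (\<theta> ` a ` gm) (a ` {x. p1 x = 0})"
    by (simp add: transversal_def polarity_def act_def base_eq)
  also have "\<dots> \<longleftrightarrow> direct_sum (?f ` gm) {x. p1 x = 0}"
    using direct_sum_image[OF aut_inv[OF A], of "\<theta> ` a ` gm" "a ` {x. p1 x = 0}"]
    by (simp add: image_image autD[OF A])
  also have "\<dots> \<longleftrightarrow> bij_betw (\<lambda>v. p1 (?f v)) gm g1" by (rule direct_sum_block[OF f])
  finally have t: "act a base \<in> non_isotropic L \<longleftrightarrow> bij_betw (\<lambda>v. p1 (?f v)) gm g1"
    using a by (auto simp: non_isotropic_def X_plus_iff)
  have i: "inv (tw a) = ?f \<circ> \<theta>"
    by (rule inv_equality) (auto simp: tw_def autD[OF A])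
  have 1: "bij_betw (\<lambda>v. p1 (inv (tw a) v)) g1 g1 \<longleftrightarrow> bij_betw (\<lambda>v. p1 (?f v)) gm g1"
  proof
    assume "bij_betw (\<lambda>v. p1 (inv (tw a) v)) g1 g1"
    from bij_betw_trans[OF theta_bij(2) this] show "bij_betw (\<lambda>v. p1 (?f v)) gm g1" by (simp add: i comp_def)
  next
    assume "bij_betw (\<lambda>v. p1 (?f v)) gm g1"
    from bij_betw_trans[OF theta_bij(1) this] show "bij_betw (\<lambda>v. p1 (inv (tw a) v)) g1 g1" by (simp add: i comp_def)
  qed
  have 2: "bij_betw (\<lambda>v. pm (tw a v)) gm gm" if "bij_betw (\<lambda>v. p1 (?f v)) gm g1"
    using bij_betw_trans[OF that theta_bij(1)] by (simp add: comp_def tw_def theta_p)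
  show ?thesis unfolding t using 1 2 chart_criterion[OF tw_GG[OF a]] chart_value(5,6)[OF tw_GG[OF a]] by metis
qed

text \<open>If \<open>\<theta> a\<^sup>-\<^sup>1 \<theta> a.o\<^sup>+ = e\<^sup>z.o\<^sup>+\<close>, applying \<open>a \<theta>\<close> gives \<open>p(a.o\<^sup>+) = a e\<^sup>\<theta>\<^sup>z.o\<^sup>-\<close>, while \<open>e\<^sup>\<theta>\<^sup>z\<close> fixes \<open>o\<^sup>+\<close>.\<close>

lemma tw_frame:
  assumes a: "a \<in> GG L" and z: "z \<in> g1" and e: "act (tw a) base = embed_V L z"
  shows "frame (act a base) (a \<circ> ex (\<theta> z))"
proof -
  have m: "\<theta> z \<in> gm" using z by (simp add: theta_in)
  have 1: "a \<circ> \<theta> \<circ> tw a = \<theta> \<circ> a" by (auto simp: tw_def autD[OF GG_aut[OF a]])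
  have 2: "\<theta> \<circ> ex z = ex (\<theta> z) \<circ> \<theta>" by (auto simp: theta_ex)
  have "act (\<theta> \<circ> a) base = act a (act \<theta> (act (tw a) base))" by (simp only: 1[symmetric] act_comp)
  also have "\<dots> = act a (act (\<theta> \<circ> ex z) base)" by (simp add: e embed_V_def act_comp)
  also have "\<dots> = act (a \<circ> ex (\<theta> z)) (act \<theta> base)" by (simp add: 2 act_comp)
  finally show ?thesis using a m by (simp add: frame_def GG.mult GG_ex act_comp ex_minus_base)
qed

lemma non_isotropic_frame: assumes "x \<in> non_isotropic L" obtains g where "frame x g"
proof -
  obtain a where a: "a \<in> GG L" "x = act a base" using assms by (auto simp: non_isotropic_def X_plus_iff)
  then obtain z where "z \<in> g1" "act (tw a) base = embed_V L z" using assms non_isotropic_iff by auto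
  then show ?thesis using tw_frame[OF a(1)] a that by metis
qed

lemma base_non_isotropic: "base \<in> non_isotropic L"
proof -
  have "tw id = id" by (auto simp: tw_def)
  then have "act (tw id) base = embed_V L 0" by (simp add: embed_V_def)
  then show ?thesis using non_isotropic_iff[OF GG.one] by (metis act_id gr_closed(1))
qed

text \<open>A symmetry commutes with \<open>\<theta>\<close>, so it carries frames to frames.  The factor \<open>\<delta>\<close> on the right fixes \<open>o\<^sup>+\<close> and \<open>o\<^sup>-\<close>; it
  keeps the product in \<open>G\<close>, which \<open>\<delta>\<close> normalizes.\<close>

lemma M_frame_move:
  assumes x: "frame x g" and y: "frame y h"
  shows "frame (act (sy g) y) (sy g \<circ> h \<circ> \<delta>)"
proof -
  have G: "g \<in> GG L" "h \<in> GG L" using x y by (auto simp: frame_def)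
  have "sy g \<circ> h \<circ> \<delta> = g \<circ> (\<delta> \<circ> (inv g \<circ> h) \<circ> \<delta>)" by (auto simp: sy_def)
  moreover have "\<dots> \<in> GG L" using G by (intro GG.intros delta_GG)
  ultimately have g: "sy g \<circ> h \<circ> \<delta> \<in> GG L" by simp
  have d: "act \<delta> base = base" by (rule degree_zero_base[OF delta_degree_zero])
  have "\<delta> \<circ> \<theta> = \<theta> \<circ> \<delta>" "sy g \<circ> \<theta> = \<theta> \<circ> sy g" using sy_theta[OF x] by (auto simp: delta_theta)
  then have "act \<delta> (act \<theta> base) = act \<theta> base" and s: "act (sy g) (act \<theta> y) = act \<theta> (act (sy g) y)"
    by (metis act_comp d, metis act_comp)
  then show ?thesis using g y by (simp add: frame_def act_comp d)
qed

text \<open>In terms of a frame \<open>g\<close>, the element \<open>\<theta> g\<^sup>-\<^sup>1 \<theta> g\<close> fixes \<open>o\<^sup>+\<close>, so the criterion holds with coordinate 0.\<close>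

lemma frame_non_isotropic:
  assumes "frame x g" shows "x \<in> non_isotropic L"
proof -
  have g: "g \<in> GG L" "act g base = x" "act g (act \<theta> base) = act \<theta> x" using assms by (auto simp: frame_def)
  have "act (tw g) base = act \<theta> (act (inv g) (act \<theta> x))" by (simp add: tw_def act_comp g)
  also have "act (inv g) (act \<theta> x) = act \<theta> base" using act_inv[OF GG_aut[OF g(1)]] g(3) by metis
  also have "act \<theta> (act \<theta> base) = embed_V L 0" by (simp add: embed_V_def act_comp[symmetric] theta_comp)
  finally show ?thesis using non_isotropic_iff[OF g(1)] g(2) by (metis gr_closed(1))
qed

subsection \<open>The axioms of a symmetric space on points\<close>

lemma M_mult_closed:
  assumes "x \<in> non_isotropic L" "y \<in> non_isotropic L"
  shows "M_mult L x y \<in> non_isotropic L"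
proof -
  obtain g h where g: "frame x g" and h: "frame y h" using assms non_isotropic_frame by metis
  show ?thesis using frame_non_isotropic[OF M_frame_move[OF g h]] M_mult_frame[OF g] by simp
qed

lemma M_mult_idem: assumes "x \<in> non_isotropic L" shows "M_mult L x x = x"
proof -
  obtain g where g: "frame x g" using assms non_isotropic_frame by metis
  then have G: "aut g" "act g base = x" by (auto simp: frame_def GG_aut)
  have "act (inv g) x = base" using G act_inv by metis
  then show ?thesis 
    by (simp add: M_mult_frame[OF g] sy_def act_comp degree_zero_base[OF delta_degree_zero] G)
qed

lemma M_mult_invol:
  assumes "x \<in> non_isotropic L" shows "M_mult L x (M_mult L x y) = y"
proof -
  obtain g where g: "frame x g" using assms non_isotropic_frame by metis
  have "sy g \<circ> sy g = id" using g by (auto simp: sy_sy frame_def GG_aut)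
  then show ?thesis by (metis M_mult_frame[OF g] act_comp act_id)
qed

lemma M_mult_distrib:
  assumes x: "x \<in> non_isotropic L" and y: "y \<in> non_isotropic L"
  shows "M_mult L x (M_mult L y z) = M_mult L (M_mult L x y) (M_mult L x z)"
proof -
  obtain g h where g: "frame x g" and h: "frame y h" using x y non_isotropic_frame by metis
  have G: "aut g" "aut h" using g h by (auto simp: frame_def GG_aut)
  have i: "inv (sy g \<circ> h \<circ> \<delta>) = \<delta> \<circ> inv h \<circ> sy g"
    by (rule inv_equality) (auto simp: autD[OF G(2)] sy_sy[OF G(1)])
  have "sy (sy g \<circ> h \<circ> \<delta>) \<circ> sy g = sy g \<circ> sy h"
    unfolding sy_def[of "sy g \<circ> h \<circ> \<delta>"] i by (auto simp: sy_def[of h] sy_sy[OF G(1)])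
  then show ?thesis
    using M_mult_frame[OF g] M_mult_frame[OF h] M_mult_frame[OF M_frame_move[OF g h]] by (metis act_comp)
qed

subsection \<open>Difference quotients of products of exponentials\<close>

text \<open>In an entry \<open>(a, a', d)\<close>, the letter \<open>a\<close> is replaced by \<open>a' = a + td\<close>.\<close>

primrec Dq :: "('g \<times> 'g \<times> 'g) list \<Rightarrow> 'g \<Rightarrow> 'g" where
  "Dq [] y = 0"
| "Dq (q # l) y = (case q of (a, a', d) \<Rightarrow>
     d \<star> W (map (\<lambda>q. fst (snd q)) l) y
     + half \<cdot> (d \<star> a' \<star> W (map (\<lambda>q. fst (snd q)) l) y + a \<star> d \<star> W (map (\<lambda>q. fst (snd q)) l) y)
     + ex a (Dq l y))"

lemma Dq_quotient:
  "\<forall>q \<in> set l. fst (snd q) = fst q + t \<cdot> snd (snd q) \<Longrightarrow>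
    W (map (\<lambda>q. fst (snd q)) l) y - W (map fst l) y = t \<cdot> Dq l y"
proof (induction l)
  case (Cons q l)
  obtain a a' d where q [simp]: "q = (a, a', d)" by (cases q)
  have a': "a' = a + t \<cdot> d" using Cons.prems by simp
  let ?y = "W (map (\<lambda>q. fst (snd q)) l) y" and ?z = "W (map fst l) y"
  have IH: "?y - ?z = t \<cdot> Dq l y" by (rule Cons.IH) (use Cons.prems in simp)
  have "ex a' ?y - ex a ?y = t \<cdot> (d \<star> ?y + half \<cdot> (d \<star> a' \<star> ?y + a \<star> d \<star> ?y))"
    by (simp add: exp_ad_def a' lin algebra_simps)
  moreover have "ex a ?y - ex a ?z = t \<cdot> ex a (Dq l y)"
    using IH ex_lin(2)[of a ?y ?z] by (simp add: ex_lin)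
  ultimately have "ex a' ?y - ex a ?z = t \<cdot> Dq (q # l) y" by (simp add: scale_right_distrib algebra_simps)
  then show ?case by simp
qed simp

text \<open>The logarithmic derivative of a product of exponentials.\<close>

primrec lam :: "('g \<times> 'g) list \<Rightarrow> 'g" where
  "lam [] = 0"
| "lam (q # l) = snd q + ex (fst q) (lam l)"

lemma lam_const: "lam (map (\<lambda>a. (a, 0)) l @ m) = W l (lam m)"
  by (induction l) auto

lemma Dq_lam:
  "\<forall>q \<in> set l. fst q \<in> g1 \<and> snd q \<in> g1 \<or> fst q \<in> gm \<and> snd q \<in> gm \<Longrightarrow>
    Dq (map (\<lambda>q. (fst q, fst q, snd q)) l) y = lam l \<star> W (map fst l) y"
proof (induction l)
  case (Cons q l)
  obtain a d where q [simp]: "q = (a, d)" by (cases q)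
  have s: "a \<in> g1 \<and> d \<in> g1 \<or> a \<in> gm \<and> d \<in> gm" using Cons.prems by auto
  let ?y = "W (map fst l) y"
  have "ex a (lam l \<star> ?y) = ex a (lam l) \<star> ex a ?y"
    using s by (intro autD(4) exp_aut) auto
  moreover have "d \<star> ex a ?y = d \<star> ?y + half \<cdot> (d \<star> a \<star> ?y + a \<star> d \<star> ?y)"
  proof -
    have "d \<star> a \<star> a \<star> ?y = 0" "a \<star> d \<star> ?y = d \<star> a \<star> ?y"
      using s by (auto intro: nilpotent br_commute)
    then show ?thesis by (simp add: exp_ad_def lin half_add)
  qed
  ultimately show ?case using Cons by (simp add: comp_def br_add_left)
qed simp

text \<open>The term inside \<open>Dq\<close> is \<open>F\<^sup>-\<^sup>1 e\<^sup>z E\<close>, for the word \<open>F\<close> of the old letters.\<close>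

definition quot :: "('g \<times> 'g \<times> 'g) list \<Rightarrow> 'g \<Rightarrow> 'g \<Rightarrow> 'g" where
  "quot l z z' = - p1 (ex (- z') (Dq l (W (rev (map (\<lambda>q. - fst q) l)) (ex z euler))))"

text \<open>The element \<open>Y = F\<^sup>-\<^sup>1 e\<^sup>z E\<close> lies in the filtration of \<open>o\<^sup>+\<close>, since \<open>e\<^sup>-\<^sup>z F\<close> fixes \<open>o\<^sup>+\<close>.  So does \<open>e\<^sup>-\<^sup>z\<^sup>' F' Y\<close> for the word
  \<open>F'\<close> of the new letters.  Writing \<open>F' Y = e\<^sup>z E + (F' - F) Y\<close>, the first summand contributes \<open>z' - z\<close> in degree 1 and the second
  has the factor \<open>t\<close>; no operator is inverted, and \<open>t\<close> need not be invertible.\<close>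

lemma quot:
  assumes w: "word (map fst l)" "word (map (\<lambda>q. fst (snd q)) l)"
    and t: "\<forall>q \<in> set l. fst (snd q) = fst q + t \<cdot> snd (snd q)"
    and z: "z \<in> g1" "act (W (map fst l)) base = embed_V L z"
    and z': "z' \<in> g1" "act (W (map (\<lambda>q. fst (snd q)) l)) base = embed_V L z'"
  shows "z' = z + t \<cdot> quot l z z'"
proof -
  let ?F = "W (map fst l)" and ?F' = "W (map (\<lambda>q. fst (snd q)) l)"
  have G: "?F \<in> GG L" "?F' \<in> GG L" using w by (simp_all only: W_GG)
  have A: "aut ?F" "aut ?F'" using G by (simp_all only: GG_aut)
  let ?f = "ex (- z) \<circ> ?F" and ?f' = "ex (- z') \<circ> ?F'"
  have s: "act ?f base = base" "act ?f' base = base"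
    using chart_value(2)[OF G(1) z] chart_value(2)[OF G(2) z'] .
  have mz: "- z \<in> g1" "- z' \<in> g1" "z - z' \<in> g1" using z z' by (simp_all add: gr_closed)
  have a: "aut ?f" "aut ?f'" using A mz by (auto intro!: aut_comp exp_aut)
  define Y where "Y = W (rev (map (\<lambda>q. - fst q) l)) (ex z euler)"
  have iF: "inv ?F = W (rev (map (\<lambda>q. - fst q) l))" using W_inv[OF w(1)] by (simp add: comp_def)
  then have FY: "?F Y = ex z euler"
    using autD(10)[OF A(1)] unfolding Y_def by metis
  have "inv ?f = inv ?F \<circ> ex z"
    by (rule inv_equality) (use z in \<open>auto simp: autD[OF A(1)] ex_cancel\<close>)
  then have "Y = inv ?f euler" by (simp add: Y_def iF)
  then have "p1 Y = 0" using stab(3)[OF aut_inv[OF a(1)] stab(4)[OF a(1) s(1)] p_euler(1)] by simp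
  then have "p1 (ex (- z') (?F' Y)) = 0" using stab(3)[OF a(2) s(2), of Y] by simp
  moreover have "?F' Y = ex z euler + t \<cdot> Dq l Y" using Dq_quotient[OF t, of Y] FY by (simp add: algebra_simps)
  moreover have "p1 (ex (- z') (ex z euler)) = z' - z"
    using z z' mz by (simp add: ex_euler ex_lin ex_same p_gr)
  ultimately show ?thesis by (simp add: quot_def Y_def[symmetric] ex_lin algebra_simps)
qed

text \<open>For coinciding words, \<open>Dq\<close> is the bracket with the logarithmic derivative, and \<open>F F\<^sup>-\<^sup>1\<close> cancels.\<close>

lemma quot_lam:
  assumes l: "\<forall>q \<in> set l. fst q \<in> g1 \<and> snd q \<in> g1 \<or> fst q \<in> gm \<and> snd q \<in> gm" 
    and z: "z \<in> g1" "act (W (map fst l)) base = embed_V L z"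
  shows "quot (map (\<lambda>q. (fst q, fst q, snd q)) l) z z = p1 (ex (- z) (lam l))"
proof -
  have w: "word (map fst l)" using l by auto
  have "W (map fst l) (W (rev (map (\<lambda>q. - fst q) l)) (ex z euler)) = ex z euler"
    using W_inv[OF w] autD(10)[of "W (map fst l)"] by (simp add: comp_def)
  then have "quot (map (\<lambda>q. (fst q, fst q, snd q)) l) z z = - p1 (ex (- z) (lam l \<star> ex z euler))"
    using Dq_lam[OF l] by (simp add: quot_def comp_def)
  also have "ex (- z) (lam l \<star> ex z euler) = ex (- z) (lam l) \<star> euler"
    using z(1) autD(4)[of "ex (- z)"] by (simp add: exp_aut gr_closed ex_cancel)
  also have "- p1 (ex (- z) (lam l) \<star> euler) = p1 (ex (- z) (lam l))"
    using br_anti[of _ euler] by (simp add: euler_p)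
  finally show ?thesis .
qed

end

section \<open>Limits\<close>

lemma limitin_compose2:
  assumes "continuous_map (prod_topology X Y) Z h" "limitin X f a F" "limitin Y g b F"
  shows "limitin Z (\<lambda>i. h (f i, g i)) (h (a, b)) F"
proof -
  have "limitin (prod_topology X Y) (\<lambda>i. (f i, g i)) (a, b) F"
    using assms by (simp add: limitin_pairwise comp_def)
  from continuous_map_limit[OF assms(1) this] show ?thesis by (simp add: comp_def)
qed

lemma module_limits:
  assumes "topological_module E"
  shows limitin_add: "limitin (mod_top E) f a F \<Longrightarrow> limitin (mod_top E) g b F \<Longrightarrow>
      limitin (mod_top E) (\<lambda>i. f i + g i) (a + b) F"
    and limitin_scale: "(c \<longlongrightarrow> t) F \<Longrightarrow> limitin (mod_top E) f a F \<Longrightarrow>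
      limitin (mod_top E) (\<lambda>i. scal E (c i) (f i)) (scal E t a) F"
  using limitin_compose2[of "mod_top E" "mod_top E" "mod_top E" "\<lambda>(x, y). x + y" f a F g b]
    limitin_compose2[of euclidean "mod_top E" "mod_top E" "\<lambda>(t, x). scal E t x" c t F f a] assms
  by (auto simp: topological_module_def)

locale C1_setting = graded_setting L for L :: "('k::topological_comm_ring_1, 'g::ab_group_add) jts" +
  assumes C1: "C1_jordan_triple_system L"
begin

abbreviation Vt :: "'g topology" where "Vt \<equiv> V_top L"

lemma topspace_V [simp]: "topspace Vt = g1" and V_mod: "topological_module (V_module L)"
  and V_sel [simp]: "scal (V_module L) = smul L" "mod_top (V_module L) = Vt"
  using C1 by (simp_all add: C1_jordan_triple_system_def V_module_def)

abbreviation vlim :: "('i \<Rightarrow> 'g) \<Rightarrow> 'g \<Rightarrow> 'i filter \<Rightarrow> bool" where "vlim \<equiv> limitin Vt"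

lemma lim_add: "vlim f a F \<Longrightarrow> vlim h b F \<Longrightarrow> vlim (\<lambda>i. f i + h i) (a + b) F"
  and lim_scale: "(c \<longlongrightarrow> t) F \<Longrightarrow> vlim f a F \<Longrightarrow> vlim (\<lambda>i. c i \<cdot> f i) (t \<cdot> a) F"
  using module_limits[OF V_mod] by simp_all

lemma lim_minus: "vlim f a F \<Longrightarrow> vlim (\<lambda>i. - f i) (- a) F"
  using lim_scale[of "\<lambda>_. -1" "-1" F f a] by simp

lemma lim_diff: "vlim f a F \<Longrightarrow> vlim h b F \<Longrightarrow> vlim (\<lambda>i. f i - h i) (a - b) F"
  using lim_add[of f a F "\<lambda>i. - h i" "- b"] lim_minus[of h b F] by simp

lemma lim_const: "a \<in> g1 \<Longrightarrow> vlim (\<lambda>i. a) a F" by simp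

lemma lim_in: assumes "vlim f a F" shows "a \<in> g1" "\<forall>\<^sub>F i in F. f i \<in> g1"
proof -
  show a: "a \<in> g1" using limitin_topspace[OF assms] by simp
  have "openin Vt g1" by (metis openin_topspace topspace_V)
  then show "\<forall>\<^sub>F i in F. f i \<in> g1" using limitinD[OF assms] a by simp
qed

lemma lim_triple:
  assumes "vlim f a F" "vlim h b F" "vlim k c F"
  shows "vlim (\<lambda>i. (f i \<star> \<theta> (h i)) \<star> k i) ((a \<star> \<theta> b) \<star> c) F"
proof -
  have "limitin (prod_topology Vt Vt) (\<lambda>i. (h i, k i)) (b, c) F" using assms by (simp add: limitin_pairwise comp_def)
  from limitin_compose2[OF _ assms(1) this, of Vt "\<lambda>(x, y, z). triple L x y z"] show ?thesis
    using C1 by (simp add: C1_jordan_triple_system_def triple_def)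
qed

lemma lim_cong: "\<forall>\<^sub>F i in F. f i = h i \<Longrightarrow> a = b \<Longrightarrow> vlim f a F \<Longrightarrow> vlim h b F"
  using limitin_transform_eventually[of f h F Vt a] by simp

text \<open>Only \<open>V\<close> carries a topology.  Convergence in \<open>\<gg>\<close> is convergence of the components of
  degree 1 and -1 together with convergence of the degree 0 components as operators on \<open>V\<close> and on
  \<open>V\<^sup>-\<close>, in the continuous sense: along all convergent families of arguments.  This notion is
  compatible with the bracket.\<close>

definition hlim :: "('i \<Rightarrow> 'g) \<Rightarrow> 'g \<Rightarrow> 'i filter \<Rightarrow> bool" where
  "hlim f l F \<longleftrightarrow> vlim (\<lambda>i. p1 (f i)) (p1 l) F \<and>
     (\<forall>v v0. vlim v v0 F \<longrightarrow> vlim (\<lambda>i. p0 (f i) \<star> v i) (p0 l \<star> v0) F)"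

definition glim :: "('i \<Rightarrow> 'g) \<Rightarrow> 'g \<Rightarrow> 'i filter \<Rightarrow> bool" where
  "glim f l F \<longleftrightarrow> hlim f l F \<and> hlim (\<lambda>i. \<theta> (f i)) (\<theta> l) F"

lemma hlim_cong: assumes e: "\<forall>\<^sub>F i in F. f i = h i" and f: "hlim f l F" shows "hlim h l F"
  unfolding hlim_def
proof (intro conjI allI impI)
  show "vlim (\<lambda>i. p1 (h i)) (p1 l) F"
  proof (rule lim_cong[OF _ refl])
    show "vlim (\<lambda>i. p1 (f i)) (p1 l) F" using f by (simp add: hlim_def)
    show "\<forall>\<^sub>F i in F. p1 (f i) = p1 (h i)" using e by eventually_elim simp
  qed
  fix v v0 assume v: "vlim v v0 F"
  show "vlim (\<lambda>i. p0 (h i) \<star> v i) (p0 l \<star> v0) F"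
  proof (rule lim_cong[OF _ refl])
    show "vlim (\<lambda>i. p0 (f i) \<star> v i) (p0 l \<star> v0) F" using f v by (simp add: hlim_def)
    show "\<forall>\<^sub>F i in F. p0 (f i) \<star> v i = p0 (h i) \<star> v i" using e by eventually_elim simp
  qed
qed

lemma glim_cong: assumes e: "\<forall>\<^sub>F i in F. f i = h i" and f: "glim f l F" shows "glim h l F"
  unfolding glim_def
proof
  show "hlim h l F" using hlim_cong[OF e] f by (simp add: glim_def)
  have "\<forall>\<^sub>F i in F. \<theta> (f i) = \<theta> (h i)" using e by eventually_elim simp
  then show "hlim (\<lambda>i. \<theta> (h i)) (\<theta> l) F" by (rule hlim_cong) (use f in \<open>simp add: glim_def\<close>)
qed

lemma hlim_arith:
  assumes "hlim f a F" "hlim h b F"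
  shows "hlim (\<lambda>i. f i + h i) (a + b) F" "hlim (\<lambda>i. f i - h i) (a - b) F"
  using assms unfolding hlim_def by (auto simp: br_add_left br_diff intro!: lim_add lim_diff)

lemma hlim_scale: "(c \<longlongrightarrow> t) F \<Longrightarrow> hlim f a F \<Longrightarrow> hlim (\<lambda>i. c i \<cdot> f i) (t \<cdot> a) F"
  unfolding hlim_def by (auto simp: br_scale_left intro!: lim_scale)

lemma glim_add: "glim f a F \<Longrightarrow> glim h b F \<Longrightarrow> glim (\<lambda>i. f i + h i) (a + b) F"
  and glim_diff: "glim f a F \<Longrightarrow> glim h b F \<Longrightarrow> glim (\<lambda>i. f i - h i) (a - b) F"
  and glim_scale: "(c \<longlongrightarrow> t) F \<Longrightarrow> glim f a F \<Longrightarrow> glim (\<lambda>i. c i \<cdot> f i) (t \<cdot> a) F"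
  by (simp_all add: glim_def hlim_arith hlim_scale)

lemma glim_minus: "glim f a F \<Longrightarrow> glim (\<lambda>i. - f i) (- a) F"
  using glim_scale[of "\<lambda>_. -1" "-1" F f a] by simp

lemma glim_theta: "glim f a F \<Longrightarrow> glim (\<lambda>i. \<theta> (f i)) (\<theta> a) F"
  by (simp add: glim_def)

text \<open>Operators of degree 0 that are brackets of degrees 1 and -1 act on \<open>V\<close> through the triple product, which is continuous;
  those that are brackets of degree 0 act as commutators.\<close>

lemma hlim_br:
  assumes f: "glim f a F" and h: "glim h b F"
  shows "hlim (\<lambda>i. f i \<star> h i) (a \<star> b) F"
proof -
  have f1: "vlim (\<lambda>i. p1 (f i)) (p1 a) F" and f2: "vlim (\<lambda>i. p1 (\<theta> (f i))) (p1 (\<theta> a)) F"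
    and h1: "vlim (\<lambda>i. p1 (h i)) (p1 b) F" and h2: "vlim (\<lambda>i. p1 (\<theta> (h i))) (p1 (\<theta> b)) F"
    and f0: "\<And>v v0. vlim v v0 F \<Longrightarrow> vlim (\<lambda>i. p0 (f i) \<star> v i) (p0 a \<star> v0) F"
    and h0: "\<And>v v0. vlim v v0 F \<Longrightarrow> vlim (\<lambda>i. p0 (h i) \<star> v i) (p0 b \<star> v0) F"
    using f h by (auto simp: glim_def hlim_def)
  have e1: "p1 (x \<star> y) = p0 x \<star> p1 y - p0 y \<star> p1 x" for x y
    using br_anti[of "p1 x" "p0 y"] by (simp add: p_br)
  have e0: "p0 (x \<star> y) \<star> v = (p1 x \<star> \<theta> (p1 (\<theta> y))) \<star> v - (p1 y \<star> \<theta> (p1 (\<theta> x))) \<star> v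
      + (p0 x \<star> p0 y \<star> v - p0 y \<star> p0 x \<star> v)" for x y v
    using jacobi[of "p0 x" "p0 y" v] br_anti[of "p1 y" "pm x"] by (simp add: p_br theta_p lin)
  show ?thesis unfolding hlim_def e1 e0
    by (intro conjI allI impI lim_add lim_diff lim_triple f0 h0 f1 h1 f2 h2)
qed

lemma glim_br: "glim f a F \<Longrightarrow> glim h b F \<Longrightarrow> glim (\<lambda>i. f i \<star> h i) (a \<star> b) F"
  using hlim_br[of f a F h b] hlim_br[of "\<lambda>i. \<theta> (f i)" "\<theta> a" F "\<lambda>i. \<theta> (h i)" "\<theta> b"]
  by (simp add: glim_def)

lemma glim_ex: "glim f a F \<Longrightarrow> glim h b F \<Longrightarrow> glim (\<lambda>i. ex (f i) (h i)) (ex a b) F"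
  unfolding exp_ad_def by (intro glim_add glim_scale glim_br tendsto_const)

lemma lim_p1: "glim f a F \<Longrightarrow> vlim (\<lambda>i. p1 (f i)) (p1 a) F"
  by (simp add: glim_def hlim_def)

lemma glim_V: assumes v: "vlim v a F" shows "glim v a F"
proof -
  have a: "a \<in> g1" and m: "\<forall>\<^sub>F i in F. v i \<in> g1" using lim_in[OF v] .
  have z: "vlim u 0 F" if "\<forall>\<^sub>F i in F. u i = 0" for u
    by (rule limitin_eventually[OF _ that]) simp
  have 1: "vlim (\<lambda>i. p1 (v i)) (p1 a) F"
  proof (rule lim_cong[OF _ _ v])
    show "\<forall>\<^sub>F i in F. v i = p1 (v i)" using m by eventually_elim (simp add: p_gr)
  qed (use a in \<open>simp add: p_gr\<close>)
  have 2: "vlim (\<lambda>i. p0 (v i) \<star> w i) 0 F" "vlim (\<lambda>i. p0 (\<theta> (v i)) \<star> w i) 0 F" for w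
    using m by (intro z; eventually_elim; simp add: theta_p p_gr)+
  have 3: "vlim (\<lambda>i. p1 (\<theta> (v i))) 0 F"
    using m by (intro z; eventually_elim; simp add: theta_p p_gr)
  show ?thesis using a 1 2 3 by (simp add: glim_def hlim_def theta_p p_gr)
qed

lemma glim_p1: "glim f a F \<Longrightarrow> glim (\<lambda>i. p1 (f i)) (p1 a) F"
  by (rule glim_V[OF lim_p1])

lemma glim_pm: "glim f a F \<Longrightarrow> glim (\<lambda>i. pm (f i)) (pm a) F"
  using glim_theta[OF glim_p1[OF glim_theta[of f a F]]] by (simp add: theta_p)

lemma lim_of_glim: 
  assumes v: "glim v a F" and m: "\<forall>\<^sub>F i in F. v i \<in> g1" and a: "a \<in> g1" shows "vlim v a F"
proof (rule lim_cong[OF _ _ lim_p1[OF v]])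
  show "\<forall>\<^sub>F i in F. p1 (v i) = v i" using m by eventually_elim (simp add: p_gr)
qed (use a in \<open>simp add: p_gr\<close>)

text \<open>An arbitrary element of degree 0 need not act continuously on \<open>V\<close>.  Filters on \<open>\<gg>\<close> suffice to test continuity: a
  family of arguments pushes its filter forward to \<open>\<gg>\<close>.\<close>

definition celem :: "'g \<Rightarrow> bool" where "celem x \<longleftrightarrow> (\<forall>F :: 'g filter. glim (\<lambda>i. x) x F)"

lemma glim_const: assumes "celem x" shows "glim (\<lambda>i. x) x F"
proof -
  have "vlim (\<lambda>i. p0 y \<star> v i) (p0 y \<star> v0) F" if y: "\<And>F :: 'g filter. hlim (\<lambda>i. y) y F" and v: "vlim v v0 F" for y v v0
  proof -
    have "vlim (\<lambda>u. u) v0 (filtermap v F)" using v by (simp add: limitin_def eventually_filtermap)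
    then have "vlim (\<lambda>u. p0 y \<star> u) (p0 y \<star> v0) (filtermap v F)" using y by (simp add: hlim_def)
    then show ?thesis by (simp add: limitin_def eventually_filtermap)
  qed
  then show ?thesis using assms by (simp add: celem_def glim_def hlim_def)
qed

lemma glim_zero: "glim (\<lambda>i. 0) 0 F" by (rule glim_V) simp

lemma celem_gr: "x \<in> g1 \<Longrightarrow> celem x" "x \<in> gm \<Longrightarrow> celem x"
  using glim_theta[OF glim_V[OF lim_const[of "\<theta> x"]]] by (auto simp: celem_def theta_in intro: glim_V)

lemma celem_euler: "celem euler"
proof -
  have t: "\<theta> euler \<star> v = - v" if "v \<in> g1" for v
  proof -
    have "\<theta> euler \<star> v = \<theta> (euler \<star> \<theta> v)" by simp
    then show ?thesis using that by (simp only: euler_simps theta_in) simp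
  qed
  have "glim (\<lambda>i. euler) euler F" for F :: "'g filter"
  proof -
    have "vlim (\<lambda>i. euler \<star> v i) (euler \<star> v0) F \<and> vlim (\<lambda>i. \<theta> euler \<star> v i) (\<theta> euler \<star> v0) F"
      if v: "vlim v v0 F" for v v0
    proof
      note m = lim_in[OF v]
      show "vlim (\<lambda>i. euler \<star> v i) (euler \<star> v0) F"
      proof (rule lim_cong[OF _ _ v])
        show "\<forall>\<^sub>F i in F. v i = euler \<star> v i" using m(2) by eventually_elim (simp add: euler_simps)
      qed (use m in \<open>simp add: euler_simps\<close>)
      show "vlim (\<lambda>i. \<theta> euler \<star> v i) (\<theta> euler \<star> v0) F"
      proof (rule lim_cong[OF _ _ lim_minus[OF v]])
        show "\<forall>\<^sub>F i in F. - v i = \<theta> euler \<star> v i" using m(2) by eventually_elim (simp add: t)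
      qed (use m in \<open>simp add: t\<close>)
    qed
    then show ?thesis by (simp add: glim_def hlim_def theta_p)
  qed
  then show ?thesis by (simp add: celem_def)
qed

lemma celem_br: "celem x \<Longrightarrow> celem y \<Longrightarrow> celem (x \<star> y)"
  and celem_add: "celem x \<Longrightarrow> celem y \<Longrightarrow> celem (x + y)"
  and celem_minus: "celem x \<Longrightarrow> celem (- x)"
  by (auto simp: celem_def intro: glim_br glim_add glim_minus)

lemma glim_W:
  "\<forall>q \<in> set l. glim (fst q) (snd q) F \<Longrightarrow> glim f a F \<Longrightarrow> 
    glim (\<lambda>i. W (map (\<lambda>q. fst q i) l) (f i)) (W (map snd l) a) F"
  by (induction l) (auto intro: glim_ex)

lemma glim_GG: assumes "g \<in> GG L" "glim f a F" shows "glim (\<lambda>i. g (f i)) (g a) F"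
proof -
  obtain l where l: "word l" "g = W l" using GG_W assms(1) by metis
  have "\<forall>q \<in> set (map (\<lambda>a. (\<lambda>_. a, a)) l). glim (fst q) (snd q) F"
    using l by (auto intro!: glim_const intro: celem_gr)
  note glim_W[OF this assms(2)]
  then show ?thesis by (simp add: l comp_def)
qed

lemma celem_GG: "g \<in> GG L \<Longrightarrow> celem x \<Longrightarrow> celem (g x)"
  using glim_GG[of g "\<lambda>_. x" x] by (auto simp: celem_def)

lemma qi_zero: "w \<in> gm \<Longrightarrow> (0, - \<theta> w) \<in> quasi_invertible L \<and> qi 0 w = 0"
  "z \<in> g1 \<Longrightarrow> (z, - \<theta> 0) \<in> quasi_invertible L \<and> qi z 0 = z"
proof -
  assume w: "w \<in> gm"
  have e: "act (ex w \<circ> ex 0) base = embed_V L 0" using ex_minus_base[OF w] by (simp add: embed_V_def)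
  then have q: "(0, - \<theta> w) \<in> quasi_invertible L" using quasi_iff(1)[of 0 w] w by auto
  then show "(0, - \<theta> w) \<in> quasi_invertible L \<and> qi 0 w = 0"
    using quasi_iff(2)[of 0 w] w e embed_inj[of 0 "qi 0 w"] by auto
next
  assume z: "z \<in> g1"
  have e: "act (ex 0 \<circ> ex z) base = embed_V L z" by (simp add: embed_V_def)
  then have q: "(z, - \<theta> 0) \<in> quasi_invertible L" using quasi_iff(1)[of z 0] z by auto
  then show "(z, - \<theta> 0) \<in> quasi_invertible L \<and> qi z 0 = z"
    using quasi_iff(2)[of z 0] z e embed_inj[of z "qi z 0"] by auto
qed

text \<open>The openness and continuity conditions on Bergman operators enter here: the quasi-inverse is an inverse Bergman
  operator applied to a polynomial.\<close>

lemma lim_qi: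
  assumes z: "vlim z z0 F" and w: "vlim (\<lambda>i. \<theta> (w i)) (\<theta> w0) F" and q: "(z0, - \<theta> w0) \<in> quasi_invertible L"
  shows "\<forall>\<^sub>F i in F. act (ex (w i) \<circ> ex (z i)) base = embed_V L (qi (z i) (w i))"
    "vlim (\<lambda>i. qi (z i) (w i)) (qi z0 w0) F"
proof -
  let ?Q = "quasi_invertible L"
  have p: "limitin (prod_topology Vt Vt) (\<lambda>i. (z i, - \<theta> (w i))) (z0, - \<theta> w0) F"
    using z lim_minus[OF w] by (simp add: limitin_pairwise comp_def)
  have o: "openin (prod_topology Vt Vt) ?Q" using C1 by (simp add: C1_jordan_triple_system_def)
  have ev: "\<forall>\<^sub>F i in F. (z i, - \<theta> (w i)) \<in> ?Q" using limitinD[OF p o q] .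
  have s: "limitin (subtopology (prod_topology Vt Vt) ?Q) (\<lambda>i. (z i, - \<theta> (w i))) (z0, - \<theta> w0) F"
    using p ev q by (simp add: limitin_subtopology)
  have gz: "glim z z0 F" "glim w w0 F" using glim_V[OF z] glim_theta[OF glim_V[OF w]] by simp_all
  have z0: "z0 \<in> g1" and w0: "w0 \<in> gm" and ez: "\<forall>\<^sub>F i in F. z i \<in> g1" and ew: "\<forall>\<^sub>F i in F. w i \<in> gm"
    using lim_in[OF z] lim_in[OF w] by (auto simp: theta_in)
  have mem: "a - half \<cdot> (a \<star> a \<star> b) \<in> g1" if "a \<in> g1" "b \<in> gm" for a b
    using that by (intro gr_closed br_gr)
  have n: "vlim (\<lambda>i. z i - half \<cdot> (z i \<star> z i \<star> w i)) (z0 - half \<cdot> (z0 \<star> z0 \<star> w0)) F"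
  proof (rule lim_of_glim)
    show "glim (\<lambda>i. z i - half \<cdot> (z i \<star> z i \<star> w i)) (z0 - half \<cdot> (z0 \<star> z0 \<star> w0)) F"
      by (intro glim_diff glim_scale[OF tendsto_const] glim_br gz)
    show "\<forall>\<^sub>F i in F. z i - half \<cdot> (z i \<star> z i \<star> w i) \<in> g1"
      using ez ew by eventually_elim (rule mem)
  qed (rule mem[OF z0 w0])
  have c: "continuous_map (prod_topology (subtopology (prod_topology Vt Vt) ?Q) Vt) Vt
      (\<lambda>((x, y), v). the_inv_into g1 (bergman L x y) v)"
    using C1 by (simp add: C1_jordan_triple_system_def)
  from limitin_compose2[OF c s n] show "vlim (\<lambda>i. qi (z i) (w i)) (qi z0 w0) F" by (simp add: qi_def)
  show "\<forall>\<^sub>F i in F. act (ex (w i) \<circ> ex (z i)) base = embed_V L (qi (z i) (w i))"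
    using ev ez ew by eventually_elim (simp add: quasi_iff(2))
qed

subsection \<open>Convergence of points\<close>

text \<open>Convergence to \<open>g.o\<^sup>+\<close>, expressed in the chart given by \<open>g\<close>.\<close>

definition near :: "('g \<Rightarrow> 'g) \<Rightarrow> ('i \<Rightarrow> 'g flag) \<Rightarrow> 'i filter \<Rightarrow> bool" where
  "near g \<xi> F \<longleftrightarrow> (\<exists>y. vlim y 0 F \<and> (\<forall>\<^sub>F i in F. \<xi> i = act g (embed_V L (y i))))"

definition plim :: "('i \<Rightarrow> 'g flag) \<Rightarrow> 'g flag \<Rightarrow> 'i filter \<Rightarrow> bool" where
  "plim \<xi> x F \<longleftrightarrow> (\<forall>g\<in>GG L. act g base = x \<longrightarrow> near g \<xi> F)"

lemma degree_zero_embed: "degree_zero h \<Longrightarrow> act h (embed_V L y) = embed_V L (h y)"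
proof -
  assume h: "degree_zero h"
  have "h \<circ> ex y = ex (h y) \<circ> h" by (auto simp: aut_ex[OF degree_zeroD(1)[OF h]])
  then show ?thesis unfolding embed_V_def by (metis act_comp degree_zero_base[OF h])
qed

lemma ex_embed: "a \<in> g1 \<Longrightarrow> y \<in> g1 \<Longrightarrow> act (ex a) (embed_V L y) = embed_V L (a + y)"
  by (simp add: embed_V_def act_comp[symmetric] ex_add)

text \<open>Two elements with the same value at \<open>o\<^sup>+\<close> differ by some \<open>e\<^sup>w k\<close> with \<open>k\<close> of degree 0.  Such a factor acts on small
  coordinates by \<open>k\<close>, followed by a quasi-inverse, which exists because it does at 0.\<close>

lemma near_change:
  assumes n: "near g \<xi> F" and g: "g \<in> GG L" and h: "h \<in> GG L" and e: "act g base = act h base"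
  shows "near h \<xi> F"
proof -
  obtain y where y: "vlim y 0 F" "\<forall>\<^sub>F i in F. \<xi> i = act g (embed_V L (y i))" using n by (auto simp: near_def)
  let ?f = "inv h \<circ> g"
  have f: "?f \<in> GG L" using g h by (intro GG.intros)
  note af = GG_aut[OF f]
  have s: "act ?f base = base" using e act_inv[OF GG_aut[OF h]] by (metis act_comp)
  define w where "w = pm (?f euler)"
  define k where "k = ex (- w) \<circ> ?f"
  have w: "w \<in> gm" "- w \<in> gm" by (simp_all add: w_def gr_closed)
  have k: "degree_zero k" "k \<in> GG L" 
    using stab_factor[OF af s] GG.mult[OF GG_ex(2)[OF w(2)] f] by (auto simp: k_def w_def)
  have "vlim (\<lambda>i. k (y i)) 0 F"
  proof (rule lim_of_glim)
    show "glim (\<lambda>i. k (y i)) 0 F"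
      using glim_GG[OF k(2) glim_V[OF y(1)]] by (simp add: autD(7)[OF degree_zeroD(1)[OF k(1)]])
    show "\<forall>\<^sub>F i in F. k (y i) \<in> g1" using lim_in(2)[OF y(1)] by eventually_elim (rule degree_zeroD(5)[OF k(1)])
  qed simp
  note qq = lim_qi[OF this, of "\<lambda>_. w" w]
  have lw: "vlim (\<lambda>i. \<theta> w) (\<theta> w) F" using w by (simp add: theta_in)
  have q: "\<forall>\<^sub>F i in F. act (ex w \<circ> ex (k (y i))) base = embed_V L (qi (k (y i)) w)" "vlim (\<lambda>i. qi (k (y i)) w) 0 F"
    using qq[OF lw] qi_zero(1)[OF w(1)] by auto
  have fk: "?f = ex w \<circ> k" using w by (auto simp: k_def ex_cancel)
  have hf: "h \<circ> ?f = g" by (rule ext) (simp add: autD(10)[OF GG_aut[OF h]])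
  have gf: "act g E = act h (act ?f E)" for E by (simp only: act_comp[symmetric] hf)
  have "\<forall>\<^sub>F i in F. \<xi> i = act h (embed_V L (qi (k (y i)) w))"
    using y(2) q(1)
  proof eventually_elim
    case (elim i)
    have "act ?f (embed_V L (y i)) = act (ex w) (act k (embed_V L (y i)))" by (simp only: fk act_comp)
    also have "\<dots> = act (ex w \<circ> ex (k (y i))) base"
      unfolding degree_zero_embed[OF k(1)] by (simp only: act_comp embed_V_def)
    finally have "act ?f (embed_V L (y i)) = embed_V L (qi (k (y i)) w)" using elim by simp
    then show ?case using elim(1) gf[of "embed_V L (y i)"] by metis
  qed
  then show ?thesis using q(2) by (auto simp: near_def)
qed

lemma plimI: assumes g: "g \<in> GG L" and n: "near g \<xi> F" shows "plim \<xi> (act g base) F"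
  unfolding plim_def
proof (intro ballI impI)
  fix h assume "h \<in> GG L" "act h base = act g base"
  then show "near h \<xi> F" by (intro near_change[OF n g]) auto
qed

lemma plimD: "plim \<xi> x F \<Longrightarrow> g \<in> GG L \<Longrightarrow> act g base = x \<Longrightarrow> near g \<xi> F"
  by (simp add: plim_def)

lemma near_cong: assumes "near g \<xi> F" and e: "\<forall>\<^sub>F i in F. \<xi> i = \<zeta> i" shows "near g \<zeta> F"
proof -
  obtain y where y: "vlim y 0 F" "\<forall>\<^sub>F i in F. \<xi> i = act g (embed_V L (y i))" using assms by (auto simp: near_def)
  have "\<forall>\<^sub>F i in F. \<zeta> i = act g (embed_V L (y i))" using y(2) e by eventually_elim simp
  then show ?thesis using y(1) by (auto simp: near_def)
qed

lemma plim_cong: assumes p: "plim \<xi> x F" and e: "\<forall>\<^sub>F i in F. \<xi> i = \<zeta> i" shows "plim \<zeta> x F"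
  unfolding plim_def using near_cong[OF plimD[OF p] e] by blast

lemma plim_move: assumes p: "plim \<xi> x F" and h: "h \<in> GG L" shows "plim (\<lambda>i. act h (\<xi> i)) (act h x) F"
  unfolding plim_def
proof (intro ballI impI)
  fix g assume g: "g \<in> GG L" "act g base = act h x"
  note H = GG_aut[OF h]
  have G: "inv h \<circ> g \<in> GG L" using g h by (intro GG.intros)
  have "act (inv h \<circ> g) base = x" using g act_inv[OF H] by (metis act_comp)
  from plimD[OF p G this] obtain y where y: "vlim y 0 F" "\<forall>\<^sub>F i in F. \<xi> i = act (inv h \<circ> g) (embed_V L (y i))"
    by (auto simp: near_def)
  have "h \<circ> (inv h \<circ> g) = g" by (auto simp: autD[OF H])
  then have a: "act h (act (inv h \<circ> g) E) = act g E" for E by (metis act_comp)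
  have "\<forall>\<^sub>F i in F. act h (\<xi> i) = act g (embed_V L (y i))" using y(2) by eventually_elim (simp only: a)
  then show "near g (\<lambda>i. act h (\<xi> i)) F" using y(1) by (auto simp: near_def)
qed

text \<open>At a good point, small exponentials and automorphisms of degree 0 close to the identity act continuously.  The
  two properties are proved together by induction on a word leading to the point, because moving a
  small exponential past a letter produces a factor of degree 0.\<close>

definition good :: "'i filter \<Rightarrow> 'g flag \<Rightarrow> bool" where
  "good F x \<longleftrightarrow> (\<forall>\<xi>. plim \<xi> x F \<longrightarrow>
     (\<forall>b. glim b 0 F \<longrightarrow> (\<forall>\<^sub>F i in F. b i \<in> g1) \<or> (\<forall>\<^sub>F i in F. b i \<in> gm) \<longrightarrow> plim (\<lambda>i. act (ex (b i)) (\<xi> i)) x F) \<and>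
     (\<forall>\<eta>. (\<forall>\<^sub>F i in F. degree_zero (\<eta> i)) \<longrightarrow> (\<forall>f a. glim f a F \<longrightarrow> glim (\<lambda>i. \<eta> i (f i)) a F) \<longrightarrow>
        plim (\<lambda>i. act (\<eta> i) (\<xi> i)) x F))"

lemma goodD:
  assumes "good F x" "plim \<xi> x F"
  shows "glim b 0 F \<Longrightarrow> (\<forall>\<^sub>F i in F. b i \<in> g1) \<or> (\<forall>\<^sub>F i in F. b i \<in> gm) \<Longrightarrow> plim (\<lambda>i. act (ex (b i)) (\<xi> i)) x F"
    and "\<forall>\<^sub>F i in F. degree_zero (\<eta> i) \<Longrightarrow> \<forall>f a. glim f a F \<longrightarrow> glim (\<lambda>i. \<eta> i (f i)) a F \<Longrightarrow>
        plim (\<lambda>i. act (\<eta> i) (\<xi> i)) x F"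
  using assms unfolding good_def by blast+

lemma good_base: "good F base"
  unfolding good_def
proof (intro allI impI conjI)
  fix \<xi> assume p: "plim \<xi> base F"
  have "near id \<xi> F" by (rule plimD[OF p GG.one]) simp
  then obtain y where y: "vlim y 0 F" "\<forall>\<^sub>F i in F. \<xi> i = embed_V L (y i)" by (auto simp: near_def)
  have b: "plim \<zeta> base F" if "vlim z 0 F" "\<forall>\<^sub>F i in F. \<zeta> i = embed_V L (z i)" for \<zeta> z
  proof -
    have "near id \<zeta> F" using that by (auto simp: near_def)
    from plimI[OF GG.one this] show ?thesis by simp
  qed
  {
    fix b :: "'a \<Rightarrow> 'g" assume lb: "glim b 0 F" and s: "(\<forall>\<^sub>F i in F. b i \<in> g1) \<or> (\<forall>\<^sub>F i in F. b i \<in> gm)"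
    from s show "plim (\<lambda>i. act (ex (b i)) (\<xi> i)) base F"
    proof
      assume m: "\<forall>\<^sub>F i in F. b i \<in> g1"
      have "vlim b 0 F" using lb m by (rule lim_of_glim) simp
      from lim_add[OF this y(1)] have "vlim (\<lambda>i. b i + y i) 0 F" by simp
      moreover have "\<forall>\<^sub>F i in F. act (ex (b i)) (\<xi> i) = embed_V L (b i + y i)"
        using m y(2) lim_in(2)[OF y(1)] by eventually_elim (simp add: ex_embed)
      ultimately show ?thesis by (rule b)
    next
      assume m: "\<forall>\<^sub>F i in F. b i \<in> gm"
      have "vlim (\<lambda>i. \<theta> (b i)) (\<theta> 0) F"
        using glim_theta[OF lb] m by (auto intro!: lim_of_glim simp: theta_in)
      from lim_qi[OF y(1) this] qi_zero(1)[of 0]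
      have q: "\<forall>\<^sub>F i in F. act (ex (b i) \<circ> ex (y i)) base = embed_V L (qi (y i) (b i))" "vlim (\<lambda>i. qi (y i) (b i)) 0 F"
        by auto
      have "\<forall>\<^sub>F i in F. act (ex (b i)) (\<xi> i) = embed_V L (qi (y i) (b i))"
        using q(1) y(2) by eventually_elim (simp add: act_comp, simp add: embed_V_def)
      then show ?thesis using q(2) by (intro b)
    qed
  }
  fix \<eta> assume d: "\<forall>\<^sub>F i in F. degree_zero (\<eta> i)" and c: "\<forall>f a. glim f a F \<longrightarrow> glim (\<lambda>i. \<eta> i (f i)) a F"
  have "vlim (\<lambda>i. \<eta> i (y i)) 0 F"
  proof (rule lim_of_glim)
    show "glim (\<lambda>i. \<eta> i (y i)) 0 F" using c glim_V[OF y(1)] by blast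
    show "\<forall>\<^sub>F i in F. \<eta> i (y i) \<in> g1" using d lim_in(2)[OF y(1)] by eventually_elim (rule degree_zeroD)
  qed simp
  moreover have "\<forall>\<^sub>F i in F. act (\<eta> i) (\<xi> i) = embed_V L (\<eta> i (y i))"
    using y(2) d by eventually_elim (simp add: degree_zero_embed)
  ultimately show "plim (\<lambda>i. act (\<eta> i) (\<xi> i)) base F" by (rule b)
qed

text \<open>For small \<open>b\<close>, the point \<open>e\<^sup>b e\<^sup>c.o\<^sup>+\<close> has a coordinate \<open>x\<close> close to \<open>c\<close>.  Then \<open>e\<^sup>-\<^sup>x e\<^sup>b e\<^sup>c\<close> fixes \<open>o\<^sup>+\<close>, and its
  factors \<open>e\<^sup>w\<close> and \<open>\<eta>\<close> are close to the identity as \<open>w\<close> is read off from its value at \<open>E\<close>; \<open>\<beta>\<close> is \<open>x - c\<close>.\<close>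

lemma exchange:
  assumes c: "c \<in> g1" and b: "glim b 0 F" "\<forall>\<^sub>F i in F. b i \<in> gm"
  obtains \<beta> w \<eta> where "\<forall>\<^sub>F i in F. ex (b i) \<circ> ex c = ex c \<circ> ex (\<beta> i) \<circ> ex (w i) \<circ> \<eta> i"
    "\<forall>\<^sub>F i in F. \<beta> i \<in> g1" "\<forall>\<^sub>F i in F. w i \<in> gm" "\<forall>\<^sub>F i in F. degree_zero (\<eta> i)" "glim \<beta> 0 F" "glim w 0 F"
    "\<forall>f a. glim f a F \<longrightarrow> glim (\<lambda>i. \<eta> i (f i)) a F"
proof -
  have "vlim (\<lambda>i. \<theta> (b i)) (\<theta> 0) F" 
    using glim_theta[OF b(1)] b(2) by (auto intro!: lim_of_glim simp: theta_in)
  from lim_qi[OF lim_const[OF c] this] qi_zero(2)[OF c]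
  have q: "\<forall>\<^sub>F i in F. act (ex (b i) \<circ> ex c) base = embed_V L (qi c (b i))" and l: "vlim (\<lambda>i. qi c (b i)) c F"
    by auto
  define x where "x = (\<lambda>i. qi c (b i))"
  define f where "f = (\<lambda>i. ex (- x i) \<circ> (ex (b i) \<circ> ex c))"
  define w where "w = (\<lambda>i. pm (f i euler))"
  define \<eta> where "\<eta> = (\<lambda>i. ex (- w i) \<circ> f i)"
  have x: "\<forall>\<^sub>F i in F. x i \<in> g1" and lx: "glim x c F" using lim_in(2)[OF l] glim_V[OF l] by (auto simp: x_def)
  have gc: "glim (\<lambda>i. c) c F" using c by (intro glim_const celem_gr)
  have lf: "glim (\<lambda>i. f i (u i)) a F" if "glim u a F" for u a
  proof -
    have "glim (\<lambda>i. ex (- x i) (ex (b i) (ex c (u i)))) (ex (- c) (ex 0 (ex c a))) F"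
      by (intro glim_ex glim_minus lx b(1) gc that)
    then show ?thesis using c by (simp add: f_def ex_cancel)
  qed
  have lw: "glim w 0 F" unfolding w_def using glim_pm[OF lf[OF glim_const[OF celem_euler]]] by simp
  have lh: "glim (\<lambda>i. \<eta> i (u i)) a F" if "glim u a F" for u a
    using glim_ex[OF glim_minus[OF lw] lf[OF that]] by (simp add: \<eta>_def)
  have ev: "\<forall>\<^sub>F i in F. degree_zero (\<eta> i) \<and> ex (b i) \<circ> ex c = ex c \<circ> ex (x i - c) \<circ> ex (w i) \<circ> \<eta> i"
    using q x b(2)
  proof eventually_elim
    case (elim i)
    let ?k = "ex (b i) \<circ> ex c"
    have G: "?k \<in> GG L" using c elim by (intro GG.mult GG_ex)
    have s: "act (f i) base = base"
      using chart_value(2)[OF G _ elim(1)] elim by (simp add: f_def x_def)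
    have a: "aut (f i)" using elim GG_aut[OF G] by (auto simp: f_def gr_closed intro!: aut_comp exp_aut)
    have "ex (x i) = ex c \<circ> ex (x i - c)" using ex_add[of c "x i - c"] c elim by (simp add: gr_closed)
    then have e: "ex c (ex (x i - c) y) = ex (x i) y" for y by simp
    have "w i \<in> gm" by (simp add: w_def)
    then have "?k = ex c \<circ> ex (x i - c) \<circ> ex (w i) \<circ> \<eta> i"
      using elim by (auto simp: fun_eq_iff \<eta>_def f_def ex_cancel e)
    then show ?case using stab_factor[OF a s] by (simp add: \<eta>_def w_def)
  qed
  show ?thesis
  proof (rule that[of "\<lambda>i. x i - c" w \<eta>])
    show "glim (\<lambda>i. x i - c) 0 F" using glim_diff[OF lx gc] by simp
    show "\<forall>\<^sub>F i in F. x i - c \<in> g1" using x c by (auto simp: gr_closed elim: eventually_mono)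
    show "\<forall>\<^sub>F i in F. w i \<in> gm" by (simp add: w_def)
  qed (use ev lw lh in \<open>auto elim: eventually_mono\<close>)
qed

lemma exchange_any:
  assumes c: "c \<in> g1 \<union> gm" and b: "glim b 0 F" "(\<forall>\<^sub>F i in F. b i \<in> g1) \<or> (\<forall>\<^sub>F i in F. b i \<in> gm)"
  obtains \<beta> w \<eta> where "\<forall>\<^sub>F i in F. ex (b i) \<circ> ex c = ex c \<circ> ex (\<beta> i) \<circ> ex (w i) \<circ> \<eta> i"
    "(\<forall>\<^sub>F i in F. \<beta> i \<in> g1) \<or> (\<forall>\<^sub>F i in F. \<beta> i \<in> gm)" "(\<forall>\<^sub>F i in F. w i \<in> g1) \<or> (\<forall>\<^sub>F i in F. w i \<in> gm)" 
    "\<forall>\<^sub>F i in F. degree_zero (\<eta> i)" "glim \<beta> 0 F" "glim w 0 F"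
    "\<forall>f a. glim f a F \<longrightarrow> glim (\<lambda>i. \<eta> i (f i)) a F"
proof -
  consider (same) "c \<in> g1 \<and> (\<forall>\<^sub>F i in F. b i \<in> g1) \<or> c \<in> gm \<and> (\<forall>\<^sub>F i in F. b i \<in> gm)"
    | (opp) "c \<in> g1" "\<forall>\<^sub>F i in F. b i \<in> gm" | (opp') "c \<in> gm" "\<forall>\<^sub>F i in F. b i \<in> g1"
    using c b(2) by auto
  then show ?thesis
  proof cases
    case same
    have e: "ex x \<circ> ex c = ex c \<circ> ex x \<circ> ex 0 \<circ> id" if "c \<in> g1 \<and> x \<in> g1 \<or> c \<in> gm \<and> x \<in> gm" for x
      using ex_add[of x c] ex_add[of c x] that by (auto simp: add.commute)
    have s: "\<forall>\<^sub>F i in F. ex (b i) \<circ> ex c = ex c \<circ> ex (b i) \<circ> ex 0 \<circ> id"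
    proof -
      have "\<forall>\<^sub>F i in F. c \<in> g1 \<and> b i \<in> g1 \<or> c \<in> gm \<and> b i \<in> gm"
        using same by (auto elim: eventually_mono)
      then show ?thesis by (rule eventually_mono) (rule e)
    qed
    show ?thesis
      by (rule that[of b "\<lambda>_. 0" "\<lambda>_. id"])
        (use b s in \<open>auto simp: glim_zero degree_zero_def aut_id[unfolded id_def] id_def\<close>)
  next
    case opp
    obtain \<beta> w \<eta> where o: "\<forall>\<^sub>F i in F. ex (b i) \<circ> ex c = ex c \<circ> ex (\<beta> i) \<circ> ex (w i) \<circ> \<eta> i"
      "\<forall>\<^sub>F i in F. \<beta> i \<in> g1" "\<forall>\<^sub>F i in F. w i \<in> gm" "\<forall>\<^sub>F i in F. degree_zero (\<eta> i)" "glim \<beta> 0 F" "glim w 0 F"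
      "\<forall>f a. glim f a F \<longrightarrow> glim (\<lambda>i. \<eta> i (f i)) a F"
      by (rule exchange[OF opp(1) b(1) opp(2)])
    show ?thesis by (rule that[OF o(1) disjI1[OF o(2)] disjI2[OF o(3)] o(4-7)])
  next
    case opp'
    have b': "glim (\<lambda>i. \<theta> (b i)) 0 F" "\<forall>\<^sub>F i in F. \<theta> (b i) \<in> gm"
      using glim_theta[OF b(1)] opp'(2) by (simp_all add: theta_in)
    have c': "\<theta> c \<in> g1" using opp'(1) by (simp add: theta_in)
    \<comment> \<open>Conjugation with \<open>\<theta>\<close> interchanges the degrees 1 and -1.\<close>
    obtain \<beta> w \<eta> where o: "\<forall>\<^sub>F i in F. ex (\<theta> (b i)) \<circ> ex (\<theta> c) = ex (\<theta> c) \<circ> ex (\<beta> i) \<circ> ex (w i) \<circ> \<eta> i"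
      "\<forall>\<^sub>F i in F. \<beta> i \<in> g1" "\<forall>\<^sub>F i in F. w i \<in> gm" "\<forall>\<^sub>F i in F. degree_zero (\<eta> i)" "glim \<beta> 0 F" "glim w 0 F"
      "\<forall>f a. glim f a F \<longrightarrow> glim (\<lambda>i. \<eta> i (f i)) a F"
      by (rule exchange[OF c' b'])
    have t: "ex (\<theta> x) y = \<theta> (ex x (\<theta> y))" for x y by (simp add: theta_ex)
    show ?thesis
    proof (rule that[of "\<lambda>i. \<theta> (\<beta> i)" "\<lambda>i. \<theta> (w i)" "\<lambda>i. \<theta> \<circ> \<eta> i \<circ> \<theta>"])
      show "\<forall>\<^sub>F i in F. ex (b i) \<circ> ex c = ex c \<circ> ex (\<theta> (\<beta> i)) \<circ> ex (\<theta> (w i)) \<circ> (\<theta> \<circ> \<eta> i \<circ> \<theta>)"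
        using o(1)
      proof eventually_elim
        case (elim i)
        have "ex (b i) (ex c y) = \<theta> ((ex (\<theta> (b i)) \<circ> ex (\<theta> c)) (\<theta> y))" for y by (simp add: theta_ex)
        then show ?case unfolding elim by (auto simp: theta_ex)
      qed
      show "(\<forall>\<^sub>F i in F. \<theta> (\<beta> i) \<in> g1) \<or> (\<forall>\<^sub>F i in F. \<theta> (\<beta> i) \<in> gm)" 
        "(\<forall>\<^sub>F i in F. \<theta> (w i) \<in> g1) \<or> (\<forall>\<^sub>F i in F. \<theta> (w i) \<in> gm)"
        using o by (simp_all add: theta_in)
      show "\<forall>\<^sub>F i in F. degree_zero (\<theta> \<circ> \<eta> i \<circ> \<theta>)" using o(4) by (rule eventually_mono) (rule degree_zero_theta)
      show "glim (\<lambda>i. \<theta> (\<beta> i)) 0 F" "glim (\<lambda>i. \<theta> (w i)) 0 F" 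
        using glim_theta[OF o(5)] glim_theta[OF o(6)] by simp_all
      show "\<forall>f a. glim f a F \<longrightarrow> glim (\<lambda>i. (\<theta> \<circ> \<eta> i \<circ> \<theta>) (f i)) a F"
      proof (intro allI impI)
        fix f :: "'a \<Rightarrow> 'g" and a assume "glim f a F"
        from o(7)[rule_format, OF glim_theta[OF this]]
        show "glim (\<lambda>i. (\<theta> \<circ> \<eta> i \<circ> \<theta>) (f i)) a F" using glim_theta[of "\<lambda>i. \<eta> i (\<theta> (f i))" "\<theta> a" F] by simp
      qed
    qed
  qed
qed

text \<open>A small exponential acting on \<open>e\<^sup>c \<zeta>\<close> becomes \<open>e\<^sup>c\<close> times small factors acting on \<open>\<zeta>\<close>.  A factor \<open>\<eta>\<close> of
  degree 0 satisfies \<open>\<eta> e\<^sup>c = e\<^sup>c e\<^sup>\<eta>\<^sup>c\<^sup>-\<^sup>c \<eta>\<close>, where \<open>\<eta> c - c\<close> is small.\<close>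

lemma good_step:
  assumes g: "good F x" and c: "c \<in> g1 \<union> gm"
  shows "good F (act (ex c) x)"
  unfolding good_def
proof (intro allI impI conjI)
  fix \<xi> assume p: "plim \<xi> (act (ex c) x) F"
  define \<zeta> where "\<zeta> = (\<lambda>i. act (ex (- c)) (\<xi> i))"
  have c': "- c \<in> g1 \<union> gm" using c by (auto simp: gr_closed)
  have G: "ex c \<in> GG L" "ex (- c) \<in> GG L" using c c' by (auto intro: GG.gen)
  have cc: "ex (- c) \<circ> ex c = id" "ex c \<circ> ex (- c) = id" using c by (auto simp: ex_cancel)
  have "plim \<zeta> (act (ex (- c)) (act (ex c) x)) F" unfolding \<zeta>_def by (rule plim_move[OF p G(2)])
  then have z: "plim \<zeta> x F" by (simp add: act_comp[symmetric] cc)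
  have xz: "\<xi> i = act (ex c) (\<zeta> i)" for i by (simp add: \<zeta>_def act_comp[symmetric] cc)
  have small: "plim (\<lambda>i. act (ex (b i)) (\<zeta>' i)) x F" 
    if "plim \<zeta>' x F" "glim b 0 F" "(\<forall>\<^sub>F i in F. b i \<in> g1) \<or> (\<forall>\<^sub>F i in F. b i \<in> gm)" for b \<zeta>'
    by (rule goodD(1)[OF g that])
  {
    fix b :: "'a \<Rightarrow> 'g" assume b: "glim b 0 F" "(\<forall>\<^sub>F i in F. b i \<in> g1) \<or> (\<forall>\<^sub>F i in F. b i \<in> gm)"
    obtain \<beta> w \<eta> where o: "\<forall>\<^sub>F i in F. ex (b i) \<circ> ex c = ex c \<circ> ex (\<beta> i) \<circ> ex (w i) \<circ> \<eta> i"
      "(\<forall>\<^sub>F i in F. \<beta> i \<in> g1) \<or> (\<forall>\<^sub>F i in F. \<beta> i \<in> gm)" "(\<forall>\<^sub>F i in F. w i \<in> g1) \<or> (\<forall>\<^sub>F i in F. w i \<in> gm)" 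
      "\<forall>\<^sub>F i in F. degree_zero (\<eta> i)" "glim \<beta> 0 F" "glim w 0 F"
      "\<forall>f a. glim f a F \<longrightarrow> glim (\<lambda>i. \<eta> i (f i)) a F"
      by (rule exchange_any[OF c b])
    have "plim (\<lambda>i. act (\<eta> i) (\<zeta> i)) x F" by (rule goodD(2)[OF g z o(4,7)])
    from plim_move[OF small[OF small[OF this o(6,3)] o(5,2)] G(1)]
    show "plim (\<lambda>i. act (ex (b i)) (\<xi> i)) (act (ex c) x) F"
    proof (rule plim_cong)
      show "\<forall>\<^sub>F i in F. act (ex c) (act (ex (\<beta> i)) (act (ex (w i)) (act (\<eta> i) (\<zeta> i)))) = act (ex (b i)) (\<xi> i)"
        using o(1) by eventually_elim (simp only: xz act_comp[symmetric] o_assoc)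
    qed
  }
  fix \<eta> assume d: "\<forall>\<^sub>F i in F. degree_zero (\<eta> i)" and l: "\<forall>f a. glim f a F \<longrightarrow> glim (\<lambda>i. \<eta> i (f i)) a F"
  have 1: "plim (\<lambda>i. act (\<eta> i) (\<zeta> i)) x F" by (rule goodD(2)[OF g z d l])
  have gc: "glim (\<lambda>i. c) c F" using c by (auto intro: glim_const celem_gr)
  have 2: "glim (\<lambda>i. \<eta> i c - c) 0 F" using glim_diff[OF l[rule_format, OF gc] gc] by simp
  have 3: "(\<forall>\<^sub>F i in F. \<eta> i c - c \<in> g1) \<or> (\<forall>\<^sub>F i in F. \<eta> i c - c \<in> gm)"
  proof (cases "c \<in> g1")
    case True
    then have "\<forall>\<^sub>F i in F. \<eta> i c - c \<in> g1" using d by (auto simp: degree_zeroD gr_closed elim!: eventually_mono)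
    then show ?thesis ..
  next
    case False
    then have "\<forall>\<^sub>F i in F. \<eta> i c - c \<in> gm" using d c by (auto simp: degree_zeroD gr_closed elim!: eventually_mono)
    then show ?thesis ..
  qed
  from plim_move[OF small[OF 1 2 3] G(1)]
  show "plim (\<lambda>i. act (\<eta> i) (\<xi> i)) (act (ex c) x) F"
  proof (rule plim_cong)
    show "\<forall>\<^sub>F i in F. act (ex c) (act (ex (\<eta> i c - c)) (act (\<eta> i) (\<zeta> i))) = act (\<eta> i) (\<xi> i)"
      using d
    proof eventually_elim
      case (elim i)
      have "\<eta> i c - c \<in> g1 \<and> c \<in> g1 \<or> \<eta> i c - c \<in> gm \<and> c \<in> gm" using c elim by (auto simp: degree_zeroD gr_closed)
      then have "ex c \<circ> ex (\<eta> i c - c) = ex (\<eta> i c)" using ex_add[of c "\<eta> i c - c"] by auto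
      moreover have "\<eta> i \<circ> ex c = ex (\<eta> i c) \<circ> \<eta> i" using aut_ex[OF degree_zeroD(1)[OF elim]] by auto
      ultimately have "ex c \<circ> (ex (\<eta> i c - c) \<circ> \<eta> i) = \<eta> i \<circ> ex c" by (simp add: o_assoc)
      then show ?case unfolding xz by (simp only: act_comp[symmetric])
    qed
  qed
qed

lemma good_word: "word l \<Longrightarrow> good F (act (W l) base)"
  by (induction l) (auto simp: good_base[unfolded] act_comp intro!: good_step simp del: o_apply)

text \<open>The letters are changed one by one: \<open>e\<^sup>a = e\<^sup>a\<^sup>0 e\<^sup>a\<^sup>-\<^sup>a\<^sup>0\<close> with \<open>a - a0\<close> small, and all points are good.\<close>

lemma plim_word:
  "\<forall>q\<in>set l. glim (fst q) (snd q) F \<and> 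
     (snd q \<in> g1 \<and> (\<forall>\<^sub>F i in F. fst q i \<in> g1) \<or> snd q \<in> gm \<and> (\<forall>\<^sub>F i in F. fst q i \<in> gm)) \<Longrightarrow>
   plim (\<lambda>i. act (W (map (\<lambda>q. fst q i) l)) base) (act (W (map snd l)) base) F"
proof (induction l)
  case Nil
  have "near id (\<lambda>i. base) F" unfolding near_def 
    by (rule exI[of _ "\<lambda>_. 0"]) (simp add: embed_V_def)
  from plimI[OF GG.one this] show ?case by (simp only: list.map W.simps act_id)
next
  case (Cons q l)
  obtain a a0 where q: "q = (a, a0)" by (cases q)
  have la: "glim a a0 F" and s: "a0 \<in> g1 \<and> (\<forall>\<^sub>F i in F. a i \<in> g1) \<or> a0 \<in> gm \<and> (\<forall>\<^sub>F i in F. a i \<in> gm)"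
    using Cons.prems by (auto simp: q)
  have gn: "a0 \<in> g1 \<union> gm" using s by auto
  have w: "word (map snd l)" using Cons.prems by auto
  have IH: "plim (\<lambda>i. act (W (map (\<lambda>q. fst q i) l)) base) (act (W (map snd l)) base) F" using Cons by auto
  have b: "glim (\<lambda>i. a i - a0) 0 F" using glim_diff[OF la glim_const[of a0]] gn by (auto simp: celem_gr)
  have bs: "(\<forall>\<^sub>F i in F. a i - a0 \<in> g1) \<or> (\<forall>\<^sub>F i in F. a i - a0 \<in> gm)"
    using s
  proof
    assume m: "a0 \<in> g1 \<and> (\<forall>\<^sub>F i in F. a i \<in> g1)"
    then have "\<forall>\<^sub>F i in F. a i \<in> g1" ..
    then have "\<forall>\<^sub>F i in F. a i - a0 \<in> g1" by eventually_elim (use m in \<open>simp add: gr_closed\<close>)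
    then show ?thesis ..
  next
    assume m: "a0 \<in> gm \<and> (\<forall>\<^sub>F i in F. a i \<in> gm)"
    then have "\<forall>\<^sub>F i in F. a i \<in> gm" ..
    then have "\<forall>\<^sub>F i in F. a i - a0 \<in> gm" by eventually_elim (use m in \<open>simp add: gr_closed\<close>)
    then show ?thesis ..
  qed
  have "plim (\<lambda>i. act (ex (a i - a0)) (act (W (map (\<lambda>q. fst q i) l)) base)) (act (W (map snd l)) base) F"
    by (rule goodD(1)[OF good_word[OF w] IH b bs])
  from plim_move[OF this GG.gen[OF gn]]
  show ?case unfolding q list.map W.simps act_comp snd_conv fst_conv
  proof (rule plim_cong)
    have "\<forall>\<^sub>F i in F. a0 \<in> g1 \<and> a i - a0 \<in> g1 \<or> a0 \<in> gm \<and> a i - a0 \<in> gm"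
      using s by (auto simp: gr_closed elim: eventually_mono)
    then show "\<forall>\<^sub>F i in F. act (ex a0) (act (ex (a i - a0)) (act (W (map (\<lambda>q. fst q i) l)) base))
        = act (ex (a i)) (act (W (map (\<lambda>q. fst q i) l)) base)"
      by eventually_elim (simp add: act_comp[symmetric] ex_add[symmetric] o_assoc)
  qed
qed

lemma word_limit:
  assumes l: "\<forall>q\<in>set l. glim (fst q) (snd q) F \<and> 
     (snd q \<in> g1 \<and> (\<forall>\<^sub>F i in F. fst q i \<in> g1) \<or> snd q \<in> gm \<and> (\<forall>\<^sub>F i in F. fst q i \<in> gm))"
    and z: "z0 \<in> g1" "act (W (map snd l)) base = embed_V L z0"
  obtains z where "vlim z z0 F" "\<forall>\<^sub>F i in F. act (W (map (\<lambda>q. fst q i) l)) base = embed_V L (z i)"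
proof -
  have "near (ex z0) (\<lambda>i. act (W (map (\<lambda>q. fst q i) l)) base) F"
    using plim_word[OF l] z GG_ex(1)[OF z(1)] by (auto simp: plim_def embed_V_def)
  then obtain y where y: "vlim y 0 F" "\<forall>\<^sub>F i in F. act (W (map (\<lambda>q. fst q i) l)) base = act (ex z0) (embed_V L (y i))"
    by (auto simp: near_def)
  show ?thesis
  proof (rule that[of "\<lambda>i. z0 + y i"])
    show "vlim (\<lambda>i. z0 + y i) z0 F" using lim_add[OF lim_const[OF z(1)] y(1)] by simp
    show "\<forall>\<^sub>F i in F. act (W (map (\<lambda>q. fst q i) l)) base = embed_V L (z0 + y i)"
      using y(2) lim_in(2)[OF y(1)] by eventually_elim (simp add: ex_embed z)
  qed
qed

end

section \<open>Differential calculus for functions with values in the Lie algebra\<close>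

subsection \<open>Limits in the iterated spaces\<close>

lemma limitin_nhdsin: "x \<in> topspace X \<Longrightarrow> limitin X (\<lambda>y. y) x (nhdsin X x)"
  by (auto simp: limitin_def eventually_nhdsin)

lemma openin_nhdsin:
  "openin X S \<longleftrightarrow> S \<subseteq> topspace X \<and> (\<forall>x\<in>S. \<forall>\<^sub>F y in nhdsin X x. y \<in> S)"
proof
  assume "openin X S" then show "S \<subseteq> topspace X \<and> (\<forall>x\<in>S. \<forall>\<^sub>F y in nhdsin X x. y \<in> S)"
    using openin_subset[of X S] by (metis eventually_nhdsin)
next
  assume a: "S \<subseteq> topspace X \<and> (\<forall>x\<in>S. \<forall>\<^sub>F y in nhdsin X x. y \<in> S)"
  show "openin X S"
  proof (subst openin_subopen, intro ballI)
    fix x assume x: "x \<in> S"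
    have "x \<in> topspace X" "\<forall>\<^sub>F y in nhdsin X x. y \<in> S" using a x by blast+
    then show "\<exists>T. openin X T \<and> x \<in> T \<and> T \<subseteq> S" by (simp add: eventually_nhdsin subset_eq)
  qed
qed

lemma continuous_map_nhdsin:
  assumes "\<And>x. x \<in> topspace X \<Longrightarrow> limitin Y f (f x) (nhdsin X x)"
  shows "continuous_map X Y f"
  unfolding continuous_map_def
proof (intro conjI allI impI)
  show "f \<in> topspace X \<rightarrow> topspace Y" using limitin_topspace[OF assms] by blast
  fix U assume U: "openin Y U"
  show "openin X {x \<in> topspace X. f x \<in> U}"
    unfolding openin_nhdsin
  proof (intro conjI ballI)
    fix x assume x: "x \<in> {x \<in> topspace X. f x \<in> U}"
    then have x': "x \<in> topspace X" "f x \<in> U" by auto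
    have "\<forall>\<^sub>F y in nhdsin X x. f y \<in> U" by (rule limitinD[OF assms[OF x'(1)] U x'(2)])
    moreover have "\<forall>\<^sub>F y in nhdsin X x. y \<in> topspace X" 
      by (rule limitinD[OF limitin_nhdsin[OF x'(1)] openin_topspace x'(1)])
    ultimately show "\<forall>\<^sub>F y in nhdsin X x. y \<in> {x \<in> topspace X. f x \<in> U}" by eventually_elim auto
  qed auto
qed

lemma limitin_pullback:
  "limitin (pullback_topology A f T) s l F \<longleftrightarrow>
    l \<in> A \<and> (\<forall>\<^sub>F i in F. s i \<in> A) \<and> limitin T (\<lambda>i. f (s i)) (f l) F"
proof
  assume l: "limitin (pullback_topology A f T) s l F"
  have t: "l \<in> A" "f l \<in> topspace T" using limitin_topspace[OF l] by (auto simp: topspace_pullback_topology)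
  have "\<forall>\<^sub>F i in F. s i \<in> f -` topspace T \<inter> A"
    using limitinD[OF l openin_topspace] limitin_topspace[OF l] by (simp add: topspace_pullback_topology)
  then have "\<forall>\<^sub>F i in F. s i \<in> A" by eventually_elim simp
  moreover have "limitin T (\<lambda>i. f (s i)) (f l) F" unfolding limitin_def
  proof (intro conjI allI impI)
    fix U assume U: "openin T U \<and> f l \<in> U"
    then have "\<forall>\<^sub>F i in F. s i \<in> f -` U \<inter> A"
      using t by (intro limitinD[OF l]) (auto simp: openin_pullback_topology)
    then show "\<forall>\<^sub>F i in F. f (s i) \<in> U" by eventually_elim simp
  qed (use t in simp)
  ultimately show "l \<in> A \<and> (\<forall>\<^sub>F i in F. s i \<in> A) \<and> limitin T (\<lambda>i. f (s i)) (f l) F" using t by simp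
next
  assume a: "l \<in> A \<and> (\<forall>\<^sub>F i in F. s i \<in> A) \<and> limitin T (\<lambda>i. f (s i)) (f l) F"
  show "limitin (pullback_topology A f T) s l F" unfolding limitin_def
  proof (intro conjI allI impI)
    show "l \<in> topspace (pullback_topology A f T)" 
      using a limitin_topspace[of T] by (auto simp: topspace_pullback_topology)
    fix U assume "openin (pullback_topology A f T) U \<and> l \<in> U"
    then obtain U' where U': "openin T U'" "U = f -` U' \<inter> A" "l \<in> U" by (auto simp: openin_pullback_topology)
    have "\<forall>\<^sub>F i in F. f (s i) \<in> U'" using a U' by (auto intro: limitinD)
    moreover have "\<forall>\<^sub>F i in F. s i \<in> A" using a by simp
    ultimately show "\<forall>\<^sub>F i in F. s i \<in> U" by eventually_elim (simp add: U')
  qed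
qed

lemma limitin_iter_0:
  "limitin (iter_top E 0) s (Leaf a) F \<longleftrightarrow> (\<forall>\<^sub>F i in F. s i \<in> range Leaf) \<and> limitin (mod_top E) (\<lambda>i. leaf (s i)) a F"
  by (auto simp: limitin_pullback)

lemma limitin_iter_Suc:
  "limitin (iter_top E (Suc n)) s (Node x v t) F \<longleftrightarrow> (\<forall>\<^sub>F i in F. s i \<in> {Node x v t | x v t. True}) \<and>
     limitin (iter_top E n) (\<lambda>i. pnt (s i)) x F \<and> limitin (iter_top E n) (\<lambda>i. dir (s i)) v F \<and> ((\<lambda>i. par (s i)) \<longlongrightarrow> t) F"
  by (auto simp: limitin_pullback limitin_pairwise comp_def)

lemma topspace_iter_0: "topspace (iter_top E 0) = Leaf ` carr E"
  by (auto simp: topspace_pullback_topology)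

lemma topspace_iter_Suc: "topspace (iter_top E (Suc n)) =
   {Node x v t | x v t. x \<in> topspace (iter_top E n) \<and> v \<in> topspace (iter_top E n)}"
  by (auto simp: topspace_pullback_topology)

locale iterated =
  fixes E :: "('k::topological_comm_ring_1, 'e::ab_group_add) tmodule"
  assumes E: "topological_module E"
begin

abbreviation Sp :: "nat \<Rightarrow> ('k, 'e) iter set" where "Sp n \<equiv> topspace (iter_top E n)"
abbreviation step :: "('k, 'e) iter \<Rightarrow> 'k \<Rightarrow> ('k, 'e) iter \<Rightarrow> ('k, 'e) iter" where
  "step x t v \<equiv> iter_add x (iter_scal E t v)"

lemma mod: "module (scal E)" using E by (simp add: topological_module_def)

lemma limitin_step:
  "limitin (iter_top E n) f a F \<Longrightarrow> (c \<longlongrightarrow> t) F \<Longrightarrow> limitin (iter_top E n) h b F \<Longrightarrow>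
    limitin (iter_top E n) (\<lambda>i. step (f i) (c i) (h i)) (step a t b) F"
proof (induction n arbitrary: f a h b)
  case 0
  obtain a' b' where e: "a = Leaf a'" "b = Leaf b'" using limitin_topspace[OF 0(1)] limitin_topspace[OF 0(3)]
    by (auto simp del: iter_top.simps simp: topspace_iter_0)
  have f: "\<forall>\<^sub>F i in F. f i \<in> range Leaf" "limitin (mod_top E) (\<lambda>i. leaf (f i)) a' F"
    and h: "\<forall>\<^sub>F i in F. h i \<in> range Leaf" "limitin (mod_top E) (\<lambda>i. leaf (h i)) b' F"
    using 0 by (simp_all only: e limitin_iter_0)
  have ev: "\<forall>\<^sub>F i in F. step (f i) (c i) (h i) = Leaf (leaf (f i) + scal E (c i) (leaf (h i)))"
    using f(1) h(1) by eventually_elim auto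
  have "limitin (mod_top E) (\<lambda>i. leaf (step (f i) (c i) (h i))) (a' + scal E t b') F"
    by (rule limitin_transform_eventually[OF _ limitin_add[OF E f(2) limitin_scale[OF E 0(2) h(2)]]])
      (use ev in \<open>eventually_elim, simp\<close>)
  moreover have "\<forall>\<^sub>F i in F. step (f i) (c i) (h i) \<in> range Leaf" using ev by eventually_elim simp
  ultimately show ?case unfolding e iter_scal.simps iter_add.simps limitin_iter_0 by blast
next
  case (Suc n)
  obtain x v s x' v' s' where e: "a = Node x v s" "b = Node x' v' s'" 
    using limitin_topspace[OF Suc(2)] limitin_topspace[OF Suc(4)] unfolding topspace_iter_Suc by blast
  note f = Suc(2)[unfolded e limitin_iter_Suc] and h = Suc(4)[unfolded e limitin_iter_Suc]
  have f1: "\<forall>\<^sub>F i in F. f i \<in> {Node x v t | x v t. True}" and h1: "\<forall>\<^sub>F i in F. h i \<in> {Node x v t | x v t. True}"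
    using f h by auto
  have ev: "\<forall>\<^sub>F i in F. step (f i) (c i) (h i) = Node (step (pnt (f i)) (c i) (pnt (h i)))
      (step (dir (f i)) (c i) (dir (h i))) (par (f i) + c i * par (h i))"
    using f1 h1 by eventually_elim auto
  have 1: "limitin (iter_top E n) (\<lambda>i. pnt (step (f i) (c i) (h i))) (step x t x') F"
    by (rule limitin_transform_eventually[OF _ Suc.IH]) (use f h Suc(3) ev in \<open>auto elim: eventually_mono\<close>)
  have 2: "limitin (iter_top E n) (\<lambda>i. dir (step (f i) (c i) (h i))) (step v t v') F"
    by (rule limitin_transform_eventually[OF _ Suc.IH]) (use f h Suc(3) ev in \<open>auto elim: eventually_mono\<close>)
  have t3: "((\<lambda>i. par (f i) + c i * par (h i)) \<longlongrightarrow> s + t * s') F"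
    using f h Suc(3) by (intro tendsto_intros) auto
  have 3: "((\<lambda>i. par (step (f i) (c i) (h i))) \<longlongrightarrow> s + t * s') F"
    by (rule Lim_transform_eventually[OF t3]) (use ev in \<open>eventually_elim, simp\<close>)
  have 4: "\<forall>\<^sub>F i in F. step (f i) (c i) (h i) \<in> {Node x v t | x v t. True}" using ev by eventually_elim simp
  show ?case unfolding e iter_scal.simps iter_add.simps limitin_iter_Suc using 1 2 3 4 by blast
qed

definition shift :: "('k, 'e) iter \<Rightarrow> ('k, 'e) iter" where "shift N = step (pnt N) (par N) (dir N)"

lemma shift_Node [simp]: "shift (Node x v t) = step x t v" by (simp add: shift_def)

lemma quot_domD: 
  assumes "N \<in> quot_dom E n U"
  shows "pnt N \<in> U" "dir N \<in> Sp n" "shift N \<in> U" "\<exists>x v t. N = Node x v t"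
  using assms by (auto simp: quot_dom_def)

lemma quot_dom_sub: "U \<subseteq> Sp n \<Longrightarrow> quot_dom E n U \<subseteq> Sp (Suc n)"
  unfolding topspace_iter_Suc by (auto simp: quot_dom_def)

text \<open>The function \<open>f1\<close> is a difference quotient of \<open>f\<close> with respect to the scalar multiplication \<open>sc\<close>, without a continuity
  condition.\<close>

definition isq :: "nat \<Rightarrow> ('k, 'e) iter set \<Rightarrow> ('k \<Rightarrow> 'w \<Rightarrow> 'w) \<Rightarrow> (('k, 'e) iter \<Rightarrow> 'w::ab_group_add) \<Rightarrow> (('k, 'e) iter \<Rightarrow> 'w) \<Rightarrow> bool" where
  "isq n U sc f f1 \<longleftrightarrow> (\<forall>N \<in> quot_dom E n U. f (shift N) = f (pnt N) + sc (par N) (f1 N))"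

text \<open>Linearity is tested on the combinations \<open>x + tv\<close>, the only ones that difference quotients involve.\<close>

definition linmap :: "nat \<Rightarrow> nat \<Rightarrow> (('k, 'e) iter \<Rightarrow> ('k, 'e) iter) \<Rightarrow> bool" where
  "linmap n m \<phi> \<longleftrightarrow> (\<forall>x\<in>Sp n. \<forall>v\<in>Sp n. \<forall>t. \<phi> (step x t v) = step (\<phi> x) t (\<phi> v)) \<and>
     continuous_map (iter_top E n) (iter_top E m) \<phi>"

definition linfun :: "nat \<Rightarrow> (('k, 'e) iter \<Rightarrow> 'k) \<Rightarrow> bool" where
  "linfun n c \<longleftrightarrow> (\<forall>x\<in>Sp n. \<forall>v\<in>Sp n. \<forall>t. c (step x t v) = c x + t * c v) \<and> 
     continuous_map (iter_top E n) euclidean c"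

lemma limitin_continuous_map_all: 
  "continuous_map X Y f \<Longrightarrow> limitin X s x F \<Longrightarrow> limitin Y (\<lambda>i. f (s i)) (f x) F"
  using continuous_map_limit[of X Y f s x F] by (simp add: comp_def)

lemma continuous_pnt: "continuous_map (iter_top E (Suc n)) (iter_top E n) pnt"
  and continuous_dir: "continuous_map (iter_top E (Suc n)) (iter_top E n) dir"
  and continuous_par: "continuous_map (iter_top E (Suc n)) euclidean par"
proof -
  have *: "limitin (iter_top E n) pnt (pnt x) (nhdsin (iter_top E (Suc n)) x) \<and>
    limitin (iter_top E n) dir (dir x) (nhdsin (iter_top E (Suc n)) x) \<and> (par \<longlongrightarrow> par x) (nhdsin (iter_top E (Suc n)) x)"
    if x: "x \<in> Sp (Suc n)" for x
  proof -
    obtain y v t where e: "x = Node y v t" using x unfolding topspace_iter_Suc by blast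
    show ?thesis using limitin_nhdsin[OF x] unfolding e limitin_iter_Suc by simp
  qed
  show "continuous_map (iter_top E (Suc n)) (iter_top E n) pnt"
    "continuous_map (iter_top E (Suc n)) (iter_top E n) dir"
    "continuous_map (iter_top E (Suc n)) euclidean par"
    using * by (auto intro!: continuous_map_nhdsin simp del: iter_top.simps)
qed

lemma linmap_pnt: "linmap (Suc n) n pnt"
  unfolding linmap_def topspace_iter_Suc using continuous_pnt by auto

lemma linfun_par: "linfun (Suc n) par"
  unfolding linfun_def topspace_iter_Suc using continuous_par by auto

lemma linfun_comp: "linfun n c \<Longrightarrow> linfun (Suc n) (\<lambda>N. c (pnt N))" "linfun n c \<Longrightarrow> linfun (Suc n) (\<lambda>N. c (dir N))"
  unfolding linfun_def topspace_iter_Suc 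
  using continuous_map_compose[OF continuous_pnt, of n euclidean c] continuous_map_compose[OF continuous_dir, of n euclidean c]
  by (auto simp: comp_def)

lemma linmap_node: 
  assumes p: "linmap n m \<phi>" shows "linmap (Suc n) (Suc m) (\<lambda>N. Node (\<phi> (pnt N)) (\<phi> (dir N)) (par N))"
  unfolding linmap_def
proof
  show "\<forall>x\<in>Sp (Suc n). \<forall>v\<in>Sp (Suc n). \<forall>t. Node (\<phi> (pnt (step x t v))) (\<phi> (dir (step x t v))) (par (step x t v)) =
    step (Node (\<phi> (pnt x)) (\<phi> (dir x)) (par x)) t (Node (\<phi> (pnt v)) (\<phi> (dir v)) (par v))"
    using p unfolding topspace_iter_Suc linmap_def by auto
  have c: "continuous_map (iter_top E n) (iter_top E m) \<phi>" using p by (simp add: linmap_def)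
  show "continuous_map (iter_top E (Suc n)) (iter_top E (Suc m)) (\<lambda>N. Node (\<phi> (pnt N)) (\<phi> (dir N)) (par N))"
  proof (rule continuous_map_nhdsin)
    fix x assume x: "x \<in> Sp (Suc n)"
    note l = limitin_nhdsin[OF x]
    show "limitin (iter_top E (Suc m)) (\<lambda>N. Node (\<phi> (pnt N)) (\<phi> (dir N)) (par N)) (Node (\<phi> (pnt x)) (\<phi> (dir x)) (par x))
       (nhdsin (iter_top E (Suc n)) x)"
      unfolding limitin_iter_Suc
      using limitin_continuous_map_all[OF c limitin_continuous_map_all[OF continuous_pnt l]]
        limitin_continuous_map_all[OF c limitin_continuous_map_all[OF continuous_dir l]]
        limitin_continuous_map_all[OF continuous_par l] by simp
  qed
qed

lemma openin_quot_dom: 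
  assumes U: "openin (iter_top E n) U" shows "openin (iter_top E (Suc n)) (quot_dom E n U)"
  unfolding openin_nhdsin
proof (intro conjI ballI)
  have sub: "U \<subseteq> Sp n" using openin_subset[OF U] .
  show "quot_dom E n U \<subseteq> Sp (Suc n)" using quot_dom_sub[OF sub] .
  fix N assume N: "N \<in> quot_dom E n U"
  then have NS: "N \<in> Sp (Suc n)" using quot_dom_sub[OF sub] by blast
  note l = limitin_nhdsin[OF NS]
  note lp = limitin_continuous_map_all[OF continuous_pnt l] and ld = limitin_continuous_map_all[OF continuous_dir l]
    and lt = limitin_continuous_map_all[OF continuous_par l, unfolded limitin_canonical_iff]
  have ls: "limitin (iter_top E n) shift (shift N) (nhdsin (iter_top E (Suc n)) N)"
    using limitin_step[OF lp lt ld] unfolding shift_def[abs_def] .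
  have "\<forall>\<^sub>F y in nhdsin (iter_top E (Suc n)) N. y \<in> Sp (Suc n)" using limitinD[OF l openin_topspace NS] .
  moreover have "\<forall>\<^sub>F y in nhdsin (iter_top E (Suc n)) N. pnt y \<in> U" by (rule limitinD[OF lp U quot_domD(1)[OF N]])
  moreover have "\<forall>\<^sub>F y in nhdsin (iter_top E (Suc n)) N. shift y \<in> U" by (rule limitinD[OF ls U quot_domD(3)[OF N]])
  ultimately show "\<forall>\<^sub>F y in nhdsin (iter_top E (Suc n)) N. y \<in> quot_dom E n U"
    unfolding topspace_iter_Suc by eventually_elim (auto simp: quot_dom_def)
qed

lemma limitin_leaf: "limitin (iter_top E 0) s x F \<Longrightarrow> limitin (mod_top E) (\<lambda>i. leaf (s i)) (leaf x) F"
proof -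
  assume l: "limitin (iter_top E 0) s x F"
  obtain a where "x = Leaf a" using limitin_topspace[OF l] unfolding topspace_iter_0 by blast
  then show ?thesis using l by (simp add: limitin_iter_0 del: iter_top.simps)
qed

end

subsection \<open>\<open>C\<^sup>k\<close> functions with values in the Lie algebra\<close>

locale C1_calculus = C1_setting L + iterated E
  for L :: "('k::topological_comm_ring_1, 'g::ab_group_add) jts" 
    and E :: "('k, 'e::ab_group_add) tmodule"
begin

text \<open>Continuity at all points of \<open>U\<close>.  The index type of the filters is large enough to carry a point of
  the domain together with an argument from \<open>V\<close>.\<close>

definition gcont :: "nat \<Rightarrow> ('k, 'e) iter set \<Rightarrow> (('k, 'e) iter \<Rightarrow> 'g) \<Rightarrow> bool" where
  "gcont n U f \<longleftrightarrow> (\<forall>(F :: (('k, 'e) iter \<times> 'g) filter) s x.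
     limitin (subtopology (iter_top E n) U) s x F \<longrightarrow> glim (\<lambda>i. f (s i)) (f x) F)"

lemma gcontD:
  fixes s :: "'i \<Rightarrow> ('k, 'e) iter" and G :: "'i filter"
  assumes f: "gcont n U f" and s: "limitin (subtopology (iter_top E n) U) s x G"
  shows "glim (\<lambda>i. f (s i)) (f x) G"
proof -
  have lift: "limitin (subtopology (iter_top E n) U) fst x (filtermap (\<lambda>i. (s i, v i)) G)" for v :: "'i \<Rightarrow> 'g"
    using s by (simp add: limitin_def eventually_filtermap)
  have g: "glim (\<lambda>j. f (fst j)) (f x) (filtermap (\<lambda>i. (s i, v i)) G)" for v :: "'i \<Rightarrow> 'g"
    by (rule f[unfolded gcont_def, rule_format, OF lift])
  have "hlim (\<lambda>i. h (s i)) (h x) G" 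
    if h: "\<And>v :: 'i \<Rightarrow> 'g. hlim (\<lambda>j. h (fst j)) (h x) (filtermap (\<lambda>i. (s i, v i)) G)" for h :: "('k, 'e) iter \<Rightarrow> 'g"
    unfolding hlim_def
  proof (intro conjI allI impI)
    show "vlim (\<lambda>i. p1 (h (s i))) (p1 (h x)) G"
      using h[of "\<lambda>_. 0"] by (simp add: hlim_def limitin_def eventually_filtermap)
    fix v v0 assume v: "vlim v v0 G"
    have "vlim snd v0 (filtermap (\<lambda>i. (s i, v i)) G)" using v by (simp add: limitin_def eventually_filtermap)
    then have "vlim (\<lambda>j. p0 (h (fst j)) \<star> snd j) (p0 (h x) \<star> v0) (filtermap (\<lambda>i. (s i, v i)) G)"
      by (rule h[of v, unfolded hlim_def, THEN conjunct2, rule_format])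
    then show "vlim (\<lambda>i. p0 (h (s i)) \<star> v i) (p0 (h x) \<star> v0) G"
      by (simp add: limitin_def eventually_filtermap)
  qed
  from this[of f] this[of "\<lambda>y. \<theta> (f y)"] show ?thesis using g by (simp add: glim_def)
qed

lemma gcontI:
  assumes "\<And>(F :: (('k, 'e) iter \<times> 'g) filter) s x. x \<in> U \<Longrightarrow> \<forall>\<^sub>F i in F. s i \<in> U \<Longrightarrow> 
      limitin (subtopology (iter_top E n) U) s x F \<Longrightarrow> glim (\<lambda>i. f (s i)) (f x) F"
  shows "gcont n U f"
  unfolding gcont_def using assms by (auto simp: limitin_subtopology)

text \<open>The analogue of \<open>Ck_on\<close> for this notion of continuity.\<close>

primrec nC :: "nat \<Rightarrow> nat \<Rightarrow> ('k, 'e) iter set \<Rightarrow> (('k, 'e) iter \<Rightarrow> 'g) \<Rightarrow> bool" where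
  "nC 0 n U f \<longleftrightarrow> gcont n U f"
| "nC (Suc k) n U f \<longleftrightarrow> gcont n U f \<and> (\<exists>f1. isq n U (smul L) f f1 \<and> nC k (Suc n) (quot_dom E n U) f1)"

abbreviation isq' :: "nat \<Rightarrow> ('k, 'e) iter set \<Rightarrow> (('k, 'e) iter \<Rightarrow> 'g) \<Rightarrow> (('k, 'e) iter \<Rightarrow> 'g) \<Rightarrow> bool" where
  "isq' n U \<equiv> isq n U (smul L)"

lemma nC_gcont: "nC k n U f \<Longrightarrow> gcont n U f" by (cases k) auto

lemma nC_lower: "nC (Suc k) n U f \<Longrightarrow> nC k n U f"
proof (induction k arbitrary: n U f)
  case (Suc k)
  then obtain f1 where "isq' n U f f1" "nC (Suc k) (Suc n) (quot_dom E n U) f1" "gcont n U f" by auto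
  moreover from Suc.IH[OF this(2)] have "nC k (Suc n) (quot_dom E n U) f1" .
  ultimately show ?case by auto
qed simp

lemma nC_cong: 
  assumes "nC k n U f" "\<And>x. x \<in> U \<Longrightarrow> f x = h x" shows "nC k n U h"
proof -
  have c: "gcont n U h" if "gcont n U f"
  proof (rule gcontI)
    fix F :: "(('k, 'e) iter \<times> 'g) filter" and s x
    assume a: "x \<in> U" "\<forall>\<^sub>F i in F. s i \<in> U" "limitin (subtopology (iter_top E n) U) s x F"
    have "\<forall>\<^sub>F i in F. f (s i) = h (s i)" using a(2) by eventually_elim (rule assms(2))
    from glim_cong[OF this gcontD[OF that a(3)]] show "glim (\<lambda>i. h (s i)) (h x) F" 
      using assms(2)[OF a(1)] by simp
  qed
  have q: "isq' n U h f1" if "isq' n U f f1" for f1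
    using that assms(2) unfolding isq_def by (metis quot_domD(1,3))
  show ?thesis using assms(1) c q by (cases k) auto
qed

lemma nC_map:
  assumes l: "\<And>F f a. glim f a (F :: (('k, 'e) iter \<times> 'g) filter) \<Longrightarrow> glim (\<lambda>i. T (f i)) (T a) F"
    and T: "\<And>x y. T (x + y) = T x + T y" "\<And>t x. T (t \<cdot> x) = t \<cdot> T x"
  shows "nC k n U f \<Longrightarrow> nC k n U (\<lambda>x. T (f x))"
proof (induction k arbitrary: n U f)
  case 0 then show ?case by (auto intro!: gcontI l dest: gcontD)
next
  case (Suc k)
  then obtain f1 where f1: "isq' n U f f1" "nC k (Suc n) (quot_dom E n U) f1" by auto
  have "isq' n U (\<lambda>x. T (f x)) (\<lambda>x. T (f1 x))" using f1 by (simp add: isq_def T)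
  moreover have "gcont n U (\<lambda>x. T (f x))" using Suc(2) by (auto intro!: gcontI l dest: gcontD)
  ultimately show ?case using Suc.IH[OF f1(2)] by auto
qed

lemma nC_p1: "nC k n U f \<Longrightarrow> nC k n U (\<lambda>x. p1 (f x))"
  by (rule nC_map[of p1]) (simp_all add: glim_p1)
lemma nC_minus: "nC k n U f \<Longrightarrow> nC k n U (\<lambda>x. - f x)"
  by (rule nC_map[of uminus]) (simp_all add: glim_minus)
lemma nC_half: "nC k n U f \<Longrightarrow> nC k n U (\<lambda>x. half \<cdot> f x)"
  by (rule nC_map[of "\<lambda>x. half \<cdot> x"]) (simp_all add: glim_scale[OF tendsto_const] scale_right_distrib mult.commute)

lemma nC_add: "nC k n U f \<Longrightarrow> nC k n U h \<Longrightarrow> nC k n U (\<lambda>x. f x + h x)"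
proof (induction k arbitrary: n U f h)
  case 0 then show ?case by (auto intro!: gcontI glim_add dest: gcontD)
next
  case (Suc k)
  then obtain f1 h1 where f1: "isq' n U f f1" "nC k (Suc n) (quot_dom E n U) f1"
    and h1: "isq' n U h h1" "nC k (Suc n) (quot_dom E n U) h1" by auto
  have "isq' n U (\<lambda>x. f x + h x) (\<lambda>x. f1 x + h1 x)" using f1 h1 by (simp add: isq_def scale_right_distrib algebra_simps)
  moreover have "gcont n U (\<lambda>x. f x + h x)" using Suc(2,3) by (auto intro!: gcontI glim_add dest: gcontD)
  ultimately show ?case using Suc.IH[OF f1(2) h1(2)] by auto
qed

lemma gcont_const: "celem c \<Longrightarrow> gcont n U (\<lambda>_. c)" by (auto intro!: gcontI glim_const)

lemma celem_zero: "celem 0" using celem_gr(1)[of 0] by simp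

lemma nC_const: "celem c \<Longrightarrow> nC k n U (\<lambda>_. c)"
proof (induction k arbitrary: n U c)
  case (Suc k)
  have "isq' n U (\<lambda>_. c) (\<lambda>_. 0)" by (simp add: isq_def)
  then show ?case using Suc.IH[OF celem_zero] Suc.prems gcont_const by auto
qed (simp add: gcont_const)

lemma limitin_sub: "limitin (subtopology (iter_top E n) U) s x F \<Longrightarrow> limitin (iter_top E n) s x F"
  by (simp add: limitin_subtopology)

lemma nC_linear:
  assumes "\<And>x v t. x \<in> Sp n \<Longrightarrow> v \<in> Sp n \<Longrightarrow> a (step x t v) = a x + t \<cdot> a v"
    and "\<And>(F :: (('k, 'e) iter \<times> 'g) filter) s x. limitin (iter_top E n) s x F \<Longrightarrow> glim (\<lambda>i. a (s i)) (a x) F"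
    and "U \<subseteq> Sp n"
  shows "nC k n U a"
  using assms
proof (induction k arbitrary: n U a)
  case 0 then show ?case by (auto intro!: gcontI dest: limitin_sub)
next
  case (Suc k)
  have "isq' n U a (\<lambda>N. a (dir N))" unfolding isq_def
    using Suc.prems(1,3) by (auto simp: quot_dom_def subset_iff)
  moreover have "nC k (Suc n) (quot_dom E n U) (\<lambda>N. a (dir N))"
  proof (rule Suc.IH[OF _ _ quot_dom_sub[OF Suc.prems(3)]])
    fix x v t assume "x \<in> Sp (Suc n)" "v \<in> Sp (Suc n)"
    then show "a (dir (step x t v)) = a (dir x) + t \<cdot> a (dir v)"
      unfolding topspace_iter_Suc using Suc.prems(1) by auto
  next
    fix F :: "(('k, 'e) iter \<times> 'g) filter" and s x assume "limitin (iter_top E (Suc n)) s x F"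
    from Suc.prems(2)[OF limitin_continuous_map_all[OF continuous_dir this]]
    show "glim (\<lambda>i. a (dir (s i))) (a (dir x)) F" .
  qed
  moreover have "gcont n U a" using Suc.prems(2) by (auto intro!: gcontI dest: limitin_sub)
  ultimately show ?case by auto
qed

text \<open>The chain rule for linear maps: \<open>\<phi>\<close> extends to the next space by acting on point and direction.\<close>

lemma nC_linmap:
  assumes "nC k m U f" "linmap n m \<phi>" "U' \<subseteq> Sp n" "\<And>x. x \<in> U' \<Longrightarrow> \<phi> x \<in> U"
  shows "nC k n U' (\<lambda>x. f (\<phi> x))"
  using assms
proof (induction k arbitrary: n m U U' \<phi> f)
  case (0 n m U U' \<phi> f)
  have c: "continuous_map (iter_top E n) (iter_top E m) \<phi>" using 0(2) by (simp add: linmap_def)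
  show ?case unfolding nC.simps
  proof (rule gcontI)
    fix F :: "(('k, 'e) iter \<times> 'g) filter" and s x
    assume a: "x \<in> U'" "\<forall>\<^sub>F i in F. s i \<in> U'" "limitin (subtopology (iter_top E n) U') s x F"
    have "\<forall>\<^sub>F i in F. \<phi> (s i) \<in> U" using a(2) by eventually_elim (rule 0(4))
    then have "limitin (subtopology (iter_top E m) U) (\<lambda>i. \<phi> (s i)) (\<phi> x) F"
      using limitin_continuous_map_all[OF c limitin_sub[OF a(3)]] 0(4)[OF a(1)] by (simp add: limitin_subtopology)
    then show "glim (\<lambda>i. f (\<phi> (s i))) (f (\<phi> x)) F" using gcontD 0(1) by fastforce
  qed
next
  case (Suc k n m U U' \<phi> f)
  have c: "continuous_map (iter_top E n) (iter_top E m) \<phi>" using Suc.prems(2) by (simp add: linmap_def)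
  have sp: "\<phi> v \<in> Sp m" if "v \<in> Sp n" for v using c that by (auto simp: continuous_map_def)
  have l: "\<phi> (step x t v) = step (\<phi> x) t (\<phi> v)" if "x \<in> Sp n" "v \<in> Sp n" for x v t
    using Suc.prems(2) that by (simp add: linmap_def)
  obtain f1 where f1: "isq' m U f f1" "nC k (Suc m) (quot_dom E m U) f1" and g: "gcont m U f" using Suc.prems by auto
  let ?\<phi> = "\<lambda>N. Node (\<phi> (pnt N)) (\<phi> (dir N)) (par N)"
  have q: "?\<phi> N \<in> quot_dom E m U" if N: "N \<in> quot_dom E n U'" for N
    using N Suc.prems(3,4) sp l unfolding quot_dom_def by (auto simp: subset_iff) metis
  have "isq' n U' (\<lambda>x. f (\<phi> x)) (\<lambda>N. f1 (?\<phi> N))" unfolding isq_def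
  proof
    fix N assume N: "N \<in> quot_dom E n U'"
    have "shift (?\<phi> N) = \<phi> (shift N)"
      using l[of "pnt N" "dir N" "par N"] quot_domD(1,2)[OF N] Suc.prems(3) by (auto simp: shift_def)
    then show "f (\<phi> (shift N)) = f (\<phi> (pnt N)) + par N \<cdot> f1 (?\<phi> N)"
      using f1(1) q[OF N] unfolding isq_def by (metis iter.sel(2,4))
  qed
  moreover have "nC k (Suc n) (quot_dom E n U') (\<lambda>N. f1 (?\<phi> N))"
    by (rule Suc.IH[OF f1(2) linmap_node[OF Suc.prems(2)] quot_dom_sub[OF Suc.prems(3)] q])
  moreover have "gcont n U' (\<lambda>x. f (\<phi> x))"
  proof (rule gcontI)
    fix F :: "(('k, 'e) iter \<times> 'g) filter" and s x
    assume a: "x \<in> U'" "\<forall>\<^sub>F i in F. s i \<in> U'" "limitin (subtopology (iter_top E n) U') s x F"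
    have "\<forall>\<^sub>F i in F. \<phi> (s i) \<in> U" using a(2) by eventually_elim (rule Suc.prems(4))
    then have "limitin (subtopology (iter_top E m) U) (\<lambda>i. \<phi> (s i)) (\<phi> x) F"
      using limitin_continuous_map_all[OF c limitin_sub[OF a(3)]] Suc.prems(4)[OF a(1)] by (simp add: limitin_subtopology)
    then show "glim (\<lambda>i. f (\<phi> (s i))) (f (\<phi> x)) F" using gcontD[OF g] by blast
  qed
  ultimately show ?case by auto
qed

lemma nC_pnt: "nC k n U f \<Longrightarrow> U \<subseteq> Sp n \<Longrightarrow> nC k (Suc n) (quot_dom E n U) (\<lambda>N. f (pnt N))"
  by (rule nC_linmap[OF _ linmap_pnt quot_dom_sub]) (auto dest: quot_domD)

lemma gcont_scale:
  assumes c: "linfun n c" and f: "gcont n U f" shows "gcont n U (\<lambda>x. c x \<cdot> f x)"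
proof (rule gcontI)
  fix F :: "(('k, 'e) iter \<times> 'g) filter" and s x
  assume a: "x \<in> U" "\<forall>\<^sub>F i in F. s i \<in> U" "limitin (subtopology (iter_top E n) U) s x F"
  have "((\<lambda>i. c (s i)) \<longlongrightarrow> c x) F"
    using limitin_continuous_map_all[of "iter_top E n" euclidean c] c limitin_sub[OF a(3)] by (simp add: linfun_def)
  then show "glim (\<lambda>i. c (s i) \<cdot> f (s i)) (c x \<cdot> f x) F" using gcontD[OF f a(3)] by (rule glim_scale)
qed

lemma shift_eq: "isq' n U f f1 \<Longrightarrow> N \<in> quot_dom E n U \<Longrightarrow> f (shift N) = f (pnt N) + par N \<cdot> f1 N"
  by (simp add: isq_def)

lemma nC_scale:
  "linfun n c \<Longrightarrow> nC k n U f \<Longrightarrow> U \<subseteq> Sp n \<Longrightarrow> nC k n U (\<lambda>x. c x \<cdot> f x)"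
proof (induction k arbitrary: n U f c)
  case 0 then show ?case by (simp add: gcont_scale)
next
  case (Suc k)
  then obtain f1 where f1: "isq' n U f f1" "nC k (Suc n) (quot_dom E n U) f1" by auto
  note sub = quot_dom_sub[OF Suc.prems(3)]
  let ?h = "\<lambda>N. c (dir N) \<cdot> (f (pnt N) + par N \<cdot> f1 N) + c (pnt N) \<cdot> f1 N"
  have c: "c (shift N) = c (pnt N) + par N * c (dir N)" if "N \<in> quot_dom E n U" for N
    using Suc.prems(1,3) quot_domD(1,2)[OF that] unfolding linfun_def shift_def by blast
  have "isq' n U (\<lambda>x. c x \<cdot> f x) ?h" unfolding isq_def
    by (simp add: shift_eq[OF f1(1)] c algebra_simps)
  moreover have "nC k (Suc n) (quot_dom E n U) ?h"
    using nC_pnt[OF nC_lower[OF Suc.prems(2)] Suc.prems(3)] linfun_comp[OF Suc.prems(1)] linfun_par f1(2) sub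
    by (intro nC_add Suc.IH) auto
  moreover have "gcont n U (\<lambda>x. c x \<cdot> f x)" using Suc.prems(1,2) by (auto intro: gcont_scale)
  ultimately show ?case by auto
qed

text \<open>The map sending \<open>(x, v, t)\<close> to \<open>x + tv\<close> is not linear; its composition with \<open>f\<close> is \<open>C\<^sup>k\<close> as it equals \<open>f x + t f1 (x, v, t)\<close>.\<close>

lemma nC_shift_quot:
  assumes f: "nC k n U f" and f1: "isq' n U f f1" "nC k (Suc n) (quot_dom E n U) f1" and U: "U \<subseteq> Sp n"
  shows "nC k (Suc n) (quot_dom E n U) (\<lambda>N. f (shift N))"
proof (rule nC_cong)
  show "nC k (Suc n) (quot_dom E n U) (\<lambda>N. f (pnt N) + par N \<cdot> f1 N)"
    by (rule nC_add[OF nC_pnt[OF f U] nC_scale[OF linfun_par f1(2) quot_dom_sub[OF U]]])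
qed (simp add: shift_eq[OF f1(1)])

lemma nC_br: "nC k n U f \<Longrightarrow> nC k n U h \<Longrightarrow> U \<subseteq> Sp n \<Longrightarrow> nC k n U (\<lambda>x. f x \<star> h x)"
proof (induction k arbitrary: n U f h)
  case 0 then show ?case by (auto intro!: gcontI glim_br dest: gcontD)
next
  case (Suc k)
  then obtain f1 h1 where f1: "isq' n U f f1" "nC k (Suc n) (quot_dom E n U) f1"
    and h1: "isq' n U h h1" "nC k (Suc n) (quot_dom E n U) h1" by auto
  note U = Suc.prems(3) and lf = nC_lower[OF Suc.prems(1)] and lh = nC_lower[OF Suc.prems(2)]
  let ?q = "\<lambda>N. f1 N \<star> h (pnt N) + f (shift N) \<star> h1 N"
  have "isq' n U (\<lambda>x. f x \<star> h x) ?q" unfolding isq_def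
    by (simp add: shift_eq[OF f1(1)] shift_eq[OF h1(1)] lin algebra_simps)
  moreover have "nC k (Suc n) (quot_dom E n U) ?q"
    by (intro nC_add Suc.IH f1(2) h1(2) nC_pnt[OF lh U] nC_shift_quot[OF lf f1 U] quot_dom_sub[OF U])
  moreover have "gcont n U (\<lambda>x. f x \<star> h x)"
    using nC_gcont[OF Suc.prems(1)] nC_gcont[OF Suc.prems(2)] by (auto intro!: gcontI glim_br dest: gcontD)
  ultimately show ?case by auto
qed

lemma nC_ex: "nC k n U f \<Longrightarrow> nC k n U h \<Longrightarrow> U \<subseteq> Sp n \<Longrightarrow> nC k n U (\<lambda>x. ex (f x) (h x))"
  unfolding exp_ad_def by (intro nC_add nC_half nC_br) auto

lemma nC_W: "\<forall>a\<in>set l. nC k n U a \<Longrightarrow> nC k n U y \<Longrightarrow> U \<subseteq> Sp n \<Longrightarrow> 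
    nC k n U (\<lambda>x. W (map (\<lambda>a. a x) l) (y x))"
  by (induction l) (auto intro: nC_ex)

lemma nC_Dq:
  assumes U: "U \<subseteq> Sp n" and y: "nC k n U y"
  shows "\<forall>q\<in>set l. nC k n U (fst q) \<and> nC k n U (fst (snd q)) \<and> nC k n U (snd (snd q)) \<Longrightarrow>
    nC k n U (\<lambda>x. Dq (map (\<lambda>q. (fst q x, fst (snd q) x, snd (snd q) x)) l) (y x))"
proof (induction l)
  case Nil show ?case using nC_const[OF celem_zero] by simp
next
  case (Cons q l)
  obtain a a' d where q: "q = (a, a', d)" by (cases q)
  have w: "nC k n U (\<lambda>x. W (map (\<lambda>q. fst (snd q) x) l) (y x))"
    using nC_W[of "map (\<lambda>q. fst (snd q)) l" k n U y] Cons.prems y U by (simp add: comp_def)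
  have "nC k n U a" "nC k n U a'" "nC k n U d" using Cons.prems by (auto simp: q)
  then show ?case using w Cons U unfolding q
    by (simp add: comp_def) (intro nC_add nC_half nC_br nC_ex U; simp)
qed

text \<open>One differentiation step for the coordinate \<open>z\<close> of a family of points \<open>F(s).o\<^sup>+\<close>, where \<open>F\<close> is a word
  with letters \<open>a\<close> and \<open>d\<close> is the difference quotient of \<open>a\<close>.\<close>

definition zq :: "((('k, 'e) iter \<Rightarrow> 'g) \<times> (('k, 'e) iter \<Rightarrow> 'g)) list \<Rightarrow> (('k, 'e) iter \<Rightarrow> 'g) \<Rightarrow> ('k, 'e) iter \<Rightarrow> 'g" where
  "zq l z N = quot (map (\<lambda>q. (fst q (pnt N), fst q (shift N), snd q N)) l) (z (pnt N)) (z (shift N))"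

abbreviation signed :: "('k, 'e) iter set \<Rightarrow> (('k, 'e) iter \<Rightarrow> 'g) \<Rightarrow> bool" where
  "signed U a \<equiv> (\<forall>s\<in>U. a s \<in> g1) \<or> (\<forall>s\<in>U. a s \<in> gm)"

abbreviation coordinate :: "('k, 'e) iter set \<Rightarrow> (('k, 'e) iter \<Rightarrow> 'g) list \<Rightarrow> (('k, 'e) iter \<Rightarrow> 'g) \<Rightarrow> bool" where
  "coordinate U l z \<equiv> \<forall>s\<in>U. z s \<in> g1 \<and> act (W (map (\<lambda>a. a s) l)) base = embed_V L (z s)"

lemma zq_step:
  assumes l: "\<forall>q\<in>set l. signed U (fst q) \<and> isq' n U (fst q) (snd q)" and z: "coordinate U (map fst l) z"
  shows "isq' n U z (zq l z)"
  unfolding isq_def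
proof
  fix N assume N: "N \<in> quot_dom E n U"
  note m = quot_domD(1,3)[OF N]
  show "z (shift N) = z (pnt N) + par N \<cdot> zq l z N" unfolding zq_def
  proof (rule quot)
    let ?l = "map (\<lambda>q. (fst q (pnt N), fst q (shift N), snd q N)) l"
    show "word (map fst ?l)" "word (map (\<lambda>q. fst (snd q)) ?l)" using l m by auto
    show "\<forall>q\<in>set ?l. fst (snd q) = fst q + par N \<cdot> snd (snd q)" using l N by (auto simp: isq_def)
    show "z (pnt N) \<in> g1" "z (shift N) \<in> g1" "act (W (map fst ?l)) base = embed_V L (z (pnt N))"
      "act (W (map (\<lambda>q. fst (snd q)) ?l)) base = embed_V L (z (shift N))"
      using z m by (simp_all add: comp_def)
  qed
qed

lemma nC_zq:
  assumes U: "U \<subseteq> Sp n" 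
    and l: "\<forall>q\<in>set l. nC k n U (fst q) \<and> isq' n U (fst q) (snd q) \<and> nC k (Suc n) (quot_dom E n U) (snd q)"
    and z: "nC k (Suc n) (quot_dom E n U) (\<lambda>N. z (pnt N))" "nC k (Suc n) (quot_dom E n U) (\<lambda>N. z (shift N))"
  shows "nC k (Suc n) (quot_dom E n U) (zq l z)"
proof -
  let ?U = "quot_dom E n U"
  note U' = quot_dom_sub[OF U]
  have a: "nC k (Suc n) ?U (\<lambda>N. fst q (pnt N))" "nC k (Suc n) ?U (\<lambda>N. fst q (shift N))" "nC k (Suc n) ?U (snd q)"
    if "q \<in> set l" for q
    using l that nC_pnt[OF _ U] nC_shift_quot[OF _ _ _ U] by blast+
  have y: "nC k (Suc n) ?U (\<lambda>N. W (rev (map (\<lambda>q. - fst q (pnt N)) l)) (ex (z (pnt N)) euler))"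
    using nC_W[of "rev (map (\<lambda>q N. - fst q (pnt N)) l)" k "Suc n" ?U "\<lambda>N. ex (z (pnt N)) euler"] 
      nC_minus[OF a(1)] nC_ex[OF z(1) nC_const[OF celem_euler] U'] U'
    by (simp add: comp_def rev_map)
  have "nC k (Suc n) ?U (\<lambda>N. Dq (map (\<lambda>q. (fst q (pnt N), fst q (shift N), snd q N)) l) 
      (W (rev (map (\<lambda>q. - fst q (pnt N)) l)) (ex (z (pnt N)) euler)))"
    using nC_Dq[OF U' y, of "map (\<lambda>q. (\<lambda>N. fst q (pnt N), \<lambda>N. fst q (shift N), snd q)) l"] a
    by (simp add: comp_def)
  from nC_minus[OF nC_p1[OF nC_ex[OF nC_minus[OF z(2)] this U']]]
  show ?thesis unfolding zq_def[abs_def] quot_def by (simp add: comp_def)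
qed

text \<open>Continuity of \<open>z\<close> is the continuity of the action on points; all higher differentiability follows by the
  formula for the difference quotient, in which \<open>z\<close> itself occurs at the points \<open>x\<close> and \<open>x + tv\<close>.  The formula has to hold
  on the whole domain: for non-invertible \<open>t\<close>, the divisibility of \<open>z(x + tv) - z(x)\<close> by \<open>t\<close> relates distant points, so being
  \<open>C\<^sup>1\<close> cannot be checked locally.\<close>

lemma nC_coordinate:
  "U \<subseteq> Sp n \<Longrightarrow> \<forall>a\<in>set l. nC k n U a \<and> signed U a \<Longrightarrow> coordinate U l z \<Longrightarrow> nC k n U z"
proof (induction k arbitrary: n U l z)
  have cont: "gcont n U z" if U: "U \<subseteq> Sp n" and l: "\<forall>a\<in>set l. gcont n U a \<and> signed U a" and z: "coordinate U l z" for n U l z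
  proof (rule gcontI)
    fix F :: "(('k, 'e) iter \<times> 'g) filter" and s x
    assume a: "x \<in> U" "\<forall>\<^sub>F i in F. s i \<in> U" "limitin (subtopology (iter_top E n) U) s x F"
    let ?l = "map (\<lambda>a. (\<lambda>i. a (s i), a x)) l"
    have "\<forall>q\<in>set ?l. glim (fst q) (snd q) F \<and> 
       (snd q \<in> g1 \<and> (\<forall>\<^sub>F i in F. fst q i \<in> g1) \<or> snd q \<in> gm \<and> (\<forall>\<^sub>F i in F. fst q i \<in> gm))"
    proof
      fix q assume "q \<in> set ?l"
      then obtain b where b: "b \<in> set l" "q = (\<lambda>i. b (s i), b x)" by auto
      have "glim (\<lambda>i. b (s i)) (b x) F" using l b a(3) gcontD by blast
      moreover have "b x \<in> g1 \<and> (\<forall>\<^sub>F i in F. b (s i) \<in> g1) \<or> b x \<in> gm \<and> (\<forall>\<^sub>F i in F. b (s i) \<in> gm)"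
      proof (cases "\<forall>s\<in>U. b s \<in> g1")
        case True
        then have "\<forall>\<^sub>F i in F. b (s i) \<in> g1" using a(2) by (auto elim: eventually_mono)
        then show ?thesis using True a(1) by blast
      next
        case False
        then have m: "\<forall>s\<in>U. b s \<in> gm" using l b by blast
        then have "\<forall>\<^sub>F i in F. b (s i) \<in> gm" using a(2) by (auto elim: eventually_mono)
        then show ?thesis using m a(1) by blast
      qed
      ultimately show "glim (fst q) (snd q) F \<and> 
       (snd q \<in> g1 \<and> (\<forall>\<^sub>F i in F. fst q i \<in> g1) \<or> snd q \<in> gm \<and> (\<forall>\<^sub>F i in F. fst q i \<in> gm))" by (simp add: b)
    qed
    moreover have "z x \<in> g1" "act (W (map snd ?l)) base = embed_V L (z x)" using z a(1) by (simp_all add: comp_def)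
    ultimately obtain z' where z': "vlim z' (z x) F" 
      "\<forall>\<^sub>F i in F. act (W (map (\<lambda>q. fst q i) ?l)) base = embed_V L (z' i)" by (rule word_limit)
    have "\<forall>\<^sub>F i in F. z' i = z (s i)" using z'(2) a(2) lim_in(2)[OF z'(1)]
    proof eventually_elim
      case (elim i)
      then have "embed_V L (z' i) = embed_V L (z (s i))" using z by (simp add: comp_def)
      then show ?case using elim z by (intro embed_inj) auto
    qed
    then show "glim (\<lambda>i. z (s i)) (z x) F" using glim_V[OF z'(1)] by (rule glim_cong)
  qed
  {
    case 0 then show ?case using cont[of U n l z] by simp
  next
    case (Suc k)
    note U = Suc.prems(1) and U' = quot_dom_sub[OF Suc.prems(1)]
    have "\<forall>a\<in>set l. \<exists>d. isq' n U a d \<and> nC k (Suc n) (quot_dom E n U) d" using Suc.prems(2) by auto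
    then obtain D where D: "\<And>a. a \<in> set l \<Longrightarrow> isq' n U a (D a) \<and> nC k (Suc n) (quot_dom E n U) (D a)" by metis
    have low: "nC k n U a" "signed U a" if "a \<in> set l" for a using Suc.prems(2) that nC_lower by blast+
    let ?l = "map (\<lambda>a. (a, D a)) l"
    have zn: "nC k n U z" by (rule Suc.IH[OF U _ Suc.prems(3)]) (use low in blast)
    have z1: "nC k (Suc n) (quot_dom E n U) (\<lambda>N. z (pnt N))" by (rule nC_pnt[OF zn U])
    have z2: "nC k (Suc n) (quot_dom E n U) (\<lambda>N. z (shift N))"
    proof (rule Suc.IH[OF U', of "map (\<lambda>a N. a (shift N)) l"])
      show "\<forall>a\<in>set (map (\<lambda>a N. a (shift N)) l). nC k (Suc n) (quot_dom E n U) a \<and> signed (quot_dom E n U) a"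
      proof
        fix b assume "b \<in> set (map (\<lambda>a N. a (shift N)) l)"
        then obtain a where a: "a \<in> set l" "b = (\<lambda>N. a (shift N))" by auto
        have "nC k (Suc n) (quot_dom E n U) b" unfolding a(2) using D[OF a(1)] nC_shift_quot[OF low(1)[OF a(1)] _ _ U] by blast
        moreover have "signed (quot_dom E n U) b" unfolding a(2) using low(2)[OF a(1)] quot_domD(3) by blast
        ultimately show "nC k (Suc n) (quot_dom E n U) b \<and> signed (quot_dom E n U) b" ..
      qed
      show "coordinate (quot_dom E n U) (map (\<lambda>a N. a (shift N)) l) (\<lambda>N. z (shift N))"
        using Suc.prems(3) quot_domD(3) by (simp add: comp_def)
    qed
    have "nC k (Suc n) (quot_dom E n U) (zq ?l z)"
      by (rule nC_zq[OF U _ z1 z2]) (use D low in auto)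
    moreover have "isq' n U z (zq ?l z)"
      by (rule zq_step) (use D low(2) Suc.prems(3) in \<open>auto simp: comp_def\<close>)
    moreover have "gcont n U z" by (rule nC_gcont[OF zn])
    ultimately show ?case by auto
  }
qed

text \<open>The derivative is the value at \<open>t = 0\<close> of the difference quotient.\<close>

lemma zq_zero:
  assumes "x \<in> U" "step x 0 v = x" "coordinate U (map fst l) z"
    and "\<forall>q\<in>set l. fst q x \<in> g1 \<and> snd q (Node x v 0) \<in> g1 \<or> fst q x \<in> gm \<and> snd q (Node x v 0) \<in> gm"
  shows "zq l z (Node x v 0) = p1 (ex (- z x) (lam (map (\<lambda>q. (fst q x, snd q (Node x v 0))) l)))"
  using quot_lam[of "map (\<lambda>q. (fst q x, snd q (Node x v 0))) l" "z x"] assms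
  by (simp add: zq_def comp_def)

subsection \<open>Smooth maps into \<open>V\<close>\<close>

lemma gcont_continuous:
  assumes f: "gcont n U f" and m: "\<And>s. s \<in> U \<Longrightarrow> f s \<in> g1" and U: "U \<subseteq> Sp n"
  shows "continuous_map (subtopology (iter_top E n) U) Vt f"
proof (rule continuous_map_nhdsin)
  fix x assume x: "x \<in> topspace (subtopology (iter_top E n) U)"
  note l = limitin_nhdsin[OF x]
  then have "\<forall>\<^sub>F y in nhdsin (subtopology (iter_top E n) U) x. y \<in> U" by (simp add: limitin_subtopology)
  then have "\<forall>\<^sub>F y in nhdsin (subtopology (iter_top E n) U) x. f y \<in> g1" by eventually_elim (rule m)
  then show "vlim f (f x) (nhdsin (subtopology (iter_top E n) U) x)"
    using gcontD[OF f l] m x by (intro lim_of_glim) auto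
qed

lemma isq_quotient_map:
  assumes q: "isq' n U f f1" and c: "gcont (Suc n) (quot_dom E n U) f1" and m: "\<And>s. s \<in> U \<Longrightarrow> f s \<in> g1" and U: "U \<subseteq> Sp n"
  shows "is_quotient_map E (V_module L) n U f (\<lambda>N. p1 (f1 N))"
  unfolding is_quotient_map_def
proof (intro conjI allI impI)
  have "gcont (Suc n) (quot_dom E n U) (\<lambda>N. p1 (f1 N))" using nC_p1[of 0 "Suc n"] c by simp
  then show "continuous_map (subtopology (iter_top E (Suc n)) (quot_dom E n U)) (mod_top (V_module L)) (\<lambda>N. p1 (f1 N))"
    using gcont_continuous[OF _ _ quot_dom_sub[OF U]] by simp
  fix x v t assume N: "Node x v t \<in> quot_dom E n U"
  then have "x \<in> U" "step x t v \<in> U" using quot_domD[OF N] by simp_all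
  then have "f x = p1 (f x)" "f (step x t v) = p1 (f (step x t v))" using m by (simp_all add: p_gr)
  moreover have "f (step x t v) = f x + t \<cdot> f1 (Node x v t)" using shift_eq[OF q N] by simp
  then have "p1 (f (step x t v)) = p1 (f x) + t \<cdot> p1 (f1 (Node x v t))" by simp
  ultimately show "f (step x t v) - f x = scal (V_module L) t (p1 (f1 (Node x v t)))" by simp
qed

lemma nC_Ck:
  "nC k n U f \<Longrightarrow> (\<And>s. s \<in> U \<Longrightarrow> f s \<in> g1) \<Longrightarrow> U \<subseteq> Sp n \<Longrightarrow> Ck_on E (V_module L) k n U f"
proof (induction k arbitrary: n U f)
  case 0 then show ?case using gcont_continuous by (simp add: V_sel)
next
  case (Suc k)
  then obtain f1 where f1: "isq' n U f f1" "nC k (Suc n) (quot_dom E n U) f1" and c: "gcont n U f" by auto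
  have "Ck_on E (V_module L) k (Suc n) (quot_dom E n U) (\<lambda>N. p1 (f1 N))"
    by (rule Suc.IH[OF nC_p1[OF f1(2)] _ quot_dom_sub[OF Suc.prems(3)]]) simp
  moreover have "is_quotient_map E (V_module L) n U f (\<lambda>N. p1 (f1 N))"
    by (rule isq_quotient_map[OF f1(1) nC_gcont[OF f1(2)] Suc.prems(2,3)])
  moreover have "continuous_map (subtopology (iter_top E n) U) Vt f"
    by (rule gcont_continuous[OF c Suc.prems(2,3)])
  ultimately show ?case by auto
qed

end

subsection \<open>Uniqueness of the differential\<close>

context iterated begin

lemma node_zero: 
  assumes "x \<in> carr E" "v \<in> carr E" shows "step (Leaf x) 0 (Leaf v) = Leaf x"
proof -
  interpret m: module "scal E" by (rule mod)
  show ?thesis by (simp add: m.scale_zero_left)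
qed

lemma openin_Leaf: "openin (mod_top E) U \<Longrightarrow> openin (iter_top E 0) (Leaf ` U)"
  unfolding iter_top.simps openin_pullback_topology by (intro exI[of _ U]) auto

lemma Leaf_sub: "openin (mod_top E) U \<Longrightarrow> Leaf ` U \<subseteq> Sp 0"
  using openin_subset unfolding topspace_iter_0 by blast

text \<open>For invertible \<open>t\<close> the difference quotient is determined by \<open>f\<close>.  Invertible elements accumulate at 0 and \<open>F\<close> is
  Hausdorff, so the value at \<open>t = 0\<close> is determined as well.\<close>

lemma quotient_unique:
  assumes R: "calculus_ring TYPE('k)" and F: "topological_module F"
    and g: "is_quotient_map E F 0 (Leaf ` U) f g" and h: "is_quotient_map E F 0 (Leaf ` U) f h"
    and U: "openin (mod_top E) U" and x: "x \<in> U" and v: "v \<in> carr E"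
  shows "g (Node (Leaf x) (Leaf v) 0) = h (Node (Leaf x) (Leaf v) 0)"
proof (rule ccontr)
  interpret m: module "scal F" using F by (simp add: topological_module_def)
  let ?P = "\<lambda>t. Node (Leaf x) (Leaf v) t" and ?Q = "quot_dom E 0 (Leaf ` U)"
  assume ne: "g (?P 0) \<noteq> h (?P 0)"
  have xE: "x \<in> carr E" using openin_subset[OF U] x by blast
  have o: "openin (iter_top E (Suc 0)) ?Q" by (rule openin_quot_dom[OF openin_Leaf[OF U]])
  have N0: "?P 0 \<in> ?Q" using x v node_zero[OF xE v] by (auto simp: quot_dom_def topspace_iter_0 simp del: iter_top.simps)
  have S: "Leaf x \<in> Sp 0" "Leaf v \<in> Sp 0" using xE v by (auto simp: topspace_iter_0 simp del: iter_top.simps)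
  have "limitin (iter_top E (Suc 0)) ?P (?P 0) (nhds 0)"
    unfolding limitin_iter_Suc using S by (simp add: filterlim_ident del: iter_top.simps)
  then have l: "limitin (subtopology (iter_top E (Suc 0)) ?Q) ?P (?P 0) (nhds 0)"
    unfolding limitin_subtopology using N0 limitinD[OF _ o N0] by blast
  have lg: "limitin (mod_top F) (\<lambda>t. g (?P t)) (g (?P 0)) (nhds 0)" "limitin (mod_top F) (\<lambda>t. h (?P t)) (h (?P 0)) (nhds 0)"
    using g h limitin_continuous_map_all[OF _ l] by (auto simp: is_quotient_map_def)
  have "Hausdorff_space (mod_top F)" using F by (simp add: topological_module_def)
  then obtain A B where AB: "openin (mod_top F) A" "openin (mod_top F) B" "g (?P 0) \<in> A" "h (?P 0) \<in> B" "disjnt A B"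
    using ne limitin_topspace[OF lg(1)] limitin_topspace[OF lg(2)] unfolding Hausdorff_space_def by blast
  have "\<forall>\<^sub>F t in nhds 0. g (?P t) \<in> A \<and> h (?P t) \<in> B \<and> ?P t \<in> ?Q"
    using limitinD[OF lg(1) AB(1,3)] limitinD[OF lg(2) AB(2,4)] l unfolding limitin_subtopology
    by (auto intro: eventually_conj)
  then obtain T where T: "open T" "0 \<in> T" "\<And>t. t \<in> T \<Longrightarrow> g (?P t) \<in> A \<and> h (?P t) \<in> B \<and> ?P t \<in> ?Q"
    by (auto simp: eventually_nhds)
  have "(0::'k) \<in> closure {u. u dvd 1}" using R by (simp add: calculus_ring_def)
  then have "{u. u dvd 1} \<inter> T \<noteq> {}" using open_Int_closure_eq_empty[OF T(1)] T(2) by blast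
  then obtain t where t: "t dvd 1" "t \<in> T" by blast
  then obtain w where w: "w * t = 1" by (metis dvdE mult.commute)
  have "scal F t (g (?P t)) = scal F t (h (?P t))"
    using g h T(3)[OF t(2)] unfolding is_quotient_map_def by metis
  then have "scal F w (scal F t (g (?P t))) = scal F w (scal F t (h (?P t)))" by simp
  then have "g (?P t) = h (?P t)" by (simp add: w)
  then show False using T(3)[OF t(2)] AB(5) by (auto simp: disjnt_def)
qed

lemma differential_unique:
  assumes "calculus_ring TYPE('k)" "topological_module F" "is_quotient_map E F 0 (Leaf ` U) (\<lambda>z. f (leaf z)) g" 
    "openin (mod_top E) U" "x \<in> U" "v \<in> carr E"
  shows "differential E F U f x v = g (Node (Leaf x) (Leaf v) 0)"
  unfolding differential_def
proof (rule the_equality)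
  fix w assume "\<exists>h. is_quotient_map E F 0 (Leaf ` U) (\<lambda>z. f (leaf z)) h \<and> w = h (Node (Leaf x) (Leaf v) 0)"
  then show "w = g (Node (Leaf x) (Leaf v) 0)" using quotient_unique[OF assms(1,2) _ assms(3-6)] by blast
qed (use assms(3) in blast)

end

lemma module_pairI: "module (scal E) \<Longrightarrow> module (scal F) \<Longrightarrow> module_prod (scal E) (scal F)"
  by (simp add: module_prod_def module_pair_def)

lemma topological_module_prod:
  fixes E :: "('k::topological_comm_ring_1, 'e::ab_group_add) tmodule" and F :: "('k, 'f::ab_group_add) tmodule"
  assumes E: "topological_module E" and F: "topological_module F"
  shows "topological_module (prod_module E F)"
proof -
  have mE: "module (scal E)" and mF: "module (scal F)" using E F by (auto simp: topological_module_def)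
  interpret p: module_prod "scal E" "scal F" using mE mF by (rule module_pairI)
  have sc: "scal (prod_module E F) t z = (scal E t (fst z), scal F t (snd z))" for t z
    by (cases z) (simp add: prod_module_def p.scale_prod)
  have tp: "mod_top (prod_module E F) = prod_topology (mod_top E) (mod_top F)" by (simp add: prod_module_def)
  interpret m: module "scal (prod_module E F)"
    by unfold_locales (simp_all add: sc module.scale_right_distrib[OF mE] module.scale_right_distrib[OF mF]
      module.scale_left_distrib[OF mE] module.scale_left_distrib[OF mF] module.scale_scale[OF mE] module.scale_scale[OF mF]
      module.scale_one[OF mE] module.scale_one[OF mF])
  have sE: "module.subspace (scal E) (carr E)" and sF: "module.subspace (scal F) (carr F)"
    using E F by (auto simp: topological_module_def)
  show ?thesis unfolding topological_module_def
  proof (intro conjI)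
    show "module (scal (prod_module E F))" by (rule m.module_axioms)
    show "module.subspace (scal (prod_module E F)) (carr (prod_module E F))"
      using sE sF by (auto simp: m.subspace_def module.subspace_def[OF mE] module.subspace_def[OF mF] sc tp zero_prod_def)
    show "Hausdorff_space (mod_top (prod_module E F))"
      using E F by (simp add: tp topological_module_def Hausdorff_space_prod_topology)
    show "continuous_map (prod_topology (mod_top (prod_module E F)) (mod_top (prod_module E F))) (mod_top (prod_module E F)) (\<lambda>(x, y). x + y)"
    proof (rule continuous_map_nhdsin)
      fix z assume z: "z \<in> topspace (prod_topology (mod_top (prod_module E F)) (mod_top (prod_module E F)))"
      from limitin_nhdsin[OF z] show "limitin (mod_top (prod_module E F)) (\<lambda>(x, y). x + y) (case z of (x, y) \<Rightarrow> x + y)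
          (nhdsin (prod_topology (mod_top (prod_module E F)) (mod_top (prod_module E F))) z)"
        unfolding tp limitin_pairwise comp_def case_prod_beta fst_add snd_add
        by (intro conjI limitin_add[OF E] limitin_add[OF F]) auto
    qed
    show "continuous_map (prod_topology euclidean (mod_top (prod_module E F))) (mod_top (prod_module E F)) (\<lambda>(t, x). scal (prod_module E F) t x)"
    proof (rule continuous_map_nhdsin)
      fix z :: "'k \<times> 'e \<times> 'f" assume z: "z \<in> topspace (prod_topology euclidean (mod_top (prod_module E F)))"
      from limitin_nhdsin[OF z] show "limitin (mod_top (prod_module E F)) (\<lambda>(t, x). scal (prod_module E F) t x) (case z of (t, x) \<Rightarrow> scal (prod_module E F) t x)
          (nhdsin (prod_topology euclidean (mod_top (prod_module E F))) z)"
        unfolding tp limitin_pairwise comp_def case_prod_beta sc fst_conv snd_conv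
        by (intro conjI limitin_scale[OF E] limitin_scale[OF F]) auto
    qed
  qed
qed

subsection \<open>Smooth families of points\<close>

context C1_calculus begin

text \<open>Letters of words depending smoothly on a parameter in \<open>U\<close>.  The difference quotient \<open>d\<close> is recorded because the
  differential of a word is computed from it.\<close>

definition letter :: "'e set \<Rightarrow> (('k, 'e) iter \<Rightarrow> 'g) \<Rightarrow> (('k, 'e) iter \<Rightarrow> 'g) \<Rightarrow> bool" where
  "letter U a d \<longleftrightarrow> (\<forall>k. nC k 0 (Leaf ` U) a) \<and> isq' 0 (Leaf ` U) a d \<and> (\<forall>k. nC k (Suc 0) (quot_dom E 0 (Leaf ` U)) d) \<and>
     ((\<forall>s\<in>Leaf ` U. a s \<in> g1) \<and> (\<forall>N\<in>quot_dom E 0 (Leaf ` U). d N \<in> g1) \<or>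
      (\<forall>s\<in>Leaf ` U. a s \<in> gm) \<and> (\<forall>N\<in>quot_dom E 0 (Leaf ` U). d N \<in> gm))"

lemma letter_const: "c \<in> g1 \<union> gm \<Longrightarrow> letter U (\<lambda>_. c) (\<lambda>_. 0)"
  unfolding letter_def using celem_gr[of c] by (auto simp: isq_def intro: nC_const celem_zero)

lemma letter_map:
  assumes a: "letter U a d"
    and l: "\<And>F f a. glim f a (F :: (('k, 'e) iter \<times> 'g) filter) \<Longrightarrow> glim (\<lambda>i. T (f i)) (T a) F"
    and T: "\<And>x y. T (x + y) = T x + T y" "\<And>t x. T (t \<cdot> x) = t \<cdot> T x"
    and s: "(\<forall>x\<in>g1. T x \<in> g1) \<and> (\<forall>x\<in>gm. T x \<in> gm) \<or> (\<forall>x\<in>g1. T x \<in> gm) \<and> (\<forall>x\<in>gm. T x \<in> g1)"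
  shows "letter U (\<lambda>s. T (a s)) (\<lambda>N. T (d N))"
proof -
  have "isq' 0 (Leaf ` U) (\<lambda>s. T (a s)) (\<lambda>N. T (d N))" using a by (simp add: letter_def isq_def T)
  moreover have "\<forall>k. nC k 0 (Leaf ` U) (\<lambda>s. T (a s))" "\<forall>k. nC k (Suc 0) (quot_dom E 0 (Leaf ` U)) (\<lambda>N. T (d N))"
    using a unfolding letter_def by (auto intro!: nC_map[of T] l T)
  moreover have "(\<forall>s\<in>Leaf ` U. T (a s) \<in> g1) \<and> (\<forall>N\<in>quot_dom E 0 (Leaf ` U). T (d N) \<in> g1) \<or>
      (\<forall>s\<in>Leaf ` U. T (a s) \<in> gm) \<and> (\<forall>N\<in>quot_dom E 0 (Leaf ` U). T (d N) \<in> gm)"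
    using a s unfolding letter_def by metis
  ultimately show ?thesis unfolding letter_def by (intro conjI)
qed

lemma letter_minus: "letter U a d \<Longrightarrow> letter U (\<lambda>s. - a s) (\<lambda>N. - d N)"
  by (rule letter_map[of U a d uminus]) (auto intro: glim_minus gr_closed)

lemma letter_theta: "letter U a d \<Longrightarrow> letter U (\<lambda>s. \<theta> (a s)) (\<lambda>N. \<theta> (d N))"
  by (rule letter_map[of U a d \<theta>]) (auto intro: glim_theta simp: theta_in)

lemma letter_double: "letter U a d \<Longrightarrow> letter U (\<lambda>s. a s + a s) (\<lambda>N. d N + d N)"
  by (rule letter_map[of U a d "\<lambda>x. x + x"]) (auto intro: glim_add gr_closed simp: scale_right_distrib algebra_simps)

lemma letter_linear:
  assumes U: "openin (mod_top E) U"
    and l: "\<And>x v t. x \<in> carr E \<Longrightarrow> v \<in> carr E \<Longrightarrow> l (x + scal E t v) = l x + t \<cdot> l v"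
    and c: "continuous_map (mod_top E) Vt l"
  shows "letter U (\<lambda>s. l (leaf s)) (\<lambda>N. l (leaf (dir N)))"
proof -
  have L0: "l (leaf (step x t v)) = l (leaf x) + t \<cdot> l (leaf v)" if "x \<in> Sp 0" "v \<in> Sp 0" for x v t
    using that l unfolding topspace_iter_0 by auto
  have L1: "glim (\<lambda>i. l (leaf (s i))) (l (leaf x)) F" if "limitin (iter_top E 0) s x F" for s x and F :: "'i filter"
    by (rule glim_V[OF limitin_continuous_map_all[OF c limitin_leaf[OF that]]])
  note sub = Leaf_sub[OF U] and sub' = quot_dom_sub[OF Leaf_sub[OF U]]
  have "nC k 0 (Leaf ` U) (\<lambda>s. l (leaf s))" for k by (rule nC_linear[OF L0 L1 sub])
  moreover have "nC k (Suc 0) (quot_dom E 0 (Leaf ` U)) (\<lambda>N. l (leaf (dir N)))" for k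
  proof (rule nC_linear[OF _ _ sub'])
    fix x v t assume "x \<in> Sp (Suc 0)" "v \<in> Sp (Suc 0)"
    then show "l (leaf (dir (step x t v))) = l (leaf (dir x)) + t \<cdot> l (leaf (dir v))"
      unfolding topspace_iter_Suc using L0 by auto
  next
    fix F :: "(('k, 'e) iter \<times> 'g) filter" and s x assume "limitin (iter_top E (Suc 0)) s x F"
    from L1[OF limitin_continuous_map_all[OF continuous_dir this]]
    show "glim (\<lambda>i. l (leaf (dir (s i)))) (l (leaf (dir x))) F" .
  qed
  moreover have "isq' 0 (Leaf ` U) (\<lambda>s. l (leaf s)) (\<lambda>N. l (leaf (dir N)))"
    unfolding isq_def shift_def using L0 quot_domD(1,2)[of _ 0 "Leaf ` U"] sub by blast
  moreover have lg: "l (leaf s) \<in> g1" if "s \<in> Sp 0" for s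
    using that c unfolding topspace_iter_0 by (auto simp: continuous_map_def)
  have "l (leaf s) \<in> g1" if s: "s \<in> Leaf ` U" for s :: "('k, 'e) iter"
    by (rule lg[OF subsetD[OF sub s]])
  moreover have "l (leaf (dir N)) \<in> g1" if "N \<in> quot_dom E 0 (Leaf ` U)" for N
    by (rule lg[OF quot_domD(2)[OF that]])
  ultimately show ?thesis unfolding letter_def by simp
qed

abbreviation wd :: "((('k, 'e) iter \<Rightarrow> 'g) \<times> (('k, 'e) iter \<Rightarrow> 'g)) list \<Rightarrow> 'e \<Rightarrow> 'g \<Rightarrow> 'g" where
  "wd l x \<equiv> W (map (\<lambda>q. fst q (Leaf x)) l)"

context
  fixes U :: "'e set" and l :: "((('k, 'e) iter \<Rightarrow> 'g) \<times> (('k, 'e) iter \<Rightarrow> 'g)) list" and f :: "'e \<Rightarrow> 'g"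
  assumes U: "openin (mod_top E) U" and l: "\<forall>q\<in>set l. letter U (fst q) (snd q)"
begin

text \<open>Coordinates persist under small changes of the letters.\<close>

lemma open_coordinate:
  "openin (mod_top E) {x \<in> U. \<exists>y\<in>g1. act (wd l x) base = embed_V L y}"
  unfolding openin_nhdsin
proof (intro conjI ballI)
  show "{x \<in> U. \<exists>y\<in>g1. act (wd l x) base = embed_V L y} \<subseteq> carr E" using openin_subset[OF U] by auto
  fix x assume "x \<in> {x \<in> U. \<exists>y\<in>g1. act (wd l x) base = embed_V L y}"
  then obtain y where x: "x \<in> U" and y: "y \<in> g1" "act (wd l x) base = embed_V L y" by auto
  have xE: "x \<in> carr E" using openin_subset[OF U] x by blast
  let ?F = "nhdsin (mod_top E) x"
  have ev: "\<forall>\<^sub>F u in ?F. u \<in> U" by (rule limitinD[OF limitin_nhdsin[OF xE] U x])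
  have "limitin (iter_top E 0) Leaf (Leaf x) ?F"
    unfolding limitin_iter_0 using limitin_nhdsin[OF xE] by simp
  then have lm: "limitin (subtopology (iter_top E 0) (Leaf ` U)) Leaf (Leaf x) ?F"
    unfolding limitin_subtopology using x ev by (auto elim: eventually_mono)
  let ?l = "map (\<lambda>q. (\<lambda>u. fst q (Leaf u), fst q (Leaf x))) l"
  have "\<forall>q\<in>set ?l. glim (fst q) (snd q) ?F \<and> 
     (snd q \<in> g1 \<and> (\<forall>\<^sub>F i in ?F. fst q i \<in> g1) \<or> snd q \<in> gm \<and> (\<forall>\<^sub>F i in ?F. fst q i \<in> gm))"
  proof
    fix q assume "q \<in> set ?l"
    then obtain p where p: "p \<in> set l" "q = (\<lambda>u. fst p (Leaf u), fst p (Leaf x))" by auto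
    have lp: "letter U (fst p) (snd p)" using l p by auto
    then have "nC 0 0 (Leaf ` U) (fst p)" unfolding letter_def by blast
    then have "glim (\<lambda>u. fst p (Leaf u)) (fst p (Leaf x)) ?F" using gcontD[OF _ lm] by simp
    moreover have "fst p (Leaf x) \<in> g1 \<and> (\<forall>\<^sub>F u in ?F. fst p (Leaf u) \<in> g1) \<or>
        fst p (Leaf x) \<in> gm \<and> (\<forall>\<^sub>F u in ?F. fst p (Leaf u) \<in> gm)"
    proof (cases "\<forall>s\<in>Leaf ` U. fst p s \<in> g1")
      case True
      then have "\<forall>\<^sub>F u in ?F. fst p (Leaf u) \<in> g1" using ev by (auto elim: eventually_mono)
      then show ?thesis using True x by blast
    next
      case False
      then have m: "\<forall>s\<in>Leaf ` U. fst p s \<in> gm" using lp unfolding letter_def by blast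
      then have "\<forall>\<^sub>F u in ?F. fst p (Leaf u) \<in> gm" using ev by (auto elim: eventually_mono)
      then show ?thesis using m x by blast
    qed
    ultimately show "glim (fst q) (snd q) ?F \<and> 
     (snd q \<in> g1 \<and> (\<forall>\<^sub>F i in ?F. fst q i \<in> g1) \<or> snd q \<in> gm \<and> (\<forall>\<^sub>F i in ?F. fst q i \<in> gm))" by (simp add: p)
  qed
  then obtain z where z: "vlim z y ?F" "\<forall>\<^sub>F i in ?F. act (W (map (\<lambda>q. fst q i) ?l)) base = embed_V L (z i)"
    by (rule word_limit[of ?l ?F y]) (use y in \<open>simp_all add: comp_def\<close>)
  show "\<forall>\<^sub>F u in ?F. u \<in> {x \<in> U. \<exists>y\<in>g1. act (wd l x) base = embed_V L y}"
    using z(2) lim_in(2)[OF z(1)] ev by eventually_elim (auto simp: comp_def)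
qed

context
  assumes f: "\<And>x. x \<in> U \<Longrightarrow> f x \<in> g1 \<and> act (wd l x) base = embed_V L (f x)"
begin

lemma coord_family: "coordinate (Leaf ` U) (map fst l) (\<lambda>s. f (leaf s))"
  using f by (auto simp: comp_def)

lemma nC_family: "nC k 0 (Leaf ` U) (\<lambda>s. f (leaf s))"
  by (rule nC_coordinate[OF Leaf_sub[OF U] _ coord_family]) (use l in \<open>auto simp: letter_def\<close>)

text \<open>The coordinate of a smooth family of points may again serve as a letter.  In this way the coordinate of the polar
  point enters the word for the product.\<close>

lemma letter_point: "letter U (\<lambda>s. f (leaf s)) (zq l (\<lambda>s. f (leaf s)))"
proof -
  let ?z = "\<lambda>s. f (leaf s)"
  have q: "isq' 0 (Leaf ` U) ?z (zq l ?z)"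
    by (rule zq_step[OF _ coord_family]) (use l in \<open>auto simp: letter_def\<close>)
  have n: "nC k (Suc 0) (quot_dom E 0 (Leaf ` U)) (zq l ?z)" for k
  proof (rule nC_zq[OF Leaf_sub[OF U]])
    show "\<forall>q\<in>set l. nC k 0 (Leaf ` U) (fst q) \<and> isq' 0 (Leaf ` U) (fst q) (snd q) \<and> 
        nC k (Suc 0) (quot_dom E 0 (Leaf ` U)) (snd q)" using l by (auto simp: letter_def)
    show "nC k (Suc 0) (quot_dom E 0 (Leaf ` U)) (\<lambda>N. ?z (pnt N))"
      by (rule nC_pnt[OF nC_family Leaf_sub[OF U]])
    obtain d where d: "isq' 0 (Leaf ` U) ?z d" "nC k (Suc 0) (quot_dom E 0 (Leaf ` U)) d"
      using nC_family[of "Suc k"] by auto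
    show "nC k (Suc 0) (quot_dom E 0 (Leaf ` U)) (\<lambda>N. ?z (shift N))"
      by (rule nC_shift_quot[OF nC_family d Leaf_sub[OF U]])
  qed
  have "zq l ?z N \<in> g1" for N unfolding zq_def quot_def by (simp add: gr_closed)
  then show ?thesis unfolding letter_def using q n nC_family f by auto
qed

lemma smooth_family: "smooth_on E (V_module L) U f"
  unfolding smooth_on_def
  by (intro conjI U allI nC_Ck nC_family Leaf_sub) (use f in auto)

lemma zq_family:
  assumes x: "x \<in> U" and v: "v \<in> carr E"
  shows "zq l (\<lambda>s. f (leaf s)) (Node (Leaf x) (Leaf v) 0) =
    p1 (ex (- f x) (lam (map (\<lambda>q. (fst q (Leaf x), snd q (Node (Leaf x) (Leaf v) 0))) l)))"
proof -
  have xE: "x \<in> carr E" using openin_subset[OF U] x by blast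
  have N: "Node (Leaf x) (Leaf v) 0 \<in> quot_dom E 0 (Leaf ` U)"
    using x v node_zero[OF xE v] by (auto simp: quot_dom_def topspace_iter_0 simp del: iter_top.simps)
  have s: "\<forall>q\<in>set l. fst q (Leaf x) \<in> g1 \<and> snd q (Node (Leaf x) (Leaf v) 0) \<in> g1 \<or>
     fst q (Leaf x) \<in> gm \<and> snd q (Node (Leaf x) (Leaf v) 0) \<in> gm"
  proof
    fix q assume "q \<in> set l"
    then have "letter U (fst q) (snd q)" using l by blast
    then show "fst q (Leaf x) \<in> g1 \<and> snd q (Node (Leaf x) (Leaf v) 0) \<in> g1 \<or>
     fst q (Leaf x) \<in> gm \<and> snd q (Node (Leaf x) (Leaf v) 0) \<in> gm" unfolding letter_def using N x by blast
  qed
  show ?thesis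
    using zq_zero[OF _ node_zero[OF xE v] coord_family s] x by auto
qed

end
end

lemma differential_eq:
  assumes U: "openin (mod_top E) U" and a: "letter U (\<lambda>s. f (leaf s)) d" and f: "\<And>x. x \<in> U \<Longrightarrow> f x \<in> g1"
    and x: "x \<in> U" and v: "v \<in> carr E"
  shows "differential E (V_module L) U f x v = p1 (d (Node (Leaf x) (Leaf v) 0))"
proof -
  have "nC 0 (Suc 0) (quot_dom E 0 (Leaf ` U)) d" "isq' 0 (Leaf ` U) (\<lambda>s. f (leaf s)) d" using a unfolding letter_def by blast+
  then have "is_quotient_map E (V_module L) 0 (Leaf ` U) (\<lambda>s. f (leaf s)) (\<lambda>N. p1 (d N))"
    using f by (intro isq_quotient_map Leaf_sub[OF U]) auto
  from differential_unique[OF ring V_mod this U x v] show ?thesis .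
qed

lemma differential_family:
  assumes U: "openin (mod_top E) U" and l: "\<forall>q\<in>set l. letter U (fst q) (snd q)"
    and f: "\<And>x. x \<in> U \<Longrightarrow> f x \<in> g1 \<and> act (wd l x) base = embed_V L (f x)"
    and x: "x \<in> U" and v: "v \<in> carr E"
  shows "differential E (V_module L) U f x v =
    p1 (ex (- f x) (lam (map (\<lambda>q. (fst q (Leaf x), snd q (Node (Leaf x) (Leaf v) 0))) l)))"
  using differential_eq[OF U letter_point[OF U l f] _ x v] zq_family[OF U l f x v] f by simp

end

section \<open>The manifold structure\<close>

lemma smooth_on_continuous:
  assumes "topological_module E" "smooth_on E F U f"
  shows "continuous_map (subtopology (mod_top E) U) (mod_top F) f"
proof -
  interpret iterated E using assms(1) by unfold_locales
  have "Ck_on E F 0 0 (Leaf ` U) (\<lambda>z. f (leaf z))" using assms(2) unfolding smooth_on_def by blast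
  then have c: "continuous_map (subtopology (iter_top E 0) (Leaf ` U)) (mod_top F) (\<lambda>z. f (leaf z))"
    by (simp only: Ck_on.simps)
  show ?thesis
  proof (rule continuous_map_nhdsin)
    fix x assume x: "x \<in> topspace (subtopology (mod_top E) U)"
    have "limitin (subtopology (iter_top E 0) (Leaf ` U)) Leaf (Leaf x) (nhdsin (subtopology (mod_top E) U) x)"
      using limitin_nhdsin[OF x] x unfolding limitin_subtopology limitin_iter_0 by (auto elim: eventually_mono)
    from limitin_continuous_map_all[OF c this]
    show "limitin (mod_top F) f (f x) (nhdsin (subtopology (mod_top E) U) x)" by simp
  qed
qed

context C1_setting begin

interpretation V: C1_calculus L "V_module L" by unfold_locales (rule V_mod)

lemma carr_V [simp]: "carr (V_module L) = g1" by simp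

text \<open>The point with coordinate \<open>x\<close> in the chart given by \<open>g\<close>.\<close>

definition pt :: "('g \<Rightarrow> 'g) \<Rightarrow> 'g \<Rightarrow> 'g flag" where "pt g x = act g (embed_V L x)"

lemma pt_base: "pt g x = act (g \<circ> ex x) base" by (simp add: pt_def embed_V_def act_comp)

lemma pt_inj: 
  assumes g: "g \<in> GG L" and m: "x \<in> g1" "y \<in> g1" and e: "pt g x = pt g y" shows "x = y"
proof -
  have "act (inv g) (act g F) = F" for F using act_inv[OF GG_aut[OF g], of F "act g F"] by simp
  then have "embed_V L x = embed_V L y" using e unfolding pt_def by metis
  then show ?thesis by (rule embed_inj[OF m])
qed

lemma pt_X: assumes "g \<in> GG L" "x \<in> g1" shows "pt g x \<in> X_plus L"
proof -
  have "g \<circ> ex x \<in> GG L" by (rule GG.mult[OF assms(1) GG_ex(1)[OF assms(2)]])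
  then show ?thesis unfolding pt_base X_plus_iff by blast
qed

lemma X_pt: "p \<in> X_plus L \<Longrightarrow> \<exists>g\<in>GG L. p = pt g 0"
  by (auto simp: X_plus_iff pt_base)

lemma pt_eq: 
  assumes "h \<in> GG L" shows "pt g x = pt h y \<longleftrightarrow> act (inv h \<circ> g) (embed_V L x) = embed_V L y"
  unfolding pt_def act_comp using act_inv[OF GG_aut[OF assms], of "embed_V L y" "act g (embed_V L x)"]
  by (metis (no_types))

lemma X_chart: "fst (X_chart L g) = pt g ` g1" "snd (X_chart L g) = the_inv_into g1 (pt g)"
  by (simp_all add: X_chart_def pt_def[abs_def])

lemma X_chart_pt: assumes "g \<in> GG L" "x \<in> g1" shows "snd (X_chart L g) (pt g x) = x"
  unfolding X_chart by (rule the_inv_into_f_f[OF inj_onI[OF pt_inj[OF assms(1)]] assms(2)])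

lemma openin_X: "openin (X_top L) U \<longleftrightarrow> U \<subseteq> X_plus L \<and> (\<forall>g\<in>GG L. openin Vt {x\<in>g1. pt g x \<in> U})"
  by (simp add: openin_X_top pt_def)

lemma topspace_X: "topspace (X_top L) = X_plus L"
proof
  show "topspace (X_top L) \<subseteq> X_plus L" using openin_topspace[of "X_top L"] unfolding openin_X by blast
  have g1o: "openin Vt g1" by (metis openin_topspace topspace_V)
  have "openin Vt {x \<in> g1. pt g x \<in> X_plus L}" if g: "g \<in> GG L" for g
  proof -
    have "{x \<in> g1. pt g x \<in> X_plus L} = g1" using pt_X[OF g] by blast
    then show ?thesis using g1o by simp
  qed
  then have "openin (X_top L) (X_plus L)" unfolding openin_X by simp
  then show "X_plus L \<subseteq> topspace (X_top L)" by (rule openin_subset)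
qed

subsection \<open>Transition maps\<close>

text \<open>A change of charts is the family of points \<open>k e\<^sup>x.o\<^sup>+\<close> given by a word with constant letters and one linear letter.\<close>

lemma transition:
  assumes k: "k \<in> GG L" and U: "openin Vt U"
  shows transition_open: "openin Vt {x \<in> U. \<exists>y\<in>g1. act k (embed_V L x) = embed_V L y}"
    and transition_smooth: "(\<And>x. x \<in> U \<Longrightarrow> f x \<in> g1 \<and> act k (embed_V L x) = embed_V L (f x)) \<Longrightarrow> 
      smooth_on (V_module L) (V_module L) U f"
    and transition_differential: "(\<And>x. x \<in> U \<Longrightarrow> f x \<in> g1 \<and> act k (embed_V L x) = embed_V L (f x)) \<Longrightarrow> 
      x \<in> U \<Longrightarrow> v \<in> g1 \<Longrightarrow> differential (V_module L) (V_module L) U f x v = p1 (ex (- f x) (k v))"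
proof -
  obtain l where l: "word l" "k = W l" using GG_W k by metis
  let ?l = "map (\<lambda>a. (\<lambda>_. a, \<lambda>_. 0)) l @ [(\<lambda>s. leaf s, \<lambda>N. leaf (dir N))]"
  have lin: "V.letter U (\<lambda>s. leaf s) (\<lambda>N. leaf (dir N))"
    by (rule V.letter_linear) (use U in auto)
  have ll: "\<forall>q\<in>set ?l. V.letter U (fst q) (snd q)"
    using lin l(1) V.letter_const[of _ U] by auto
  have w: "act (V.wd ?l x) base = act k (embed_V L x)" for x
    by (simp add: comp_def W_append[unfolded comp_def] l embed_V_def act_def image_image)
  have U': "openin (mod_top (V_module L)) U" using U by simp
  from V.open_coordinate[OF U' ll] show "openin Vt {x \<in> U. \<exists>y\<in>g1. act k (embed_V L x) = embed_V L y}"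
    unfolding w by simp
  assume f: "\<And>x. x \<in> U \<Longrightarrow> f x \<in> g1 \<and> act k (embed_V L x) = embed_V L (f x)"
  then have f': "\<And>x. x \<in> U \<Longrightarrow> f x \<in> g1 \<and> act (V.wd ?l x) base = embed_V L (f x)" unfolding w .
  show "smooth_on (V_module L) (V_module L) U f" by (rule V.smooth_family[OF U' ll f'])
  assume x: "x \<in> U" and v: "v \<in> g1"
  have k: "lam (map (\<lambda>q. (fst q (Leaf x), snd q (Node (Leaf x) (Leaf v) 0))) ?l) = k v"
    using lam_const[of l "[(x, v)]"] by (simp add: comp_def l)
  have "v \<in> carr (V_module L)" using v by simp
  from V.differential_family[OF U' ll f' x this, unfolded k]
  show "differential (V_module L) (V_module L) U f x v = p1 (ex (- f x) (k v))" .
qed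

lemma pt_open: assumes g: "g \<in> GG L" and U: "openin Vt U" shows "openin (X_top L) (pt g ` U)"
  unfolding openin_X
proof (intro conjI ballI)
  have Ug: "U \<subseteq> g1" using openin_subset[OF U] by simp
  then show "pt g ` U \<subseteq> X_plus L" using pt_X[OF g] by blast
  fix h assume h: "h \<in> GG L"
  let ?k = "inv g \<circ> h"
  have k: "?k \<in> GG L" using g h by (intro GG.intros)
  let ?T = "{x \<in> g1. \<exists>y\<in>g1. act ?k (embed_V L x) = embed_V L y}"
  have g1o: "openin Vt g1" by (metis openin_topspace topspace_V)
  have T: "openin Vt ?T" by (rule transition_open[OF k g1o])
  define f where "f x = (SOME y. y \<in> g1 \<and> act ?k (embed_V L x) = embed_V L y)" for x
  have f: "f x \<in> g1 \<and> act ?k (embed_V L x) = embed_V L (f x)" if "x \<in> ?T" for x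
  proof -
    have "\<exists>y. y \<in> g1 \<and> act ?k (embed_V L x) = embed_V L y" using that by blast
    from someI_ex[OF this] show ?thesis unfolding f_def .
  qed
  have c: "continuous_map (subtopology Vt ?T) Vt f"
    using smooth_on_continuous[OF V_mod transition_smooth[OF k T f]] by simp
  have "{x \<in> g1. pt h x \<in> pt g ` U} = {x \<in> topspace (subtopology Vt ?T). f x \<in> U}"
  proof (intro equalityI subsetI)
    fix x assume "x \<in> {x \<in> g1. pt h x \<in> pt g ` U}"
    then obtain u where u: "x \<in> g1" "u \<in> U" "pt h x = pt g u" by auto
    then have e: "act ?k (embed_V L x) = embed_V L u" using pt_eq[OF g] by simp
    then have xT: "x \<in> ?T" using u Ug by auto
    have "f x = u" using f[OF xT] e u Ug by (auto intro: embed_inj)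
    then show "x \<in> {x \<in> topspace (subtopology Vt ?T). f x \<in> U}" using xT u by simp
  next
    fix x assume "x \<in> {x \<in> topspace (subtopology Vt ?T). f x \<in> U}"
    then have x: "x \<in> ?T" "f x \<in> U" by auto
    then have "pt h x = pt g (f x)" using f[OF x(1)] pt_eq[OF g] by simp
    then show "x \<in> {x \<in> g1. pt h x \<in> pt g ` U}" using x by auto
  qed
  then show "openin Vt {x \<in> g1. pt h x \<in> pt g ` U}"
    using openin_continuous_map_preimage[OF c U] openin_trans_full[OF _ T] by simp
qed

lemma pt_continuous: assumes "g \<in> GG L" shows "continuous_map Vt (X_top L) (pt g)"
  unfolding continuous_map_def topspace_V topspace_X
proof (intro conjI allI impI)
  show "pt g \<in> g1 \<rightarrow> X_plus L" using pt_X[OF assms] by blast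
qed (use assms in \<open>simp add: openin_X\<close>)

subsection \<open>Open submanifolds\<close>

abbreviation ch :: "'g flag set \<Rightarrow> ('g \<Rightarrow> 'g) \<Rightarrow> ('g flag, 'g) chart" where "ch A g \<equiv> restrict_chart A (X_chart L g)"
abbreviation mf :: "'g flag set \<Rightarrow> ('k, 'g, 'g flag) mfd" where "mf A \<equiv> restrict_mfd (X_mfd L) A"
abbreviation Dom :: "'g flag set \<Rightarrow> ('g \<Rightarrow> 'g) \<Rightarrow> 'g set" where "Dom A g \<equiv> {x \<in> g1. pt g x \<in> A}"

lemma mf_simps: "model (mf A) = V_module L" "mfd_top (mf A) = subtopology (X_top L) A" "atlas (mf A) = ch A ` GG L"
  by (simp_all add: restrict_mfd_def X_mfd_def image_image)

lemma mf_all: "mf (X_plus L) = X_mfd L"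
proof -
  have "ch (X_plus L) g = X_chart L g" if g: "g \<in> GG L" for g
  proof -
    have "pt g ` g1 \<inter> X_plus L = pt g ` g1" using pt_X[OF g] by blast
    then show ?thesis by (simp add: restrict_chart_def X_chart prod_eq_iff)
  qed
  then have "ch (X_plus L) ` GG L = X_chart L ` GG L" by (rule image_cong[OF refl])
  moreover have "subtopology (X_top L) (X_plus L) = X_top L" by (metis subtopology_topspace topspace_X)
  ultimately show ?thesis by (simp add: restrict_mfd_def X_mfd_def image_image)
qed

lemma ch_fst: "fst (ch A g) = pt g ` Dom A g"
proof -
  have "fst (ch A g) = pt g ` g1 \<inter> A" by (simp add: restrict_chart_def X_chart)
  also have "\<dots> = pt g ` Dom A g"
  proof (intro equalityI subsetI)
    fix p assume p: "p \<in> pt g ` g1 \<inter> A"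
    then obtain x where "x \<in> g1" "p = pt g x" by blast
    then show "p \<in> pt g ` Dom A g" using p by (intro image_eqI[of _ _ x]) simp_all
  qed blast
  finally show ?thesis .
qed

lemma ch_snd: "g \<in> GG L \<Longrightarrow> x \<in> g1 \<Longrightarrow> snd (ch A g) (pt g x) = x"
  by (simp add: restrict_chart_def X_chart_pt)

lemma ch_mem: "p \<in> fst (ch A g) \<longleftrightarrow> (\<exists>x. x \<in> Dom A g \<and> p = pt g x)"
  unfolding ch_fst by blast

lemma ch_img: assumes g: "g \<in> GG L" shows "snd (ch A g) ` fst (ch A g) = Dom A g"
proof -
  have "snd (ch A g) ` fst (ch A g) = (\<lambda>x. snd (ch A g) (pt g x)) ` Dom A g"
    unfolding ch_fst image_image ..
  also have "\<dots> = (\<lambda>x. x) ` Dom A g" by (rule image_cong[OF refl]) (rule ch_snd[OF g], simp)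
  finally show ?thesis by simp
qed

lemma ch_inv: assumes g: "g \<in> GG L" and x: "x \<in> Dom A g" shows "chart_inv (ch A g) x = pt g x"
  unfolding chart_inv_def
proof (rule the_inv_into_f_eq)
  have x1: "x \<in> g1" using x by blast
  show "snd (ch A g) (pt g x) = x" by (rule ch_snd[OF g x1])
  show "pt g x \<in> fst (ch A g)" unfolding ch_mem using x by blast
  show "inj_on (snd (ch A g)) (fst (ch A g))"
  proof (rule inj_onI)
    fix p q assume "p \<in> fst (ch A g)" "q \<in> fst (ch A g)" and e: "snd (ch A g) p = snd (ch A g) q"
    then obtain y z where y: "y \<in> g1" "p = pt g y" and z: "z \<in> g1" "q = pt g z" unfolding ch_mem by blast
    then have "y = z" using e ch_snd[OF g y(1), of A] ch_snd[OF g z(1), of A] by simp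
    then show "p = q" using y z by simp
  qed
qed

subsection \<open>Tangent vectors\<close>

text \<open>The coordinate of the infinitesimal action of \<open>X\<close> in the chart of \<open>g\<close>.\<close>

definition xi :: "('g \<Rightarrow> 'g) \<Rightarrow> 'g \<Rightarrow> 'g \<Rightarrow> 'g" where "xi g x X = p1 (ex (- x) (inv g X))"

lemma xi_in [simp]: "xi g x X \<in> g1" by (simp add: xi_def)

lemma xi_self: "g \<in> GG L \<Longrightarrow> x \<in> g1 \<Longrightarrow> v \<in> g1 \<Longrightarrow> xi g x (g v) = v"
  by (simp add: xi_def GG_cancel ex_same gr_closed p_gr)

lemma xi_add: "g \<in> GG L \<Longrightarrow> xi g x (X + Y) = xi g x X + xi g x Y"
  and xi_scale: "g \<in> GG L \<Longrightarrow> xi g x (t \<cdot> X) = t \<cdot> xi g x X"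
  and xi_minus: "g \<in> GG L \<Longrightarrow> xi g x (- X) = - xi g x X"
  and xi_zero: "g \<in> GG L \<Longrightarrow> xi g x 0 = 0"
  by (simp_all add: xi_def autD[OF aut_inv[OF GG_aut]] ex_lin)

text \<open>The element \<open>e\<^sup>-\<^sup>y h\<^sup>-\<^sup>1 g e\<^sup>x\<close> fixes \<open>o\<^sup>+\<close>, so it acts on the quotient \<open>\<gg>\<^sub>1\<close>.\<close>

lemma xi_change:
  assumes g: "g \<in> GG L" and h: "h \<in> GG L" and x: "x \<in> g1" and y: "y \<in> g1" and e: "pt g x = pt h y"
  shows "xi h y (g (xi g x X)) = xi h y X"
proof -
  let ?f = "ex (- y) \<circ> (inv h \<circ> (g \<circ> ex x))"
  have m: "- y \<in> g1" using y by (simp add: gr_closed)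
  have G: "inv h \<circ> (g \<circ> ex x) \<in> GG L" using g h x by (intro GG.intros GG_ex) auto
  have e': "act (inv h \<circ> (g \<circ> ex x)) base = embed_V L y"
    using e pt_eq[OF h, of g x y] by (simp add: embed_V_def act_comp)
  have a: "aut ?f" using GG_aut[OF G] m by (auto intro: aut_comp exp_aut)
  have s: "act ?f base = base" by (rule chart_value(2)[OF G y e'])
  let ?X = "ex (- x) (inv g X)"
  have "?f ?X = ex (- y) (inv h X)" using x g by (simp add: ex_cancel GG_cancel)
  moreover have "?f (p1 ?X) = ex (- y) (inv h (g (p1 ?X)))" using x by (simp add: ex_same)
  ultimately show ?thesis using stab(1)[OF a s, of ?X] by (simp add: xi_def)
qed

text \<open>The vector at \<open>p\<close> given by the infinitesimal action of \<open>X\<close>, as the family of its coordinates in all charts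
  of \<open>A\<close> around \<open>p\<close>.\<close>

definition tau :: "'g flag set \<Rightarrow> 'g flag \<Rightarrow> 'g \<Rightarrow> ('g flag, 'g) tangent" where
  "tau A p X = (p, {(ch A g, xi g x X) | g x. g \<in> GG L \<and> x \<in> g1 \<and> p = pt g x})"

lemma fst_tau [simp]: "fst (tau A p X) = p" by (simp add: tau_def)

context
  fixes A :: "'g flag set"
  assumes A: "openin (X_top L) A"
begin

lemma A_sub: "A \<subseteq> X_plus L" using A by (simp add: openin_X)

lemma Dom_open: "g \<in> GG L \<Longrightarrow> openin Vt (Dom A g)" using A by (simp add: openin_X)

lemma loc_dom_id: assumes g: "g \<in> GG L" and h: "h \<in> GG L"
  shows "loc_dom (ch A g) id (ch A h) = {x \<in> Dom A g. \<exists>y\<in>g1. act (inv h \<circ> g) (embed_V L x) = embed_V L y}"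
proof -
  have "x \<in> loc_dom (ch A g) id (ch A h) \<longleftrightarrow> x \<in> Dom A g \<and> (\<exists>y\<in>g1. pt g x = pt h y)" for x
  proof
    assume "x \<in> loc_dom (ch A g) id (ch A h)"
    then obtain p where p: "x = snd (ch A g) p" "p \<in> fst (ch A g)" "p \<in> fst (ch A h)" unfolding loc_dom_def id_apply by blast
    obtain u where u: "u \<in> Dom A g" "p = pt g u" using p(2) unfolding ch_mem by blast
    obtain y where y: "y \<in> Dom A h" "p = pt h y" using p(3) unfolding ch_mem by blast
    have "x = u" using u p(1) ch_snd[OF g, of u A] by simp
    then show "x \<in> Dom A g \<and> (\<exists>y\<in>g1. pt g x = pt h y)" using u y by blast
  next
    assume x: "x \<in> Dom A g \<and> (\<exists>y\<in>g1. pt g x = pt h y)"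
    then obtain y where y: "y \<in> g1" "pt g x = pt h y" by blast
    have "pt g x \<in> fst (ch A g)" "pt g x \<in> fst (ch A h)" using x y unfolding ch_mem by (blast, metis (mono_tags, lifting) mem_Collect_eq)
    moreover have "x = snd (ch A g) (pt g x)" using x ch_snd[OF g, of x A] by simp
    ultimately show "x \<in> loc_dom (ch A g) id (ch A h)" unfolding loc_dom_def id_apply by blast
  qed
  then show ?thesis using pt_eq[OF h] by (simp add: set_eq_iff)
qed

lemma loc_rep_id: 
  assumes g: "g \<in> GG L" and h: "h \<in> GG L" and x: "x \<in> loc_dom (ch A g) id (ch A h)"
  shows "loc_rep (ch A g) id (ch A h) x \<in> g1 \<and> act (inv h \<circ> g) (embed_V L x) = embed_V L (loc_rep (ch A g) id (ch A h) x)"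
proof -
  obtain y where y: "x \<in> Dom A g" "y \<in> g1" "act (inv h \<circ> g) (embed_V L x) = embed_V L y"
    using x unfolding loc_dom_id[OF g h] by blast
  then have "pt g x = pt h y" using pt_eq[OF h] by simp
  then have "loc_rep (ch A g) id (ch A h) x = y" using ch_inv[OF g y(1)] ch_snd[OF h y(2)] by (simp add: loc_rep_def)
  then show ?thesis using y by simp
qed

lemma loc_dom_open: "g \<in> GG L \<Longrightarrow> h \<in> GG L \<Longrightarrow> openin Vt (loc_dom (ch A g) id (ch A h))"
  unfolding loc_dom_id by (intro transition_open Dom_open GG.intros)

lemma smooth_manifold_mf: "smooth_manifold (mf A)"
  unfolding smooth_manifold_def mf_simps
proof (intro conjI ballI V_mod)
  fix c assume "c \<in> ch A ` GG L"
  then obtain g where g: "g \<in> GG L" "c = ch A g" by blast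
  have d: "openin Vt (Dom A g)" by (rule Dom_open[OF g(1)])
  have o: "openin (X_top L) (pt g ` Dom A g)" by (rule pt_open[OF g(1) d])
  show "openin (subtopology (X_top L) A) (fst c)"
    unfolding g(2) ch_fst openin_subtopology using o by blast
  show "openin (mod_top (V_module L)) (snd c ` fst c)" using d by (simp add: g ch_img)
  have s: "subtopology (subtopology (X_top L) A) (fst c) = subtopology (X_top L) (pt g ` Dom A g)"
  proof -
    have "A \<inter> pt g ` Dom A g = pt g ` Dom A g" by blast
    then show ?thesis by (simp only: g(2) ch_fst subtopology_subtopology)
  qed
  have t: "topspace (subtopology (X_top L) (pt g ` Dom A g)) = pt g ` Dom A g" 
    "topspace (subtopology Vt (Dom A g)) = Dom A g"
    using openin_subset[OF o] by auto
  have sc: "snd c (pt g x) = x" if "x \<in> Dom A g" for x unfolding g(2) using ch_snd[OF g(1), of x A] that by blast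
  have "homeomorphic_maps (subtopology (X_top L) (pt g ` Dom A g)) (subtopology Vt (Dom A g)) (snd c) (pt g)"
    unfolding homeomorphic_maps_def t
  proof (intro conjI ballI)
    show "continuous_map (subtopology Vt (Dom A g)) (subtopology (X_top L) (pt g ` Dom A g)) (pt g)"
      unfolding continuous_map_in_subtopology
      using continuous_map_from_subtopology[OF pt_continuous[OF g(1)], of "Dom A g"] t(2) by blast
    show "continuous_map (subtopology (X_top L) (pt g ` Dom A g)) (subtopology Vt (Dom A g)) (snd c)"
      unfolding continuous_map_def t
    proof (intro conjI allI impI)
      show "snd c \<in> pt g ` Dom A g \<rightarrow> Dom A g" 
      proof
        fix p assume "p \<in> pt g ` Dom A g"
        then obtain x where "x \<in> Dom A g" "p = pt g x" by blast
        then show "snd c p \<in> Dom A g" using sc[of x] by simp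
      qed
      fix U assume "openin (subtopology Vt (Dom A g)) U"
      then have U: "openin Vt U" "U \<subseteq> Dom A g" using openin_open_subtopology[OF d] by blast+
      have e: "{p \<in> pt g ` Dom A g. snd c p \<in> U} = pt g ` U"
      proof (intro equalityI subsetI)
        fix p assume p: "p \<in> {p \<in> pt g ` Dom A g. snd c p \<in> U}"
        then obtain x where x: "x \<in> Dom A g" "p = pt g x" by blast
        have "x \<in> U" using p sc[OF x(1)] by (simp add: x(2))
        then show "p \<in> pt g ` U" unfolding x(2) by (rule imageI)
      next
        fix p assume "p \<in> pt g ` U"
        then obtain x where x: "x \<in> U" "p = pt g x" by blast
        then have xD: "x \<in> Dom A g" using U(2) by blast
        then have "pt g x \<in> pt g ` Dom A g" by (rule imageI)
        then show "p \<in> {p \<in> pt g ` Dom A g. snd c p \<in> U}" using sc[OF xD] x by simp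
      qed
      show "openin (subtopology (X_top L) (pt g ` Dom A g)) {p \<in> pt g ` Dom A g. snd c p \<in> U}"
        unfolding e openin_open_subtopology[OF o]
        by (rule conjI[OF pt_open[OF g(1) U(1)] image_mono[OF U(2)]])
    qed
    show "pt g (snd c p) = p" if p: "p \<in> pt g ` Dom A g" for p
    proof -
      obtain x where "x \<in> Dom A g" "p = pt g x" using p by blast
      then show ?thesis using sc[of x] by simp
    qed
  qed (rule sc)
  then show "homeomorphic_map (subtopology (subtopology (X_top L) A) (fst c)) 
      (subtopology (mod_top (V_module L)) (snd c ` fst c)) (snd c)"
    unfolding s unfolding g(2) ch_img[OF g(1)] V_sel by (rule homeomorphic_maps_imp_map)
next
  have "p \<in> (\<Union>c\<in>ch A ` GG L. fst c)" if p: "p \<in> A" for p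
  proof -
    obtain g where g: "g \<in> GG L" "p = pt g 0" using X_pt[of p] A_sub p by blast
    then have "p \<in> fst (ch A g)" using p unfolding ch_mem by (intro exI[of _ 0]) simp
    then show ?thesis using g by blast
  qed
  moreover have "fst (ch A g) \<subseteq> A" for g unfolding ch_fst by blast
  ultimately have "(\<Union>c\<in>ch A ` GG L. fst c) = A" by blast
  then show "(\<Union>c\<in>ch A ` GG L. fst c) = topspace (subtopology (X_top L) A)"
    using A_sub by (simp add: topspace_X Int_absorb1)
next
  fix c c' assume "c \<in> ch A ` GG L" "c' \<in> ch A ` GG L"
  then obtain g h where g: "g \<in> GG L" "h \<in> GG L" "c = ch A g" "c' = ch A h" by blast
  have k: "inv h \<circ> g \<in> GG L" using g by (intro GG.intros)
  show "smooth_on (V_module L) (V_module L) (loc_dom c id c') (loc_rep c id c')"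
    unfolding g(3,4) by (rule transition_smooth[OF k loc_dom_open[OF g(1,2)] loc_rep_id[OF g(1,2)]])
qed

lemma transition_tangent:
  assumes g: "g \<in> GG L" and h: "h \<in> GG L" and x: "x \<in> Dom A g" and y: "y \<in> g1" and e: "pt g x = pt h y" and v: "v \<in> g1"
  shows "differential (V_module L) (V_module L) (loc_dom (ch A g) id (ch A h)) (loc_rep (ch A g) id (ch A h)) x v
    = xi h y (g v)"
proof -
  have k: "inv h \<circ> g \<in> GG L" using g h by (intro GG.intros)
  have e': "act (inv h \<circ> g) (embed_V L x) = embed_V L y" using e pt_eq[OF h] by simp
  have xl: "x \<in> loc_dom (ch A g) id (ch A h)" using x y e' unfolding loc_dom_id[OF g h] by blast
  have "loc_rep (ch A g) id (ch A h) x = y"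
    using loc_rep_id[OF g h xl] e' y by (auto intro: embed_inj)
  then show ?thesis
    using transition_differential[OF k loc_dom_open[OF g h] loc_rep_id[OF g h] xl v] by (simp add: xi_def)
qed

text \<open>Two group elements may define the same chart of \<open>A\<close>; the coordinate of a tangent vector depends on
  the chart only.\<close>

lemma tau_coord:
  assumes g: "g \<in> GG L" and x: "x \<in> Dom A g" and e: "p = pt g x"
  shows "(ch A g, w) \<in> snd (tau A p X) \<longleftrightarrow> w = xi g x X"
proof
  assume "w = xi g x X" then show "(ch A g, w) \<in> snd (tau A p X)" using g x e by (auto simp: tau_def)
next
  assume "(ch A g, w) \<in> snd (tau A p X)"
  then obtain h y where h: "h \<in> GG L" "y \<in> g1" "p = pt h y" "ch A g = ch A h" "w = xi h y X"
    by (auto simp: tau_def)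
  have x1: "x \<in> g1" using x by simp
  have "xi h y X = xi h y (g (xi g x X))" using xi_change[OF g h(1) x1 h(2)] e h(3) by simp
  also have "\<dots> = differential (V_module L) (V_module L) (loc_dom (ch A g) id (ch A h)) (loc_rep (ch A g) id (ch A h)) x (xi g x X)"
    using transition_tangent[OF g h(1) x h(2)] e h(3) by simp
  also have "\<dots> = xi g x (g (xi g x X))"
    unfolding h(4)[symmetric] by (rule transition_tangent[OF g g x x1 refl xi_in])
  also have "\<dots> = xi g x X" using g x1 by (simp add: xi_self)
  finally show "w = xi g x X" using h by simp
qed

lemma tau_elem:
  "z \<in> snd (tau A p X) \<longleftrightarrow> (\<exists>g x. g \<in> GG L \<and> x \<in> g1 \<and> p = pt g x \<and> z = (ch A g, xi g x X))"
  by (auto simp: tau_def)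

lemma tangent_ext: "fst s = p \<Longrightarrow> (\<And>z. z \<in> snd s \<longleftrightarrow> z \<in> snd (tau A p X)) \<Longrightarrow> s = tau A p X"
  by (rule prod_eqI) (simp_all add: set_eq_iff del: split_paired_All)

lemma tau_cong: 
  assumes "\<And>g x. g \<in> GG L \<Longrightarrow> x \<in> g1 \<Longrightarrow> p = pt g x \<Longrightarrow> xi g x X = xi g x Y" shows "tau A p X = tau A p Y"
  by (rule tangent_ext) (simp, unfold tau_elem, metis assms)

lemma tangent_eqI:
  assumes f: "fst s = p" 
    and 1: "\<And>g x w. g \<in> GG L \<Longrightarrow> x \<in> g1 \<Longrightarrow> p = pt g x \<Longrightarrow> (ch A g, w) \<in> snd s \<longleftrightarrow> w = xi g x X"
    and 2: "\<And>c w. (c, w) \<in> snd s \<Longrightarrow> \<exists>Y v. (c, v) \<in> snd (tau A p Y)"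
  shows "s = tau A p X"
proof (rule tangent_ext[OF f])
  fix z :: "('g flag, 'g) chart \<times> 'g"
  obtain c w where z: "z = (c, w)" by (cases z) 
  show "z \<in> snd s \<longleftrightarrow> z \<in> snd (tau A p X)"
  proof
    assume a: "z \<in> snd s"
    then obtain g x where g: "g \<in> GG L" "x \<in> g1" "p = pt g x" "c = ch A g" using 2[of c w] unfolding z tau_elem by blast
    then have "w = xi g x X" using 1[OF g(1-3)] a z by simp
    then show "z \<in> snd (tau A p X)" unfolding tau_elem using g z by blast
  next
    assume "z \<in> snd (tau A p X)"
    then show "z \<in> snd s" unfolding tau_elem using 1 by blast
  qed
qed

context
  fixes p assumes p: "p \<in> A"
begin

lemma Dom_p: "x \<in> g1 \<Longrightarrow> p = pt g x \<Longrightarrow> x \<in> Dom A g" using p by simp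

lemma p_chart: obtains g x where "g \<in> GG L" "x \<in> g1" "p = pt g x"
proof -
  have "p \<in> X_plus L" using p A_sub by blast
  then obtain g where g: "g \<in> GG L" "p = pt g 0" using X_pt by blast
  show ?thesis by (rule that[OF g(1) gr_closed(1) g(2)])
qed

lemma p_atlas: "c \<in> atlas (mf A) \<and> p \<in> fst c \<longleftrightarrow> (\<exists>g x. g \<in> GG L \<and> x \<in> g1 \<and> p = pt g x \<and> c = ch A g)"
proof
  assume "c \<in> atlas (mf A) \<and> p \<in> fst c"
  then obtain g where g: "g \<in> GG L" "c = ch A g" "p \<in> fst (ch A g)" unfolding mf_simps by blast
  then obtain x where "x \<in> Dom A g" "p = pt g x" unfolding ch_mem by blast
  then show "\<exists>g x. g \<in> GG L \<and> x \<in> g1 \<and> p = pt g x \<and> c = ch A g" using g by blast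
next
  assume "\<exists>g x. g \<in> GG L \<and> x \<in> g1 \<and> p = pt g x \<and> c = ch A g"
  then obtain g x where g: "g \<in> GG L" "x \<in> g1" "p = pt g x" "c = ch A g" by blast
  have "p \<in> fst (ch A g)" unfolding ch_mem using Dom_p[OF g(2,3)] g(3) by blast
  then show "c \<in> atlas (mf A) \<and> p \<in> fst c" unfolding mf_simps using g by blast
qed

lemma tau_comprehension:
  assumes d: "\<And>h y. h \<in> GG L \<Longrightarrow> y \<in> g1 \<Longrightarrow> p = pt h y \<Longrightarrow> D (ch A h) = xi h y X"
  shows "{(c, D c) | c. c \<in> atlas (mf A) \<and> p \<in> fst c} = snd (tau A p X)"
proof (intro equalityI subsetI)
  fix z assume "z \<in> {(c, D c) | c. c \<in> atlas (mf A) \<and> p \<in> fst c}"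
  then obtain c where c: "z = (c, D c)" "c \<in> atlas (mf A) \<and> p \<in> fst c" by blast
  then obtain h y where h: "h \<in> GG L" "y \<in> g1" "p = pt h y" "c = ch A h" using p_atlas by blast
  have "z = (ch A h, xi h y X)" using c(1) d[OF h(1-3)] by (simp only: h(4))
  then show "z \<in> snd (tau A p X)" unfolding tau_elem using h by blast
next
  fix z assume "z \<in> snd (tau A p X)"
  then obtain h y where h: "h \<in> GG L" "y \<in> g1" "p = pt h y" "z = (ch A h, xi h y X)" unfolding tau_elem by blast
  have "z = (ch A h, D (ch A h))" using h(4) by (simp only: d[OF h(1-3)])
  moreover have "ch A h \<in> atlas (mf A) \<and> p \<in> fst (ch A h)" unfolding p_atlas using h by blast
  ultimately show "z \<in> {(c, D c) | c. c \<in> atlas (mf A) \<and> p \<in> fst c}" by blast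
qed

lemma tvec_tau:
  assumes g: "g \<in> GG L" and x: "x \<in> g1" "p = pt g x" and v: "v \<in> g1"
  shows "tvec (mf A) (ch A g) p v = tau A p (g v)"
proof -
  let ?d = "\<lambda>c'. differential (V_module L) (V_module L) (loc_dom (ch A g) id c') (loc_rep (ch A g) id c') (snd (ch A g) p) v"
  have d: "?d (ch A h) = xi h y (g v)" if "h \<in> GG L" "y \<in> g1" "p = pt h y" for h y
    using transition_tangent[OF g that(1) Dom_p[OF x] that(2) _ v] that x ch_snd[OF g x(1), of A] by simp
  have "snd (tvec (mf A) (ch A g) p v) = snd (tau A p (g v))"
    unfolding tvec_def mf_simps(1) snd_conv by (rule tau_comprehension[of ?d, OF d])
  then show ?thesis by (intro prod_eqI) (simp_all add: tvec_def)
qed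

lemma tangent_space_tau: "tangent_space (mf A) p = range (tau A p)"
proof -
  have "tau A p X \<in> tangent_space (mf A) p" for X
  proof -
    obtain g x where g: "g \<in> GG L" "x \<in> g1" "p = pt g x" by (rule p_chart)
    have "tau A p X = tau A p (g (xi g x X))"
      by (rule tau_cong) (use xi_change[OF g(1) _ g(2)] g(3) in metis)
    also have "\<dots> = tvec (mf A) (ch A g) p (xi g x X)" using tvec_tau[OF g] by simp
    finally have e: "tau A p X = tvec (mf A) (ch A g) p (xi g x X)" .
    have "ch A g \<in> atlas (mf A) \<and> p \<in> fst (ch A g)" unfolding p_atlas using g by blast
    moreover have "xi g x X \<in> carr (model (mf A))" by (simp add: mf_simps(1))
    ultimately show ?thesis unfolding tangent_space_def e by blast
  qed
  moreover have "\<xi> \<in> range (tau A p)" if \<xi>: "\<xi> \<in> tangent_space (mf A) p" for \<xi>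
  proof -
    obtain c v where c: "\<xi> = tvec (mf A) c p v" "c \<in> atlas (mf A) \<and> p \<in> fst c" "v \<in> g1"
      using \<xi> unfolding tangent_space_def mf_simps(1) carr_V by blast
    then show ?thesis using tvec_tau unfolding p_atlas by blast
  qed
  ultimately show ?thesis by blast
qed

lemma tzero_tau: "tzero (mf A) p = tau A p 0"
proof -
  have "snd (tzero (mf A) p) = snd (tau A p 0)"
    unfolding tzero_def snd_conv by (rule tau_comprehension) (simp add: xi_zero)
  then show ?thesis by (intro prod_eqI) (simp_all add: tzero_def)
qed

lemma tneg_tau: "tneg (tau A p X) = tau A p (- X)"
proof (rule tangent_eqI)
  have s: "(c, w) \<in> snd (tneg (tau A p X)) \<longleftrightarrow> (\<exists>v. w = - v \<and> (c, v) \<in> snd (tau A p X))" for c w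
    by (simp add: tneg_def del: split_paired_Ex)
  show "(ch A g, w) \<in> snd (tneg (tau A p X)) \<longleftrightarrow> w = xi g x (- X)" if "g \<in> GG L" "x \<in> g1" "p = pt g x" for g x w
    unfolding s using tau_coord[OF that(1) Dom_p[OF that(2,3)] that(3)] xi_minus[OF that(1)] by simp
  show "\<exists>Y v. (c, v) \<in> snd (tau A p Y)" if "(c, w) \<in> snd (tneg (tau A p X))" for c w using that s by blast
qed (simp add: tneg_def)

lemma tscal_tau: "tscal (mf A) t (tau A p X) = tau A p (t \<cdot> X)"
proof (rule tangent_eqI)
  have s: "(c, w) \<in> snd (tscal (mf A) t (tau A p X)) \<longleftrightarrow> (\<exists>v. w = t \<cdot> v \<and> (c, v) \<in> snd (tau A p X))" for c w
    by (simp add: tscal_def mf_simps(1) del: split_paired_Ex)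
  show "(ch A g, w) \<in> snd (tscal (mf A) t (tau A p X)) \<longleftrightarrow> w = xi g x (t \<cdot> X)" if "g \<in> GG L" "x \<in> g1" "p = pt g x" for g x w
    unfolding s using tau_coord[OF that(1) Dom_p[OF that(2,3)] that(3)] xi_scale[OF that(1)] by simp
  show "\<exists>Y v. (c, v) \<in> snd (tau A p Y)" if "(c, w) \<in> snd (tscal (mf A) t (tau A p X))" for c w using that s by blast
qed (simp add: tscal_def)

lemma tadd_tau: "tadd (tau A p X) (tau A p Y) = tau A p (X + Y)"
proof (rule tangent_eqI)
  have s: "(c, w) \<in> snd (tadd (tau A p X) (tau A p Y)) \<longleftrightarrow> (\<exists>v u. w = v + u \<and> (c, v) \<in> snd (tau A p X) \<and> (c, u) \<in> snd (tau A p Y))" for c w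
    by (simp add: tadd_def del: split_paired_Ex)
  show "(ch A g, w) \<in> snd (tadd (tau A p X) (tau A p Y)) \<longleftrightarrow> w = xi g x (X + Y)" if "g \<in> GG L" "x \<in> g1" "p = pt g x" for g x w
    unfolding s using tau_coord[OF that(1) Dom_p[OF that(2,3)] that(3)] xi_add[OF that(1)] by simp
  show "\<exists>Z v. (c, v) \<in> snd (tau A p Z)" if "(c, w) \<in> snd (tadd (tau A p X) (tau A p Y))" for c w using that s by blast
qed (simp add: tadd_def)

lemma coord_tau: "g \<in> GG L \<Longrightarrow> x \<in> g1 \<Longrightarrow> p = pt g x \<Longrightarrow> coord (tau A p X) (ch A g) = xi g x X"
  unfolding coord_def using tau_coord[OF _ Dom_p] by simp

end

subsection \<open>Vector fields given by the Lie algebra\<close>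

text \<open>In a chart the field of \<open>X\<close> is \<open>x \<mapsto> p\<^sub>1 (e\<^sup>-\<^sup>x g\<^sup>-\<^sup>1 X)\<close>, a polynomial, whose difference quotient is that of a
  word with one letter.\<close>

lemma xi_differential:
  assumes g: "g \<in> GG L" and X: "celem X" and x: "x \<in> Dom A g" and v: "v \<in> g1"
    and f: "\<And>u. u \<in> Dom A g \<Longrightarrow> f u = xi g u X"
  shows "differential (V_module L) (V_module L) (Dom A g) f x v = - p1 (v \<star> ex (- x) (inv g X))"
proof -
  let ?U = "Dom A g" and ?Y = "inv g X"
  have U: "openin (mod_top (V_module L)) ?U" using Dom_open[OF g] by simp
  have Y: "celem ?Y" by (rule celem_GG[OF GG.inverse[OF g] X])
  have lin: "V.letter ?U (\<lambda>s. - leaf s) (\<lambda>N. - leaf (dir N))"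
    by (rule V.letter_minus[OF V.letter_linear[OF U]]) auto
  let ?L = "Leaf ` ?U" and ?Q = "quot_dom (V_module L) 0 (Leaf ` ?U)"
  let ?d = "\<lambda>N. p1 (Dq [(- leaf (pnt N), - leaf (V.shift N), - leaf (dir N))] ?Y)"
  note sub = V.Leaf_sub[OF U] and sub' = V.quot_dom_sub[OF V.Leaf_sub[OF U]]
  have n: "V.nC k 0 ?L (\<lambda>s. - leaf s)" and q: "V.isq' 0 ?L (\<lambda>s. - leaf s) (\<lambda>N. - leaf (dir N))"
    and n': "V.nC k (Suc 0) ?Q (\<lambda>N. - leaf (dir N))" for k
    using lin unfolding V.letter_def by blast+
  have 1: "V.nC k 0 ?L (\<lambda>s. xi g (leaf s) X)" for k
    unfolding xi_def by (intro V.nC_p1 V.nC_ex n V.nC_const Y sub)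
  have 2: "V.nC k (Suc 0) ?Q ?d" for k
    using V.nC_Dq[OF sub' V.nC_const[OF Y], where k=k and l="[(\<lambda>N. - leaf (pnt N), \<lambda>N. - leaf (V.shift N), \<lambda>N. - leaf (dir N))]"]
      V.nC_pnt[OF n sub] V.nC_shift_quot[OF n q n' sub] n'
    by (intro V.nC_p1) simp
  have 3: "V.isq' 0 ?L (\<lambda>s. xi g (leaf s) X) ?d"
    unfolding V.isq_def
  proof
    fix N assume N: "N \<in> ?Q"
    have "- leaf (V.shift N) = - leaf (pnt N) + par N \<cdot> - leaf (dir N)" using q N by (simp add: V.isq_def)
    then have "ex (- leaf (V.shift N)) ?Y - ex (- leaf (pnt N)) ?Y = par N \<cdot> Dq [(- leaf (pnt N), - leaf (V.shift N), - leaf (dir N))] ?Y"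
      using Dq_quotient[of "[(- leaf (pnt N), - leaf (V.shift N), - leaf (dir N))]" "par N" ?Y] by simp
    then have "ex (- leaf (V.shift N)) ?Y = ex (- leaf (pnt N)) ?Y + par N \<cdot> Dq [(- leaf (pnt N), - leaf (V.shift N), - leaf (dir N))] ?Y"
      by (simp add: algebra_simps)
    then show "xi g (leaf (V.shift N)) X = xi g (leaf (pnt N)) X + par N \<cdot> ?d N"
      by (simp only: xi_def p_add p_scale)
  qed
  have "V.letter ?U (\<lambda>s. f (leaf s)) ?d"
  proof -
    have e: "f (leaf s) = xi g (leaf s) X" if "s \<in> ?L" for s :: "('k, 'g) iter" using that f by auto
    have "V.nC k 0 ?L (\<lambda>s. f (leaf s))" for k by (rule V.nC_cong[OF 1]) (simp add: e)
    moreover have "V.isq' 0 ?L (\<lambda>s. f (leaf s)) ?d" unfolding V.isq_def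
    proof
      fix N assume N: "N \<in> ?Q"
      show "f (leaf (V.shift N)) = f (leaf (pnt N)) + par N \<cdot> ?d N"
        using 3 N e[OF V.quot_domD(1)[OF N]] e[OF V.quot_domD(3)[OF N]] by (simp only: V.isq_def)
    qed
    moreover have "(\<forall>s\<in>(?L :: ('k, 'g) iter set). f (leaf s) \<in> g1) \<and> (\<forall>N\<in>?Q. ?d N \<in> g1)"
    proof (intro conjI ballI p_in)
      fix s :: "('k, 'g) iter" assume "s \<in> ?L"
      then show "f (leaf s) \<in> g1" using e[of s] by simp
    qed
    ultimately show ?thesis unfolding V.letter_def using 2 by blast
  qed
  from V.differential_eq[OF U this _ x]
  have "differential (V_module L) (V_module L) ?U f x v = p1 (?d (Node (Leaf x) (Leaf v) 0))" using f v by simp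
  also have "\<dots> = p1 (- v \<star> ex (- x) ?Y)"
  proof -
    have "Dq [(- x, - x, - v)] ?Y = - v \<star> ex (- x) ?Y"
      using Dq_lam[of "[(- x, - v)]" ?Y] x v by (simp add: gr_closed)
    moreover have "leaf (V.shift (Node (Leaf x) (Leaf v) 0)) = x" by simp
    ultimately show ?thesis by simp
  qed
  finally show ?thesis by simp
qed

text \<open>With \<open>X' = e\<^sup>-\<^sup>x g\<^sup>-\<^sup>1 X\<close> and \<open>Y'\<close> likewise, the bracket in the chart is the part of degree 1 of
  \<open>[p\<^sub>1 Y', X'] - [p\<^sub>1 X', Y']\<close>, which is that of \<open>-[X', Y']\<close>: an action from the left gives an anti-homomorphism.\<close>

lemma lie_bracket_tau:
  assumes F: "\<And>q. q \<in> A \<Longrightarrow> F q = tau A q X" and H: "\<And>q. q \<in> A \<Longrightarrow> H q = tau A q Y"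
    and X: "celem X" and Y: "celem Y" and p: "p \<in> A"
  shows "lie_bracket (mf A) F H p = tau A p (- (X \<star> Y))"
proof -
  have rep: "field_rep F (ch A g) u = xi g u X" "field_rep H (ch A g) u = xi g u Y"
    if "g \<in> GG L" "u \<in> Dom A g" for g u
    using that coord_tau[of "pt g u" g u] by (simp_all add: field_rep_def ch_inv F H)
  let ?b = "\<lambda>c. differential (V_module L) (V_module L) (snd c ` fst c) (field_rep H c) (snd c p) (field_rep F c (snd c p))
            - differential (V_module L) (V_module L) (snd c ` fst c) (field_rep F c) (snd c p) (field_rep H c (snd c p))"
  have b: "?b (ch A g) = xi g x (- (X \<star> Y))" if g: "g \<in> GG L" "x \<in> g1" "p = pt g x" for g x
  proof -
    have xD: "x \<in> Dom A g" using Dom_p[OF p] g by blast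
    have s: "snd (ch A g) p = x" using g by (simp add: ch_snd)
    let ?X = "ex (- x) (inv g X)" and ?Y = "ex (- x) (inv g Y)"
    have a: "aut (inv g)" "aut (ex (- x))" using g by (auto intro: aut_inv GG_aut exp_aut gr_closed)
    have "?b (ch A g) = - p1 (p1 ?X \<star> ?Y) + p1 (p1 ?Y \<star> ?X)"
      unfolding ch_img[OF g(1)] s rep[OF g(1) xD]
      using xi_differential[OF g(1) Y xD xi_in rep(2)[OF g(1)]] xi_differential[OF g(1) X xD xi_in rep(1)[OF g(1)]]
      by (simp add: xi_def)
    also have "\<dots> = - p1 (?X \<star> ?Y)" using br_anti[of "p1 ?Y" "p0 ?X"] by (simp add: p_br)
    also have "\<dots> = xi g x (- (X \<star> Y))" by (simp add: xi_def autD[OF a(1)] autD[OF a(2)])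
    finally show ?thesis .
  qed
  have "snd (lie_bracket (mf A) F H p) = snd (tau A p (- (X \<star> Y)))"
    unfolding lie_bracket_def mf_simps(1) snd_conv by (rule tau_comprehension[OF p, of ?b, OF b])
  then show ?thesis by (intro prod_eqI) (simp_all add: lie_bracket_def)
qed

end
end

section \<open>The multiplication map\<close>

context graded_setting begin

lemma tw_ex: assumes a: "a \<in> GG L" and u: "u \<in> g1" shows "tw (a \<circ> ex u) = ex (- \<theta> u) \<circ> tw a \<circ> ex u"
proof -
  have i: "inv (a \<circ> ex u) = ex (- u) \<circ> inv a"
    by (rule inv_equality) (use a u in \<open>auto simp: ex_cancel GG_cancel\<close>)
  show ?thesis unfolding tw_def i by (auto simp: theta_ex)
qed

text \<open>Moving the middle \<open>\<delta>\<close> of \<open>g \<delta> g\<^sup>-\<^sup>1\<close> to the right end inverts the exponentials that it passes.  There it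
  acts trivially on \<open>o\<^sup>+\<close>, and what remains is a product of elements of \<open>G\<close>.\<close>

lemma sy_product:
  assumes a: "a \<in> GG L" and b: "b \<in> GG L" and u: "u \<in> g1" and y: "y \<in> gm" and v: "v \<in> g1"
  shows "act (sy (a \<circ> ex u \<circ> ex y)) (act (b \<circ> ex v) base) =
    act (a \<circ> ex u \<circ> ex (y + y) \<circ> ex u \<circ> (\<delta> \<circ> (inv a \<circ> b) \<circ> \<delta>) \<circ> ex (- v)) base"
proof -
  have i: "inv (a \<circ> ex u \<circ> ex y) = ex (- y) \<circ> ex (- u) \<circ> inv a"
    by (rule inv_equality) (use a u y in \<open>auto simp: ex_cancel GG_cancel\<close>)
  have d: "\<delta> (ex x Z) = ex (- x) (\<delta> Z)" if "x \<in> g1 \<union> gm" for x Z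
    using aut_ex[OF delta_aut] that by (simp add: delta_gr)
  have yy: "ex (y + y) Z = ex y (ex y Z)" for Z using ex_add[of y y] y by simp
  have m: "- y \<in> g1 \<union> gm" "- u \<in> g1 \<union> gm" "- v \<in> g1 \<union> gm" using u y v by (auto simp: gr_closed)
  have "sy (a \<circ> ex u \<circ> ex y) \<circ> (b \<circ> ex v) =
      (a \<circ> ex u \<circ> ex (y + y) \<circ> ex u \<circ> (\<delta> \<circ> (inv a \<circ> b) \<circ> \<delta>) \<circ> ex (- v)) \<circ> \<delta>"
    unfolding sy_def i by (rule ext) (simp add: d[OF m(1)] d[OF m(2)] d[OF m(3)] yy)
  then show ?thesis by (simp only: act_comp[symmetric]) (simp only: act_comp degree_zero_base[OF delta_degree_zero])
qed

text \<open>Let \<open>\<alpha> = a e\<^sup>u = \<gamma> e\<^sup>-\<^sup>y\<close> fix \<open>o\<^sup>+\<close>.  When \<open>u\<close> moves with velocity \<open>v\<close>, the coordinate of \<open>X\<close>, then \<open>y\<close> moves with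
  velocity \<open>\<theta> z'\<close>, and the sum is the logarithmic derivative of \<open>a e\<^sup>u e\<^sup>2\<^sup>y e\<^sup>u\<close>.  The terms
  quadratic in \<open>y\<close> cancel against those of \<open>\<theta> z'\<close>.\<close>

lemma tilde_algebra:
  assumes \<gamma>: "degree_zero \<gamma>" and y: "y \<in> gm" and X: "X \<in> g1" and \<alpha>: "\<alpha> = \<gamma> \<circ> ex (- y)"
    and v: "v = p1 (inv \<alpha> X)" and z': "z' = p1 (ex (- \<theta> y) (- \<theta> v + \<theta> (inv \<alpha> (\<theta> (\<alpha> v)))))"
  shows "\<alpha> v + \<alpha> (\<theta> z' + \<theta> z') + \<alpha> (ex (y + y) v) = (X + \<theta> X) + (X + \<theta> X)"
proof -
  note A = degree_zeroD(1)[OF \<gamma>] and AI = aut_inv[OF degree_zeroD(1)[OF \<gamma>]]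
  note \<gamma>i = degree_zero_inv[OF \<gamma>]
  have my: "- y \<in> gm" "y + y \<in> gm" using y by (simp_all add: gr_closed)
  have i: "inv \<alpha> = ex y \<circ> inv \<gamma>" unfolding \<alpha>
    by (rule inv_equality) (use y in \<open>auto simp: ex_cancel autD[OF A]\<close>)
  have av: "\<alpha> w = \<gamma> (ex (- y) w)" for w by (simp add: \<alpha>)
  have v': "v = inv \<gamma> X" unfolding v i
    using y X degree_zeroD(5)[OF \<gamma>i X] by (simp add: p_ex_minus p_gr)
  then have v1: "v \<in> g1" using degree_zeroD(5)[OF \<gamma>i X] by simp
  have gv: "\<gamma> v = X" using v' autD(10)[OF A] by simp
  have "\<theta> z' = pm (ex (- y) (- v + inv \<alpha> (\<theta> (\<alpha> v))))"
    unfolding z' by (simp add: theta_p(3)[symmetric] theta_ex)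
  also have "\<dots> = - pm (ex (- y) v) + pm (inv \<gamma> (\<theta> (\<gamma> (ex (- y) v))))"
    using y by (simp add: i av ex_lin ex_cancel)
  also have "pm (ex (- y) v) = half \<cdot> (y \<star> y \<star> v)" using my v1 by (simp add: p_ex_minus p_gr)
  also have "pm (inv \<gamma> (\<theta> (\<gamma> (ex (- y) v)))) = inv \<gamma> (\<theta> (\<gamma> (p1 (ex (- y) v))))"
    by (simp add: degree_zeroD(2,4)[OF \<gamma>] degree_zeroD(4)[OF \<gamma>i] theta_p)
  also have "\<dots> = inv \<gamma> (\<theta> X)" using my v1 by (simp add: p_ex_minus p_gr gv)
  finally have z: "\<theta> z' = - half \<cdot> (y \<star> y \<star> v) + inv \<gamma> (\<theta> X)" by simp
  have "\<theta> z' \<in> gm" unfolding z' by (simp add: theta_in)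
  then have ez: "ex (- y) (\<theta> z' + \<theta> z') = \<theta> z' + \<theta> z'" using my y by (intro ex_same(2) gr_closed) simp_all
  have ey: "ex (- y) (ex (y + y) v) = ex y v" using ex_add[of "- y" "y + y"] y my by (simp add: fun_eq_iff)
  have "ex (- y) v + ex y v = v + v + y \<star> y \<star> v"
    using half_add[of "y \<star> y \<star> v"] by (simp add: exp_ad_def algebra_simps)
  moreover have "\<theta> z' + \<theta> z' = - (y \<star> y \<star> v) + (inv \<gamma> (\<theta> X) + inv \<gamma> (\<theta> X))"
    using half_add[of "y \<star> y \<star> v"] by (simp add: z algebra_simps)
  ultimately have e: "ex (- y) v + (\<theta> z' + \<theta> z') + ex y v = (v + v) + (inv \<gamma> (\<theta> X) + inv \<gamma> (\<theta> X))"
    by (simp add: algebra_simps)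
  have "\<alpha> v + \<alpha> (\<theta> z' + \<theta> z') + \<alpha> (ex (y + y) v) = \<gamma> (ex (- y) v + (\<theta> z' + \<theta> z') + ex y v)"
    by (simp add: av ez ey autD(2)[OF A])
  also have "\<dots> = (X + \<theta> X) + (X + \<theta> X)" unfolding e by (simp add: autD(2,10)[OF A] gv algebra_simps)
  finally show ?thesis .
qed

end

context C1_calculus begin

subsection \<open>Words with constant letters\<close>

text \<open>A fixed element of \<open>G\<close> as a word, with a choice of its letters.\<close>

definition kl :: "('g \<Rightarrow> 'g) \<Rightarrow> ((('k, 'e) iter \<Rightarrow> 'g) \<times> (('k, 'e) iter \<Rightarrow> 'g)) list" where
  "kl k = map (\<lambda>c. (\<lambda>_. c, \<lambda>_. 0)) (SOME l. word l \<and> k = W l)"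

lemma kl: 
  assumes k: "k \<in> GG L"
  shows kl_W: "W (map (\<lambda>q. fst q s) (kl k)) = k" and kl_letter: "\<forall>q\<in>set (kl k). letter U (fst q) (snd q)"
    and kl_lam: "lam (map (\<lambda>q. (fst q s, snd q N)) (kl k) @ m) = k (lam m)"
proof -
  let ?l = "SOME l. word l \<and> k = W l"
  have "\<exists>l. word l \<and> k = W l" using GG_W[OF k] by blast
  from someI_ex[OF this] have l: "word ?l" "k = W ?l" by blast+
  show "W (map (\<lambda>q. fst q s) (kl k)) = k" using l(2) by (simp add: kl_def comp_def)
  show "\<forall>q\<in>set (kl k). letter U (fst q) (snd q)" using l(1) letter_const[of _ U] by (auto simp: kl_def)
  from lam_const[of ?l m] show "lam (map (\<lambda>q. (fst q s, snd q N)) (kl k) @ m) = k (lam m)" 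
    using l(2) by (simp add: kl_def comp_def)
qed

subsection \<open>The opposite coordinate of the polar point\<close>

text \<open>For \<open>u\<close> the coordinate of a point in the chart of \<open>a\<close>, this is a word for \<open>\<theta> (a e\<^sup>u)\<^sup>-\<^sup>1 \<theta> a e\<^sup>u\<close>, whose value at \<open>o\<^sup>+\<close>
  decides whether the point is non-isotropic.\<close>

definition twl :: "('g \<Rightarrow> 'g) \<Rightarrow> (('k, 'e) iter \<Rightarrow> 'g) \<Rightarrow> (('k, 'e) iter \<Rightarrow> 'g) \<Rightarrow>
    ((('k, 'e) iter \<Rightarrow> 'g) \<times> (('k, 'e) iter \<Rightarrow> 'g)) list" where
  "twl a u du = (\<lambda>s. - \<theta> (u s), \<lambda>N. - \<theta> (du N)) # kl (tw a) @ [(u, du)]"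

lemma twl:
  assumes a: "a \<in> GG L"
  shows twl_letter: "letter U u du \<Longrightarrow> \<forall>q\<in>set (twl a u du). letter U (fst q) (snd q)"
    and twl_W: "u s \<in> g1 \<Longrightarrow> W (map (\<lambda>q. fst q s) (twl a u du)) = tw (a \<circ> ex (u s))"
    and twl_lam: "lam (map (\<lambda>q. (fst q s, snd q N)) (twl a u du)) = - \<theta> (du N) + ex (- \<theta> (u s)) (tw a (du N))"
proof -
  note t = tw_GG[OF a]
  show "letter U u du \<Longrightarrow> \<forall>q\<in>set (twl a u du). letter U (fst q) (snd q)"
    using kl_letter[OF t, of U] letter_minus[OF letter_theta, of U u du] by (auto simp: twl_def)
  show "u s \<in> g1 \<Longrightarrow> W (map (\<lambda>q. fst q s) (twl a u du)) = tw (a \<circ> ex (u s))"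
    unfolding twl_def list.map map_append W.simps W_append kl_W[OF t] fst_conv tw_ex[OF a] by (simp add: o_assoc)
  show "lam (map (\<lambda>q. (fst q s, snd q N)) (twl a u du)) = - \<theta> (du N) + ex (- \<theta> (u s)) (tw a (du N))"
    unfolding twl_def list.map map_append lam.simps kl_lam[OF t] fst_conv snd_conv by simp
qed

text \<open>The word of \<open>sy_product\<close> with \<open>y = \<theta> z\<close>, seen in the chart of \<open>c\<close>.  Each letter is paired with its
  difference quotient.\<close>

definition mul :: "('g \<Rightarrow> 'g) \<Rightarrow> ('g \<Rightarrow> 'g) \<Rightarrow> ('g \<Rightarrow> 'g) \<Rightarrow>
    (('k, 'e) iter \<Rightarrow> 'g) \<Rightarrow> (('k, 'e) iter \<Rightarrow> 'g) \<Rightarrow> (('k, 'e) iter \<Rightarrow> 'g) \<Rightarrow> (('k, 'e) iter \<Rightarrow> 'g) \<Rightarrow>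
    (('k, 'e) iter \<Rightarrow> 'g) \<Rightarrow> (('k, 'e) iter \<Rightarrow> 'g) \<Rightarrow>
    ((('k, 'e) iter \<Rightarrow> 'g) \<times> (('k, 'e) iter \<Rightarrow> 'g)) list" where
  "mul c a b u du z dz v dv = kl (inv c \<circ> a) @
     (u, du) # (\<lambda>s. \<theta> (z s) + \<theta> (z s), \<lambda>N. \<theta> (dz N) + \<theta> (dz N)) # (u, du) #
     kl (\<delta> \<circ> (inv a \<circ> b) \<circ> \<delta>) @ [(\<lambda>s. - v s, \<lambda>N. - dv N)]"

lemma mul:
  assumes c: "c \<in> GG L" and a: "a \<in> GG L" and b: "b \<in> GG L"
  shows mul_letter: "letter U u du \<Longrightarrow> letter U z dz \<Longrightarrow> letter U v dv \<Longrightarrow> 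
      \<forall>q\<in>set (mul c a b u du z dz v dv). letter U (fst q) (snd q)"
    and mul_W: "W (map (\<lambda>q. fst q s) (mul c a b u du z dz v dv)) =
      inv c \<circ> (a \<circ> ex (u s) \<circ> ex (\<theta> (z s) + \<theta> (z s)) \<circ> ex (u s) \<circ> (\<delta> \<circ> (inv a \<circ> b) \<circ> \<delta>) \<circ> ex (- v s))"
    and mul_lam: "dv N = 0 \<Longrightarrow> lam (map (\<lambda>q. (fst q s, snd q N)) (mul c a b u du z dz v dv)) =
      inv c (a (du N + ex (u s) ((\<theta> (dz N) + \<theta> (dz N)) + ex (\<theta> (z s) + \<theta> (z s)) (du N))))"
proof -
  have G: "inv c \<circ> a \<in> GG L" "\<delta> \<circ> (inv a \<circ> b) \<circ> \<delta> \<in> GG L" using a b c by (auto intro!: delta_GG GG.intros)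
  show "letter U u du \<Longrightarrow> letter U z dz \<Longrightarrow> letter U v dv \<Longrightarrow> 
      \<forall>q\<in>set (mul c a b u du z dz v dv). letter U (fst q) (snd q)"
    using kl_letter[OF G(1), of U] kl_letter[OF G(2), of U] letter_minus[of U v dv] letter_double[OF letter_theta, of U z dz]
    by (auto simp: mul_def)
  show "W (map (\<lambda>q. fst q s) (mul c a b u du z dz v dv)) =
      inv c \<circ> (a \<circ> ex (u s) \<circ> ex (\<theta> (z s) + \<theta> (z s)) \<circ> ex (u s) \<circ> (\<delta> \<circ> (inv a \<circ> b) \<circ> \<delta>) \<circ> ex (- v s))"
    unfolding mul_def list.map map_append W.simps W_append kl_W[OF G(1)] kl_W[OF G(2)] fst_conv by (simp add: o_assoc)
  show "dv N = 0 \<Longrightarrow> lam (map (\<lambda>q. (fst q s, snd q N)) (mul c a b u du z dz v dv)) =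
      inv c (a (du N + ex (u s) ((\<theta> (dz N) + \<theta> (dz N)) + ex (\<theta> (z s) + \<theta> (z s)) (du N))))"
    unfolding mul_def list.map map_append lam.simps kl_lam[OF G(1)] kl_lam[OF G(2)] fst_conv snd_conv
    by (simp add: autD[OF GG_aut[OF a]] autD(7)[OF GG_aut[OF b]] autD(7)[OF delta_aut] autD(7)[OF aut_inv[OF GG_aut[OF a]]])
qed

end

section \<open>The symmetric space\<close>

context C1_setting begin

abbreviation MM :: "'g flag set" where "MM \<equiv> non_isotropic L"
abbreviation V2m :: "('k, 'g \<times> 'g) tmodule" where "V2m \<equiv> prod_module (V_module L) (V_module L)"

lemma V2_mod: "topological_module V2m" by (rule topological_module_prod[OF V_mod V_mod])

interpretation V: C1_calculus L "V_module L" by unfold_locales (rule V_mod)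
interpretation V2: C1_calculus L V2m by unfold_locales (rule V2_mod)

lemma V2_top: "mod_top V2m = prod_topology Vt Vt" by (simp add: prod_module_def)
lemma V2_carr: "carr V2m = g1 \<times> g1" by (simp add: V2_top)
lemma V2_scal: "scal V2m t x = (t \<cdot> fst x, t \<cdot> snd x)"
proof -
  interpret p: module_prod "smul L" "smul L" by (simp add: module_prod_def module_pair_def module_axioms)
  show ?thesis by (cases x) (simp add: prod_module_def p.scale_prod)
qed

lemma g1_open: "openin Vt g1" by (metis openin_topspace topspace_V)

lemma pt_MM: assumes "g \<in> GG L" "x \<in> g1"
  shows "pt g x \<in> MM \<longleftrightarrow> (\<exists>z\<in>g1. act (tw (g \<circ> ex x)) base = embed_V L z)"
  unfolding pt_base using non_isotropic_iff[OF GG.mult[OF assms(1) GG_ex(1)[OF assms(2)]]] .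

lemma M_open: "openin (X_top L) MM"
  unfolding openin_X
proof (intro conjI ballI)
  show "MM \<subseteq> X_plus L" by (simp add: non_isotropic_def)
  fix g assume g: "g \<in> GG L"
  have U: "openin (mod_top (V_module L)) g1" using g1_open by simp
  let ?u = "\<lambda>s :: ('k, 'g) iter. leaf s" and ?du = "\<lambda>N :: ('k, 'g) iter. leaf (dir N)"
  have l: "V.letter g1 ?u ?du" by (rule V.letter_linear[OF U]) auto
  have "{x \<in> g1. pt g x \<in> MM} = {x \<in> g1. \<exists>y\<in>g1. act (V.wd (V.twl g ?u ?du) x) base = embed_V L y}"
    using pt_MM[OF g] V.twl_W[OF g, of ?u "Leaf _" ?du] by (intro Collect_cong conj_cong refl) simp
  then show "openin Vt {x \<in> g1. pt g x \<in> MM}"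
    using V.open_coordinate[OF U V.twl_letter[OF g l]] by simp
qed

text \<open>By \<open>tw_frame\<close>, \<open>\<theta> (zc a u)\<close> is the coordinate of the polar of the point \<open>a e\<^sup>u.o\<^sup>+\<close> in the
  opposite chart of \<open>a e\<^sup>u\<close>.\<close>

definition zc :: "('g \<Rightarrow> 'g) \<Rightarrow> 'g \<Rightarrow> 'g" where
  "zc a u = (SOME z. z \<in> g1 \<and> act (tw (a \<circ> ex u)) base = embed_V L z)"

lemma zc: assumes "a \<in> GG L" "u \<in> Dom MM a"
  shows "zc a u \<in> g1 \<and> act (tw (a \<circ> ex u)) base = embed_V L (zc a u)"
proof -
  have "\<exists>z. z \<in> g1 \<and> act (tw (a \<circ> ex u)) base = embed_V L z" using pt_MM[OF assms(1)] assms(2) by blast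
  from someI_ex[OF this] show ?thesis unfolding zc_def .
qed

lemma zc_frame:
  assumes a: "a \<in> GG L" and u: "u \<in> Dom MM a"
  shows "frame (pt a u) (a \<circ> ex u \<circ> ex (\<theta> (zc a u)))"
proof -
  have u1: "u \<in> g1" using u by blast
  have G: "a \<circ> ex u \<in> GG L" by (rule GG.mult[OF a GG_ex(1)[OF u1]])
  show ?thesis unfolding pt_base using tw_frame[OF G] zc[OF a u] by blast
qed

abbreviation mm :: "'g flag \<Rightarrow> 'g flag \<Rightarrow> 'g flag" where "mm \<equiv> M_mult L"

lemma mm_pt:
  assumes a: "a \<in> GG L" and b: "b \<in> GG L" and u: "u \<in> Dom MM a" and v: "v \<in> g1"
  shows "mm (pt a u) (pt b v) = act (a \<circ> ex u \<circ> ex (\<theta> (zc a u) + \<theta> (zc a u)) \<circ> ex u \<circ> (\<delta> \<circ> (inv a \<circ> b) \<circ> \<delta>) \<circ> ex (- v)) base"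
proof -
  have u1: "u \<in> g1" using u by blast
  have z: "\<theta> (zc a u) \<in> gm" using zc[OF a u] by (simp add: theta_in)
  show ?thesis unfolding M_mult_frame[OF zc_frame[OF a u]] unfolding pt_base by (rule sy_product[OF a b u1 z v])
qed

lemma act_pt: assumes "c \<in> GG L" shows "act g base = pt c w \<longleftrightarrow> act (inv c \<circ> g) base = embed_V L w"
  unfolding pt_def act_comp using act_inv[OF GG_aut[OF assms], of "embed_V L w" "act g base"] by (metis (no_types))

subsection \<open>Local formula for the multiplication\<close>

abbreviation DD :: "('g \<Rightarrow> 'g) \<Rightarrow> ('g \<Rightarrow> 'g) \<Rightarrow> ('g \<times> 'g) set" where "DD a b \<equiv> Dom MM a \<times> Dom MM b"

definition MD :: "('g \<Rightarrow> 'g) \<Rightarrow> ('g \<Rightarrow> 'g) \<Rightarrow> ('g \<Rightarrow> 'g) \<Rightarrow> ('g \<times> 'g) set" where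
  "MD a b c = {x \<in> DD a b. \<exists>w\<in>g1. mm (pt a (fst x)) (pt b (snd x)) = pt c w}"

lemma MD_sub: "MD a b c \<subseteq> DD a b" unfolding MD_def by blast

context
  fixes a b c assumes a: "a \<in> GG L" and b: "b \<in> GG L" and c: "c \<in> GG L"
begin

abbreviation (input) "uu \<equiv> (\<lambda>s :: ('k, 'g \<times> 'g) iter. fst (leaf s))"
abbreviation (input) "duu \<equiv> (\<lambda>N :: ('k, 'g \<times> 'g) iter. fst (leaf (dir N)))"
abbreviation (input) "vv \<equiv> (\<lambda>s :: ('k, 'g \<times> 'g) iter. snd (leaf s))"
abbreviation (input) "dvv \<equiv> (\<lambda>N :: ('k, 'g \<times> 'g) iter. snd (leaf (dir N)))"
abbreviation (input) "zz \<equiv> (\<lambda>s :: ('k, 'g \<times> 'g) iter. zc a (fst (leaf s)))"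
abbreviation (input) "ml \<equiv> V2.mul c a b uu duu zz (V2.zq (V2.twl a uu duu) zz) vv dvv"

lemma DD_open: "openin (mod_top V2m) (DD a b)"
  unfolding V2_top using Dom_open[OF M_open a] Dom_open[OF M_open b] by (simp add: openin_prod_Times_iff)

lemma uv_letter: 
  assumes "openin (mod_top V2m) U" shows "V2.letter U uu duu" "V2.letter U vv dvv"
  by (rule V2.letter_linear[OF assms]; auto simp: V2_scal V2_top continuous_map_fst continuous_map_snd)+

lemma zz_coord: "x \<in> DD a b \<Longrightarrow> zc a (fst x) \<in> g1 \<and> act (V2.wd (V2.twl a uu duu) x) base = embed_V L (zc a (fst x))"
  using zc[OF a, of "fst x"] V2.twl_W[OF a, of uu "Leaf x" duu] by auto

lemma zz_letter:
  assumes U: "openin (mod_top V2m) U" and sub: "U \<subseteq> DD a b"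
  shows "V2.letter U zz (V2.zq (V2.twl a uu duu) zz)"
  by (rule V2.letter_point[OF U V2.twl_letter[OF a uv_letter(1)[OF U]] zz_coord]) (use sub in blast)

lemma ml_letter:
  assumes "openin (mod_top V2m) U" and "U \<subseteq> DD a b"
  shows "\<forall>q\<in>set ml. V2.letter U (fst q) (snd q)"
  by (rule V2.mul_letter[OF c a b uv_letter(1)[OF assms(1)] zz_letter[OF assms] uv_letter(2)[OF assms(1)]])

lemma ml_W: 
  assumes "x \<in> DD a b" and w: "w \<in> g1"
  shows "act (V2.wd ml x) base = embed_V L w \<longleftrightarrow> mm (pt a (fst x)) (pt b (snd x)) = pt c w"
proof -
  have "fst x \<in> Dom MM a" "snd x \<in> g1" using assms by auto
  from mm_pt[OF a b this] show ?thesis unfolding V2.mul_W[OF c a b] using act_pt[OF c] by simp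
qed

lemma MD_eq: "MD a b c = {x \<in> DD a b. \<exists>w\<in>g1. act (V2.wd ml x) base = embed_V L w}"
  unfolding MD_def using ml_W by blast

lemma MD_open: "openin (mod_top V2m) (MD a b c)"
  unfolding MD_eq by (rule V2.open_coordinate[OF DD_open ml_letter[OF DD_open subset_refl]])

context
  fixes f assumes f: "\<And>x. x \<in> MD a b c \<Longrightarrow> f x \<in> g1 \<and> mm (pt a (fst x)) (pt b (snd x)) = pt c (f x)"
begin

lemma f_coord: "x \<in> MD a b c \<Longrightarrow> f x \<in> g1 \<and> act (V2.wd ml x) base = embed_V L (f x)"
  using f ml_W MD_sub by blast

lemma mm_smooth: "smooth_on V2m (V_module L) (MD a b c) f"
  by (rule V2.smooth_family[OF MD_open ml_letter[OF MD_open MD_sub] f_coord])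

text \<open>Only the first factor moves.  The velocity \<open>z'\<close> of \<open>zc a u\<close> comes from the word that defines \<open>zc\<close>.\<close>

lemma mm_differential:
  assumes x: "x \<in> MD a b c" and v: "v \<in> g1"
  shows "differential V2m (V_module L) (MD a b c) f x (v, 0) =
    (let u = fst x; z = zc a u; z' = p1 (ex (- z) (- \<theta> v + ex (- \<theta> u) (tw a v)))
     in xi c (f x) (a (v + ex u ((\<theta> z' + \<theta> z') + ex (\<theta> z + \<theta> z) v))))"
proof -
  let ?N = "Node (Leaf x) (Leaf (v, 0)) 0"
  have vc: "(v, 0) \<in> carr V2m" using v by (simp add: V2_carr)
  have xD: "x \<in> DD a b" using x MD_sub by blast
  have dz: "V2.zq (V2.twl a uu duu) zz ?N = p1 (ex (- zc a (fst x)) (- \<theta> v + ex (- \<theta> (fst x)) (tw a v)))"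
    using V2.zq_family[OF DD_open V2.twl_letter[OF a uv_letter(1)[OF DD_open]] zz_coord xD vc]
    by (simp only: V2.twl_lam[OF a]) simp
  have "differential V2m (V_module L) (MD a b c) f x (v, 0) = p1 (ex (- f x) (lam (map (\<lambda>q. (fst q (Leaf x), snd q ?N)) ml)))"
    by (rule V2.differential_family[OF MD_open ml_letter[OF MD_open MD_sub] f_coord x vc])
  also have "lam (map (\<lambda>q. (fst q (Leaf x), snd q ?N)) ml) = (let u = fst x; z = zc a u; z' = p1 (ex (- z) (- \<theta> v + ex (- \<theta> u) (tw a v)))
     in inv c (a (v + ex u ((\<theta> z' + \<theta> z') + ex (\<theta> z + \<theta> z) v))))"
    using V2.mul_lam[OF c a b, where dv=dvv and N="?N" and u=uu and s="Leaf x" and du=duu and z=zz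
      and dz="V2.zq (V2.twl a uu duu) zz" and v=vv]
    unfolding dz Let_def by simp
  finally show ?thesis by (simp add: Let_def xi_def)
qed

end
end

subsection \<open>Charts of the product\<close>

lemma MM_X: "p \<in> MM \<Longrightarrow> p \<in> X_plus L" by (simp add: non_isotropic_def)

abbreviation PM :: "('k, 'g \<times> 'g, 'g flag \<times> 'g flag) mfd" where "PM \<equiv> prod_mfd (mf MM) (mf MM)"
abbreviation mp :: "'g flag \<times> 'g flag \<Rightarrow> 'g flag" where "mp \<equiv> (\<lambda>(x, y). mm x y)"
abbreviation pc :: "('g \<Rightarrow> 'g) \<Rightarrow> ('g \<Rightarrow> 'g) \<Rightarrow> ('g flag \<times> 'g flag, 'g \<times> 'g) chart" where
  "pc a b \<equiv> prod_chart (ch MM a) (ch MM b)"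

lemma pc_fst: "fst (pc a b) = fst (ch MM a) \<times> fst (ch MM b)"
  and pc_snd: "snd (pc a b) (p, q) = (snd (ch MM a) p, snd (ch MM b) q)"
  by (simp_all add: prod_chart_def)

lemma pc_inv:
  assumes a: "a \<in> GG L" and b: "b \<in> GG L" and x: "x \<in> DD a b"
  shows "chart_inv (pc a b) x = (pt a (fst x), pt b (snd x))"
  unfolding chart_inv_def
proof (rule the_inv_into_f_eq)
  have x': "fst x \<in> Dom MM a" "snd x \<in> Dom MM b" using x by auto
  then have x1: "fst x \<in> g1" "snd x \<in> g1" by blast+
  show "snd (pc a b) (pt a (fst x), pt b (snd x)) = x"
    unfolding pc_snd using ch_snd[OF a x1(1), of MM] ch_snd[OF b x1(2), of MM] by simp
  show "(pt a (fst x), pt b (snd x)) \<in> fst (pc a b)" unfolding pc_fst ch_fst using x' by blast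
  show "inj_on (snd (pc a b)) (fst (pc a b))"
  proof (rule inj_onI)
    fix p q assume p: "p \<in> fst (pc a b)" and q: "q \<in> fst (pc a b)" and e: "snd (pc a b) p = snd (pc a b) q"
    obtain u v where u: "u \<in> g1" "v \<in> g1" "p = (pt a u, pt b v)" using p unfolding pc_fst ch_fst by blast
    obtain u' v' where u': "u' \<in> g1" "v' \<in> g1" "q = (pt a u', pt b v')" using q unfolding pc_fst ch_fst by blast
    have "(u, v) = (u', v')" using e unfolding u(3) u'(3) pc_snd
      ch_snd[OF a u(1)] ch_snd[OF b u(2)] ch_snd[OF a u'(1)] ch_snd[OF b u'(2)] .
    then show "p = q" using u u' by simp
  qed
qed

lemma pc_loc_dom:
  assumes a: "a \<in> GG L" and b: "b \<in> GG L" and c: "c \<in> GG L"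
  shows "loc_dom (pc a b) mp (ch MM c) = MD a b c"
proof (intro equalityI subsetI)
  fix x assume "x \<in> loc_dom (pc a b) mp (ch MM c)"
  then obtain P where P: "x = snd (pc a b) P" "P \<in> fst (pc a b)" "mp P \<in> fst (ch MM c)" unfolding loc_dom_def by blast
  obtain u v where u: "u \<in> Dom MM a" "v \<in> Dom MM b" "P = (pt a u, pt b v)" using P(2) unfolding pc_fst ch_fst by blast
  have u1: "u \<in> g1" "v \<in> g1" using u by blast+
  have xe: "x = (u, v)" using P(1) unfolding u(3) pc_snd ch_snd[OF a u1(1)] ch_snd[OF b u1(2)] .
  obtain w where "w \<in> g1" "mp P = pt c w" using P(3) unfolding ch_mem by blast
  then have "\<exists>w\<in>g1. mm (pt a u) (pt b v) = pt c w" unfolding u(3) by auto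
  then show "x \<in> MD a b c" unfolding MD_def xe using u by simp
next
  fix x assume "x \<in> MD a b c"
  then obtain w where x: "x \<in> DD a b" "w \<in> g1" "mm (pt a (fst x)) (pt b (snd x)) = pt c w" unfolding MD_def by blast
  let ?P = "(pt a (fst x), pt b (snd x))"
  have x': "fst x \<in> Dom MM a" "snd x \<in> Dom MM b" using x(1) by auto
  then have x1: "fst x \<in> g1" "snd x \<in> g1" and xM: "pt a (fst x) \<in> MM" "pt b (snd x) \<in> MM" by blast+
  have "x = snd (pc a b) ?P"
    unfolding pc_snd using ch_snd[OF a x1(1), of MM] ch_snd[OF b x1(2), of MM] by simp
  moreover have "?P \<in> fst (pc a b)" unfolding pc_fst ch_fst using x' by blast
  moreover have "mp ?P \<in> fst (ch MM c)"
    using M_mult_closed[OF xM] x(2,3) unfolding ch_mem by auto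
  ultimately show "x \<in> loc_dom (pc a b) mp (ch MM c)" unfolding loc_dom_def by blast
qed

lemma pc_loc_rep:
  assumes a: "a \<in> GG L" and b: "b \<in> GG L" and c: "c \<in> GG L" and x: "x \<in> MD a b c"
  shows "loc_rep (pc a b) mp (ch MM c) x \<in> g1 \<and> mm (pt a (fst x)) (pt b (snd x)) = pt c (loc_rep (pc a b) mp (ch MM c) x)"
proof -
  obtain w where w: "x \<in> DD a b" "w \<in> g1" "mm (pt a (fst x)) (pt b (snd x)) = pt c w" using x unfolding MD_def by blast
  have "loc_rep (pc a b) mp (ch MM c) x = w"
    unfolding loc_rep_def pc_inv[OF a b w(1)] prod.case w(3) by (rule ch_snd[OF c w(2)])
  then show ?thesis using w by simp
qed

lemma PM_simps: "model PM = V2m" "mfd_top PM = prod_topology (subtopology (X_top L) MM) (subtopology (X_top L) MM)"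
  "c \<in> atlas PM \<longleftrightarrow> (\<exists>a\<in>GG L. \<exists>b\<in>GG L. c = pc a b)"
proof -
  show "model PM = V2m" "mfd_top PM = prod_topology (subtopology (X_top L) MM) (subtopology (X_top L) MM)"
    by (simp_all add: prod_mfd_def mf_simps)
  have "atlas PM = {prod_chart c c' | c c'. c \<in> ch MM ` GG L \<and> c' \<in> ch MM ` GG L}" by (simp add: prod_mfd_def mf_simps(3))
  then show "c \<in> atlas PM \<longleftrightarrow> (\<exists>a\<in>GG L. \<exists>b\<in>GG L. c = pc a b)" by blast
qed

lemma topspace_MM: "topspace (subtopology (X_top L) MM) = MM"
  using openin_subset[OF M_open] by auto

lemma MM_pt: assumes "p \<in> MM" obtains a u where "a \<in> GG L" "u \<in> Dom MM a" "p = pt a u" "u = 0"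
proof -
  obtain g where g: "g \<in> GG L" "p = pt g 0" using X_pt[OF MM_X[OF assms]] by blast
  show ?thesis by (rule that[OF g(1) _ g(2)]) (use assms g in auto)
qed

text \<open>Products of chart domains are open and cover \<open>M \<times> M\<close>, and smooth maps are continuous in charts.\<close>

lemma mp_continuous:
  "continuous_map (prod_topology (subtopology (X_top L) MM) (subtopology (X_top L) MM)) (subtopology (X_top L) MM) mp"
  (is "continuous_map (prod_topology ?T ?T) ?T mp")
  unfolding continuous_map_def topspace_prod_topology topspace_MM
proof (intro conjI allI impI)
  show "mp \<in> MM \<times> MM \<rightarrow> MM" using M_mult_closed by auto
  fix O' assume O': "openin ?T O'"
  then have O: "openin (X_top L) O'" "O' \<subseteq> MM" using openin_open_subtopology[OF M_open] by blast+
  show "openin (prod_topology ?T ?T) {P \<in> MM \<times> MM. mp P \<in> O'}"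
  proof (subst openin_subopen, intro ballI)
    fix P assume P: "P \<in> {P \<in> MM \<times> MM. mp P \<in> O'}"
    obtain p q where pq: "P = (p, q)" by (cases P)
    have M: "p \<in> MM" "q \<in> MM" "mm p q \<in> O'" using P by (simp_all add: pq)
    obtain a u where a: "a \<in> GG L" "u \<in> Dom MM a" "p = pt a u" using M(1) by (rule MM_pt)
    obtain b v where b: "b \<in> GG L" "v \<in> Dom MM b" "q = pt b v" using M(2) by (rule MM_pt)
    obtain c w where c: "c \<in> GG L" "w \<in> Dom MM c" "mm p q = pt c w" using M_mult_closed[OF M(1,2)] by (rule MM_pt)
    let ?f = "loc_rep (pc a b) mp (ch MM c)" and ?D = "MD a b c"
    have D: "openin (prod_topology Vt Vt) ?D" using MD_open[OF a(1) b(1) c(1)] by (simp add: V2_top)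
    have uv: "(u, v) \<in> ?D" unfolding MD_def using a b c by auto
    have fc: "continuous_map (subtopology (prod_topology Vt Vt) ?D) Vt ?f"
      using smooth_on_continuous[OF V2_mod mm_smooth[OF a(1) b(1) c(1) pc_loc_rep[OF a(1) b(1) c(1)]]] by (simp add: V2_top)
    let ?O = "{w \<in> g1. pt c w \<in> O'}"
    have "openin Vt ?O" using O(1) c(1) by (simp add: openin_X)
    from openin_continuous_map_preimage[OF fc this]
    have D': "openin (prod_topology Vt Vt) {x \<in> topspace (subtopology (prod_topology Vt Vt) ?D). ?f x \<in> ?O}" (is "openin _ ?D'")
      using openin_trans_full[OF _ D] by blast
    have "(u, v) \<in> ?D'"
    proof -
      have "?f (u, v) \<in> g1" "pt c (?f (u, v)) = mm p q" using pc_loc_rep[OF a(1) b(1) c(1) uv] a b by auto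
      moreover have "(u, v) \<in> topspace (subtopology (prod_topology Vt Vt) ?D)" using uv a b by auto
      ultimately show ?thesis using M(3) by simp
    qed
    then obtain A B where AB: "openin Vt A" "openin Vt B" "u \<in> A" "v \<in> B" "A \<times> B \<subseteq> ?D'"
      using D'[unfolded openin_prod_topology_alt, rule_format, of u v] by blast
    have Dsub: "?D' \<subseteq> ?D" by auto
    have AD: "A \<subseteq> Dom MM a" "B \<subseteq> Dom MM b" using AB(3-5) subset_trans[OF Dsub MD_sub] by blast+
    have oA: "openin ?T (pt a ` A)" "openin ?T (pt b ` B)"
      using pt_open[OF a(1) AB(1)] pt_open[OF b(1) AB(2)] AD by (auto simp: openin_open_subtopology[OF M_open])
    show "\<exists>T. openin (prod_topology ?T ?T) T \<and> P \<in> T \<and> T \<subseteq> {P \<in> MM \<times> MM. mp P \<in> O'}"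
    proof (intro exI conjI)
      show "openin (prod_topology ?T ?T) (pt a ` A \<times> pt b ` B)" using oA by (simp add: openin_prod_Times_iff)
      show "P \<in> pt a ` A \<times> pt b ` B" unfolding pq a(3) b(3) using AB by blast
      show "pt a ` A \<times> pt b ` B \<subseteq> {P \<in> MM \<times> MM. mp P \<in> O'}"
      proof
        fix Q assume "Q \<in> pt a ` A \<times> pt b ` B"
        then obtain u' v' where Q: "u' \<in> A" "v' \<in> B" "Q = (pt a u', pt b v')" by blast
        then have "(u', v') \<in> ?D'" using AB(5) by blast
        then have x: "(u', v') \<in> ?D" "pt c (?f (u', v')) \<in> O'" using Dsub by auto
        then have "mm (pt a u') (pt b v') \<in> O'" using pc_loc_rep[OF a(1) b(1) c(1) x(1)] by simp
        then show "Q \<in> {P \<in> MM \<times> MM. mp P \<in> O'}" unfolding Q(3) using Q AD by auto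
      qed
    qed
  qed
qed

lemma mp_smooth: "smooth_map PM (mf MM) mp"
  unfolding smooth_map_def
proof (intro conjI ballI)
  show "continuous_map (mfd_top PM) (mfd_top (mf MM)) mp" using mp_continuous by (simp only: PM_simps mf_simps)
  fix C C' assume "C \<in> atlas PM" "C' \<in> atlas (mf MM)"
  then obtain a b c where g: "a \<in> GG L" "b \<in> GG L" "c \<in> GG L" "C = pc a b" "C' = ch MM c"
    unfolding PM_simps mf_simps by blast
  show "smooth_on (model PM) (model (mf MM)) (loc_dom C mp C') (loc_rep C mp C')"
    unfolding g(4,5) PM_simps(1) mf_simps(1) pc_loc_dom[OF g(1-3)] by (rule mm_smooth[OF g(1-3) pc_loc_rep[OF g(1-3)]])
qed

subsection \<open>The tangent map of the multiplication\<close>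

text \<open>The value of a tangent map collects the coordinates computed from all charts at the source; here they agree.\<close>

lemma tau_comprehension2:
  assumes p: "p \<in> MM" and S: "S \<noteq> {}"
    and D: "\<And>h y c v. h \<in> GG L \<Longrightarrow> y \<in> g1 \<Longrightarrow> p = pt h y \<Longrightarrow> (c, v) \<in> S \<Longrightarrow> D (ch MM h) c v = xi h y X"
  shows "{(c', D c' c v) | c' c v. c' \<in> atlas (mf MM) \<and> p \<in> fst c' \<and> (c, v) \<in> S} = snd (tau MM p X)"
proof -
  obtain c0 v0 where s: "(c0, v0) \<in> S" using S by (metis ex_in_conv surj_pair)
  have "D c' c v = D c' c0 v0" if c': "c' \<in> atlas (mf MM) \<and> p \<in> fst c'" "(c, v) \<in> S" for c' c v
  proof -
    obtain h y where h: "h \<in> GG L" "y \<in> g1" "p = pt h y" "c' = ch MM h" using p_atlas[OF M_open p] c'(1) by blast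
    show ?thesis unfolding h(4) D[OF h(1-3) c'(2)] D[OF h(1-3) s] ..
  qed
  then have "{(c', D c' c v) | c' c v. c' \<in> atlas (mf MM) \<and> p \<in> fst c' \<and> (c, v) \<in> S}
      = {(c', D c' c0 v0) | c'. c' \<in> atlas (mf MM) \<and> p \<in> fst c'}"
    using s by blast
  also have "\<dots> = snd (tau MM p X)" by (rule tau_comprehension[OF M_open p D[OF _ _ _ s]])
  finally show ?thesis .
qed

lemma tpair_elem: "(C, V) \<in> snd (tpair \<xi> \<eta>) \<longleftrightarrow> 
  (\<exists>c c' v w. C = prod_chart c c' \<and> V = (v, w) \<and> (c, v) \<in> snd \<xi> \<and> (c', w) \<in> snd \<eta>)"
  unfolding tpair_def snd_conv by blast

lemma tau_nonempty: assumes "p \<in> MM" shows "\<exists>c v. (c, v) \<in> snd (tau MM p X)"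
proof -
  obtain a u where "a \<in> GG L" "u \<in> Dom MM a" "p = pt a u" using assms by (rule MM_pt)
  then show ?thesis unfolding tau_def snd_conv by blast
qed

text \<open>The symmetry at \<open>o\<^sup>+\<close> varies with velocity \<open>2(X + \<theta> X)\<close>, by \<open>tilde_algebra\<close>.\<close>

lemma Tm_base:
  assumes X: "X \<in> g1" and q: "q \<in> MM"
  shows "tangent_map PM (mf MM) mp (tpair (tau MM base X) (tau MM q 0)) = tau MM (mm base q) ((X + \<theta> X) + (X + \<theta> X))"
proof -
  let ?t = "tpair (tau MM base X) (tau MM q 0)" and ?S = "(X + \<theta> X) + (X + \<theta> X)"
  have f: "fst ?t = (base, q)" by (simp add: tpair_def)
  note B = base_non_isotropic
  have mq: "mm base q \<in> MM" by (rule M_mult_closed[OF B q])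
  have "snd (tangent_map PM (mf MM) mp ?t) = snd (tau MM (mm base q) ?S)"
    unfolding tangent_map_def snd_conv f prod.case PM_simps(1) mf_simps(1)
  proof (rule tau_comprehension2[OF mq])
    obtain c v where c: "(c, v) \<in> snd (tau MM base X)" using tau_nonempty[OF B] by blast
    obtain c' v' where c': "(c', v') \<in> snd (tau MM q 0)" using tau_nonempty[OF q] by blast
    have "(prod_chart c c', (v, v')) \<in> snd ?t" unfolding tpair_elem using c c' by blast
    then show "snd ?t \<noteq> {}" by blast
  next
    fix c w C V assume c: "c \<in> GG L" "w \<in> g1" "mm base q = pt c w" and CV: "(C, V) \<in> snd ?t"
    obtain a u b v where a: "a \<in> GG L" "u \<in> g1" "base = pt a u" and b: "b \<in> GG L" "v \<in> g1" "q = pt b v"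
      and CV': "C = pc a b" "V = (xi a u X, xi b v 0)"
      using CV unfolding tpair_elem tau_def snd_conv by blast
    have uD: "u \<in> Dom MM a" "v \<in> Dom MM b" using a b B q by auto
    let ?x = "(u, v)" and ?v = "xi a u X"
    have x: "?x \<in> MD a b c" unfolding MD_def using uD a b c by auto
    note G = a(1) b(1) c(1)
    let ?f = "loc_rep (pc a b) mp (ch MM c)"
    have fx: "?f ?x = w"
    proof -
      have "?f ?x \<in> g1" "pt c (?f ?x) = pt c w" using pc_loc_rep[OF G x] a(3) b(3) c(3) by auto
      then show ?thesis using pt_inj[OF c(1) _ c(2)] by blast
    qed
    have sx: "snd C (base, q) = ?x" unfolding CV'(1) pc_snd using a b by (simp only: ch_snd)
    let ?z = "zc a u" and ?\<alpha> = "a \<circ> ex u"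
    define z' where "z' = p1 (ex (- ?z) (- \<theta> ?v + ex (- \<theta> u) (tw a ?v)))"
    have z1: "?z \<in> g1" using zc[OF a(1) uD(1)] by blast
    have y: "\<theta> ?z \<in> gm" using z1 by (simp add: theta_in)
    let ?\<gamma> = "?\<alpha> \<circ> ex (\<theta> ?z)"
    have fr: "frame base ?\<gamma>" using zc_frame[OF a(1) uD(1)] a(3) by simp
    have \<gamma>: "degree_zero ?\<gamma>" using fr by (intro frame_stab) (simp_all add: frame_def GG_aut)
    have i\<alpha>: "inv ?\<alpha> = ex (- u) \<circ> inv a"
      by (rule inv_equality) (use a in \<open>auto simp: ex_cancel GG_cancel\<close>)
    have av: "?\<alpha> ?v = a ?v" using a(2) by (simp add: ex_same)
    have "tw a ?v = \<theta> (inv a (\<theta> (a ?v)))" by (simp add: tw_def)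
    then have "ex (- \<theta> u) (tw a ?v) = \<theta> (inv ?\<alpha> (\<theta> (?\<alpha> ?v)))" unfolding i\<alpha> av by (simp add: theta_ex)
    then have z'': "z' = p1 (ex (- \<theta> (\<theta> ?z)) (- \<theta> ?v + \<theta> (inv ?\<alpha> (\<theta> (?\<alpha> ?v)))))" unfolding z'_def by simp
    have \<alpha>: "?\<alpha> = ?\<gamma> \<circ> ex (- \<theta> ?z)" using y by (auto simp: ex_cancel)
    have vX: "?v = p1 (inv ?\<alpha> X)" unfolding i\<alpha> xi_def by simp
    have S: "?\<alpha> ?v + ?\<alpha> (\<theta> z' + \<theta> z') + ?\<alpha> (ex (\<theta> ?z + \<theta> ?z) ?v) = ?S"
      by (rule tilde_algebra[OF \<gamma> y X \<alpha> vX z''])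
    have "a (?v + ex u ((\<theta> z' + \<theta> z') + ex (\<theta> ?z + \<theta> ?z) ?v)) = ?S"
      using S unfolding av by (simp add: ex_lin autD(2)[OF GG_aut[OF a(1)]] algebra_simps)
    moreover have "V = (?v, 0)" using CV'(2) b by (simp add: xi_zero)
    ultimately show "differential V2m (V_module L) (loc_dom C mp (ch MM c)) (loc_rep C mp (ch MM c)) (snd C (base, q)) V = xi c w ?S"
      unfolding sx using mm_differential[OF G pc_loc_rep[OF G] x xi_in, of a u X]
      by (simp add: CV'(1) pc_loc_dom[OF G] fx Let_def z'_def)
  qed
  then show ?thesis by (intro prod_eqI) (simp_all add: tangent_map_def f)
qed

text \<open>The inner application sends \<open>(0\<^sub>o, 0\<^sub>p)\<close> to the zero vector at \<open>m(o, p)\<close>; the outer one moves it back to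
  \<open>m(o, m(o, p)) = p\<close> with the velocity of the moving symmetry, and one half removes the factor 2.\<close>

lemma tilde_tau:
  assumes X: "X \<in> g1" and p: "p \<in> MM"
  shows "tilde_field (mf MM) mm base (tau MM base X) p = tau MM p (X + \<theta> X)"
proof -
  note B = base_non_isotropic
  have q: "mm base p \<in> MM" by (rule M_mult_closed[OF B p])
  have 1: "tangent_map PM (mf MM) mp (tpair (tau MM base 0) (tau MM p 0)) = tau MM (mm base p) 0"
    using Tm_base[OF gr_closed(1) p] by simp
  have "tilde_field (mf MM) mm base (tau MM base X) p = tscal (mf MM) half (tau MM (mm base (mm base p)) ((X + \<theta> X) + (X + \<theta> X)))"
    unfolding tilde_field_def Let_def tzero_tau[OF M_open B] tzero_tau[OF M_open p] 1 Tm_base[OF X q] ..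
  also have "\<dots> = tau MM p (X + \<theta> X)"
    unfolding M_mult_invol[OF B] tscal_tau[OF M_open p] half_double ..
  finally show ?thesis .
qed

subsection \<open>The tangent map of a symmetry\<close>

text \<open>The letter \<open>v\<close> of the second point is turned into \<open>\<delta> v = -v\<close> when \<open>\<delta>\<close> is moved to the right end.\<close>

lemma symmetry_coordinate:
  assumes b: "b \<in> GG L" and c: "c \<in> GG L" and g: "frame p g"
  shows "mm p (pt b v) = pt c w \<longleftrightarrow> act ((inv c \<circ> (sy g \<circ> b \<circ> \<delta>)) \<circ> ex (\<delta> v)) base = embed_V L w"
proof -
  have "sy g \<circ> (b \<circ> ex v) = (sy g \<circ> b \<circ> \<delta>) \<circ> ex (\<delta> v) \<circ> \<delta>"
    by (rule ext) (simp add: aut_ex[OF delta_aut, of v, symmetric])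
  then have "mm p (pt b v) = act ((sy g \<circ> b \<circ> \<delta>) \<circ> ex (\<delta> v)) base"
    unfolding M_mult_frame[OF g] pt_base by (metis act_comp degree_zero_base[OF delta_degree_zero])
  then show ?thesis using act_pt[OF c, of "(sy g \<circ> b \<circ> \<delta>) \<circ> ex (\<delta> v)" w] by (simp add: o_assoc)
qed

lemma symmetry_loc:
  assumes b: "b \<in> GG L" and c: "c \<in> GG L" and p: "p \<in> MM"
  shows "loc_dom (ch MM b) (mm p) (ch MM c) = {v \<in> Dom MM b. \<exists>w\<in>g1. mm p (pt b v) = pt c w}"
    and "v \<in> Dom MM b \<Longrightarrow> w \<in> g1 \<Longrightarrow> mm p (pt b v) = pt c w \<Longrightarrow> loc_rep (ch MM b) (mm p) (ch MM c) v = w"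
proof -
  show "loc_dom (ch MM b) (mm p) (ch MM c) = {v \<in> Dom MM b. \<exists>w\<in>g1. mm p (pt b v) = pt c w}"
  proof (intro equalityI subsetI)
    fix v assume "v \<in> loc_dom (ch MM b) (mm p) (ch MM c)"
    then obtain q where q: "v = snd (ch MM b) q" "q \<in> fst (ch MM b)" "mm p q \<in> fst (ch MM c)" unfolding loc_dom_def by blast
    obtain u where u: "u \<in> Dom MM b" "q = pt b u" using q(2) unfolding ch_mem by blast
    have "v = u" using u q(1) ch_snd[OF b, of u MM] by simp
    moreover obtain w where "w \<in> g1" "mm p q = pt c w" using q(3) unfolding ch_mem by blast
    ultimately show "v \<in> {v \<in> Dom MM b. \<exists>w\<in>g1. mm p (pt b v) = pt c w}" using u by blast
  next
    fix v assume "v \<in> {v \<in> Dom MM b. \<exists>w\<in>g1. mm p (pt b v) = pt c w}"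
    then obtain w where v: "v \<in> Dom MM b" "w \<in> g1" "mm p (pt b v) = pt c w" by blast
    have v1: "v \<in> g1" "pt b v \<in> MM" using v(1) by blast+
    have "pt b v \<in> fst (ch MM b)" unfolding ch_mem using v(1) by blast
    moreover have "mm p (pt b v) \<in> fst (ch MM c)" using M_mult_closed[OF p v1(2)] v unfolding ch_mem by auto
    moreover have "v = snd (ch MM b) (pt b v)" using ch_snd[OF b v1(1), of MM] by simp
    ultimately show "v \<in> loc_dom (ch MM b) (mm p) (ch MM c)" unfolding loc_dom_def by blast
  qed
  show "loc_rep (ch MM b) (mm p) (ch MM c) v = w" if v: "v \<in> Dom MM b" "w \<in> g1" "mm p (pt b v) = pt c w"
    unfolding loc_rep_def ch_inv[OF b v(1)] v(3) by (rule ch_snd[OF c v(2)])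
qed

text \<open>With a frame \<open>g\<close> at \<open>p\<close>, the symmetry acts on infinitesimal actions at \<open>p\<close> as \<open>g \<delta> g\<^sup>-\<^sup>1\<close>, and \<open>\<delta>\<close> is \<open>-1\<close> on
  the component of degree 1 in the chart of \<open>g\<close>.\<close>

lemma symmetry_tangent:
  assumes p: "p \<in> MM" shows "tangent_map (mf MM) (mf MM) (mm p) (tau MM p X) = tau MM p (- X)"
proof -
  obtain g where g: "frame p g" using non_isotropic_frame[OF p] by blast
  have gG: "g \<in> GG L" using g by (simp add: frame_def)
  have pg: "p = pt g 0" using g by (simp add: pt_base frame_def)
  note idem = M_mult_idem[OF p]
  have "snd (tangent_map (mf MM) (mf MM) (mm p) (tau MM p X)) = snd (tau MM p (- X))"
    unfolding tangent_map_def snd_conv fst_tau idem mf_simps(1)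
  proof (rule tau_comprehension2[OF p])
    show "snd (tau MM p X) \<noteq> {}" using tau_nonempty[OF p] by blast
  next
    fix c w C V assume c: "c \<in> GG L" "w \<in> g1" "p = pt c w" and CV: "(C, V) \<in> snd (tau MM p X)"
    obtain b u where b: "b \<in> GG L" "u \<in> g1" "p = pt b u" and CV': "C = ch MM b" "V = xi b u X"
      using CV unfolding tau_def snd_conv by blast
    let ?U = "loc_dom (ch MM b) (mm p) (ch MM c)" and ?f = "loc_rep (ch MM b) (mm p) (ch MM c)"
    let ?k = "inv c \<circ> (sy g \<circ> b \<circ> \<delta>)"
    have "sy g \<circ> b \<circ> \<delta> = g \<circ> (\<delta> \<circ> (inv g \<circ> b) \<circ> \<delta>)" by (auto simp: sy_def)
    then have k: "?k \<in> GG L" using gG b(1) c(1) by (auto intro!: delta_GG GG.intros)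
    let ?l = "V.kl ?k @ [(\<lambda>s. - leaf s, \<lambda>N. - leaf (dir N))]"
    have D: "openin (mod_top (V_module L)) (Dom MM b)" using Dom_open[OF M_open b(1)] by simp
    have ll: "\<forall>q\<in>set ?l. V.letter U (fst q) (snd q)" if U: "openin (mod_top (V_module L)) U" for U
    proof -
      have "V.letter U (\<lambda>s. leaf s) (\<lambda>N. leaf (dir N))" by (rule V.letter_linear[OF U]) auto
      from V.letter_minus[OF this] show ?thesis using V.kl_letter[OF k, of U] by simp
    qed
    have Ww: "act (V.wd ?l v) base = embed_V L w' \<longleftrightarrow> mm p (pt b v) = pt c w'" if v: "v \<in> g1" for v w'
    proof -
      have "V.wd ?l v = ?k \<circ> ex (- v)" by (simp add: W_append V.kl_W[OF k])
      moreover have "\<delta> v = - v" using v by (simp add: delta_gr)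
      ultimately show ?thesis using symmetry_coordinate[OF b(1) c(1) g, of v w'] by simp
    qed
    have Ueq: "?U = {v \<in> Dom MM b. \<exists>w\<in>g1. act (V.wd ?l v) base = embed_V L w}"
      unfolding symmetry_loc(1)[OF b(1) c(1) p] using Ww by blast
    have U: "openin (mod_top (V_module L)) ?U" unfolding Ueq by (rule V.open_coordinate[OF D ll[OF D]])
    have f: "?f v \<in> g1 \<and> act (V.wd ?l v) base = embed_V L (?f v)" if v: "v \<in> ?U" for v
    proof -
      obtain w' where w': "v \<in> Dom MM b" "w' \<in> g1" "mm p (pt b v) = pt c w'"
        using v unfolding symmetry_loc(1)[OF b(1) c(1) p] by blast
      then have "?f v = w'" by (intro symmetry_loc(2)[OF b(1) c(1) p])
      moreover have "v \<in> g1" using w' by blast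
      ultimately show ?thesis using Ww[of v w'] w' by simp
    qed
    have uD: "u \<in> Dom MM b" using b p by simp
    have mu: "mm p (pt b u) = pt c w" using idem b(3) c(3) by simp
    have uU: "u \<in> ?U" unfolding symmetry_loc(1)[OF b(1) c(1) p] using uD mu c(2) by blast
    have fu: "?f u = w" by (rule symmetry_loc(2)[OF b(1) c(1) p uD c(2) mu])
    have Vc: "V \<in> carr (V_module L)" "V \<in> g1" unfolding CV'(2) by simp_all
    have sC: "snd (ch MM b) p = u" unfolding b(3) by (rule ch_snd[OF b(1,2)])
    have "differential (V_module L) (V_module L) ?U ?f u V
        = p1 (ex (- ?f u) (lam (map (\<lambda>q. (fst q (Leaf u), snd q (Node (Leaf u) (Leaf V) 0))) ?l)))"
      by (rule V.differential_family[OF U ll[OF U] f uU Vc(1)])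
    also have "lam (map (\<lambda>q. (fst q (Leaf u), snd q (Node (Leaf u) (Leaf V) 0))) ?l) = ?k (- V)"
      by (simp add: V.kl_lam[OF k])
    also have "p1 (ex (- ?f u) (?k (- V))) = xi c w (sy g (b V))"
      unfolding fu xi_def using Vc(2) by (simp add: delta_gr gr_closed)
    also have "\<dots> = xi c w (g (xi g 0 (sy g (b V))))" using xi_change[OF gG c(1) gr_closed(1) c(2)] pg c(3) by simp
    also have "xi g 0 (sy g (b V)) = - xi g 0 (b V)" by (simp add: xi_def sy_def GG_cancel[OF gG] p_delta)
    also have "xi c w (g (- xi g 0 (b V))) = - xi c w (g (xi g 0 (b V)))"
      by (simp add: autD(5)[OF GG_aut[OF gG]] xi_minus[OF c(1)])
    also have "xi c w (g (xi g 0 (b V))) = xi c w (b V)" using xi_change[OF gG c(1) gr_closed(1) c(2)] pg c(3) by simp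
    also have "\<dots> = xi c w X" unfolding CV'(2) using xi_change[OF b(1) c(1) b(2) c(2)] b(3) c(3) by simp
    finally show "differential (V_module L) (V_module L) (loc_dom C (mm p) (ch MM c)) (loc_rep C (mm p) (ch MM c)) (snd C p) V = xi c w (- X)"
      unfolding CV'(1) sC by (simp add: xi_minus[OF c(1)])
  qed
  then show ?thesis by (intro prod_eqI) (simp_all add: tangent_map_def idem)
qed

text \<open>In the chart of a frame the symmetry is \<open>v \<mapsto> -v\<close>, and \<open>-v = v\<close> forces \<open>v = 0\<close> as 2 is invertible.\<close>

lemma isolated_symmetry:
  assumes p: "p \<in> MM" shows "isolated_fixed_point (subtopology (X_top L) MM) (mm p) p"
proof -
  obtain g where g: "frame p g" using non_isotropic_frame[OF p] by blast
  have gG: "g \<in> GG L" using g by (simp add: frame_def)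
  have pg: "p = pt g 0" using g by (simp add: pt_base frame_def)
  let ?N = "pt g ` Dom MM g"
  have o: "openin (subtopology (X_top L) MM) ?N"
    unfolding openin_open_subtopology[OF M_open] using pt_open[OF gG Dom_open[OF M_open gG]] by blast
  have pN: "p \<in> ?N" using p pg by (intro image_eqI[of _ _ 0]) auto
  have "q = p" if q: "q \<in> ?N" and fixed: "mm p q = q" for q
  proof -
    obtain v where v: "v \<in> g1" "q = pt g v" using q by blast
    have "sy g \<circ> g = g \<circ> \<delta>" by (auto simp: sy_def GG_cancel[OF gG])
    then have "mm p q = act (g \<circ> \<delta>) (embed_V L v)" unfolding M_mult_frame[OF g] v(2) pt_def by (metis act_comp)
    also have "\<dots> = pt g (- v)" using v by (simp add: act_comp degree_zero_embed[OF delta_degree_zero] delta_gr pt_def)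
    finally have "pt g (- v) = pt g v" using fixed v by simp
    then have "- v = v" using pt_inj[OF gG gr_closed(4)[OF v(1)] v(1)] by simp
    then have "v = 0" by (metis add.right_inverse double_zero)
    then show ?thesis using v pg by simp
  qed
  then show ?thesis unfolding isolated_fixed_point_def using M_mult_idem[OF p] o pN by blast
qed

subsection \<open>The Lie triple product\<close>

lemma mf_MM: "M_mfd L = mf MM" by (simp add: M_mfd_def)

lemma base_pt: "base = pt id 0" by (simp add: pt_base)

lemma V_tangent_tau: "v \<in> g1 \<Longrightarrow> V_tangent L v = tau MM base v"
  unfolding V_tangent_def mf_MM using tvec_tau[OF M_open base_non_isotropic GG.one gr_closed(1) base_pt] by simp

lemma xi_id: "xi id 0 X = p1 X" by (simp add: xi_def inv_id)

lemma tau_base_p1: "tau MM base X = tau MM base (p1 X)"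
proof (rule tau_cong[OF M_open])
  fix g x assume g: "g \<in> GG L" "x \<in> g1" "base = pt g x"
  show "xi g x X = xi g x (p1 X)" using xi_change[OF GG.one g(1) gr_closed(1) g(2), of X] g(3) base_pt by (simp add: xi_id)
qed

lemma tau_base_inj: assumes "v \<in> g1" "w \<in> g1" "tau MM base v = tau MM base w" shows "v = w"
proof -
  have "xi id 0 v = coord (tau MM base v) (ch MM id)" "xi id 0 w = coord (tau MM base w) (ch MM id)"
    using coord_tau[OF M_open base_non_isotropic GG.one gr_closed(1) base_pt] by simp_all
  then show ?thesis using assms by (simp add: xi_id p_gr)
qed

text \<open>Two brackets of fields produce two signs, which cancel.\<close>

lemma lts_tau:
  assumes x: "x \<in> g1" and y: "y \<in> g1" and z: "z \<in> g1"
  shows "lts_bracket (mf MM) mm base (tau MM base x) (tau MM base y) (tau MM base z)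
    = tau MM base (triple L x y z - triple L y x z)"
proof -
  let ?h = "\<lambda>v. v + \<theta> v"
  have ce: "celem (?h v)" if "v \<in> g1" for v using that by (intro celem_add celem_gr) (simp_all add: theta_in)
  have 1: "lie_bracket (mf MM) (tilde_field (mf MM) mm base (tau MM base x)) (tilde_field (mf MM) mm base (tau MM base y)) q
      = tau MM q (- (?h x \<star> ?h y))" if "q \<in> MM" for q
    using tilde_tau[OF x] tilde_tau[OF y] that by (intro lie_bracket_tau[OF M_open _ _ ce[OF x] ce[OF y]])
  have "lts_bracket (mf MM) mm base (tau MM base x) (tau MM base y) (tau MM base z) = tau MM base (- (- (?h x \<star> ?h y) \<star> ?h z))"
    unfolding lts_bracket_def
    by (rule lie_bracket_tau[OF M_open 1 tilde_tau[OF z] celem_minus[OF celem_br[OF ce[OF x] ce[OF y]]] ce[OF z] base_non_isotropic])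
  also have "\<dots> = tau MM base (p1 ((?h x \<star> ?h y) \<star> ?h z))" by (subst tau_base_p1) simp
  also have "p1 ((?h x \<star> ?h y) \<star> ?h z) = (x \<star> \<theta> y + \<theta> x \<star> y) \<star> z"
    using x y z by (simp add: p_br p_gr theta_in)
  also have "\<dots> = triple L x y z - triple L y x z"
    using br_anti[of "\<theta> x" y] by (simp add: triple_def br_diff)
  finally show ?thesis .
qed

lemma non_isotropic_symmetric_space:
  "open_submanifold (X_mfd L) MM \<and> base \<in> MM \<and> symmetric_space (mf MM) mm \<and>
    (\<forall>x\<in>MM. isolated_fixed_point (mfd_top (mf MM)) (mm x) x)"
proof (intro conjI ballI)
  have "openin (X_top L) (X_plus L)" using openin_topspace[of "X_top L"] by (simp add: topspace_X)
  from smooth_manifold_mf[OF this] have "smooth_manifold (X_mfd L)" by (simp add: mf_all)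
  then show "open_submanifold (X_mfd L) MM" using M_open by (simp add: open_submanifold_def X_mfd_def)
  show "base \<in> MM" by (rule base_non_isotropic)
  have P: "pts (mf MM) = MM" unfolding mf_simps by (rule topspace_MM)
  show "symmetric_space (mf MM) mm" unfolding symmetric_space_def P
  proof (intro conjI ballI)
    show "smooth_manifold (mf MM)" by (rule smooth_manifold_mf[OF M_open])
    show "smooth_map PM (mf MM) mp" by (rule mp_smooth)
    show "mm x x = x" if "x \<in> MM" for x using M_mult_idem that .
    show "mm x (mm x y) = y" if "x \<in> MM" for x y using M_mult_invol that .
    show "mm x (mm y z) = mm (mm x y) (mm x z)" if "x \<in> MM" "y \<in> MM" for x y z using M_mult_distrib that .
    fix x \<xi> assume x: "x \<in> MM" and \<xi>: "\<xi> \<in> tangent_space (mf MM) x"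
    then obtain X where "\<xi> = tau MM x X" using tangent_space_tau[OF M_open x] by blast
    then show "tangent_map (mf MM) (mf MM) (mm x) \<xi> = tneg \<xi>"
      using symmetry_tangent[OF x] tneg_tau[OF M_open x] by simp
  qed
  show "isolated_fixed_point (mfd_top (mf MM)) (mm x) x" if "x \<in> MM" for x
    unfolding mf_simps by (rule isolated_symmetry[OF that])
qed

lemma lie_triple_system_at_base:
  "bij_betw (V_tangent L) g1 (tangent_space (mf MM) base) \<and>
   (\<forall>u\<in>g1. \<forall>v\<in>g1. V_tangent L (u + v) = tadd (V_tangent L u) (V_tangent L v)) \<and>
   (\<forall>t. \<forall>v\<in>g1. V_tangent L (t \<cdot> v) = tscal (mf MM) t (V_tangent L v)) \<and>
   (\<forall>x\<in>g1. \<forall>y\<in>g1. \<forall>z\<in>g1. lts_bracket (mf MM) mm base (V_tangent L x) (V_tangent L y) (V_tangent L z)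
       = V_tangent L (triple L x y z - triple L y x z))"
proof (intro conjI ballI allI)
  note B = base_non_isotropic
  show "bij_betw (V_tangent L) g1 (tangent_space (mf MM) base)" unfolding bij_betw_def
  proof
    show "inj_on (V_tangent L) g1" by (rule inj_onI, rule tau_base_inj) (simp_all add: V_tangent_tau)
    have "V_tangent L ` g1 = tau MM base ` g1" by (rule image_cong[OF refl]) (rule V_tangent_tau)
    moreover have "range (tau MM base) \<subseteq> tau MM base ` g1"
    proof
      fix t assume "t \<in> range (tau MM base)"
      then obtain X where "t = tau MM base X" by blast
      then have "t = tau MM base (p1 X)" using tau_base_p1[of X] by simp
      then show "t \<in> tau MM base ` g1" by simp
    qed
    ultimately show "V_tangent L ` g1 = tangent_space (mf MM) base"
      unfolding tangent_space_tau[OF M_open B] by blast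
  qed
  show "V_tangent L (u + v) = tadd (V_tangent L u) (V_tangent L v)" if "u \<in> g1" "v \<in> g1" for u v
    using that by (simp add: V_tangent_tau gr_closed tadd_tau[OF M_open B])
  show "V_tangent L (t \<cdot> v) = tscal (mf MM) t (V_tangent L v)" if "v \<in> g1" for t v
    using that by (simp add: V_tangent_tau gr_closed tscal_tau[OF M_open B])
  show "lts_bracket (mf MM) mm base (V_tangent L x) (V_tangent L y) (V_tangent L z)
       = V_tangent L (triple L x y z - triple L y x z)" if "x \<in> g1" "y \<in> g1" "z \<in> g1" for x y z
  proof -
    have "triple L x y z - triple L y x z \<in> g1"
      unfolding triple_def using that by (intro gr_closed br_gr) (simp_all add: theta_in)
    then show ?thesis using that by (simp add: V_tangent_tau lts_tau)
  qed
qed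

end

theorem theorem6p3:
  fixes L :: "('k::topological_comm_ring_1, 'g::ab_group_add) jts"
  assumes "calculus_ring TYPE('k)"
    and "involutive_graded_lie_algebra L"
    and "C1_jordan_triple_system L"
  shows
    "(open_submanifold (X_mfd L) (non_isotropic L) \<and>
      o_plus L \<in> non_isotropic L \<and>
      symmetric_space (M_mfd L) (M_mult L) \<and>
      (\<forall>x \<in> non_isotropic L. isolated_fixed_point (mfd_top (M_mfd L)) (M_mult L x) x)) \<and>
     (bij_betw (V_tangent L) (VV L) (tangent_space (M_mfd L) (o_plus L)) \<and>
      (\<forall>u \<in> VV L. \<forall>v \<in> VV L. V_tangent L (u + v) = tadd (V_tangent L u) (V_tangent L v)) \<and>
      (\<forall>t. \<forall>v \<in> VV L. V_tangent L (smul L t v) = tscal (M_mfd L) t (V_tangent L v)) \<and>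
      (\<forall>x \<in> VV L. \<forall>y \<in> VV L. \<forall>z \<in> VV L.
         lts_bracket (M_mfd L) (M_mult L) (o_plus L) (V_tangent L x) (V_tangent L y) (V_tangent L z)
         = V_tangent L (triple L x y z - triple L y x z)))"
proof -
  interpret C1_setting L using assms by unfold_locales
  show ?thesis unfolding mf_MM by (rule conjI[OF non_isotropic_symmetric_space lie_triple_system_at_base])
qed

end
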